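(* For $e_0\in(0,1)$ let $z_{e_0}\in T^*\mathrm{SL}(3)$ denote the MacLaurin spheroid of eccentricity $e_0$ (for Dirichlet's Hamiltonian system, with symmetry group $G=\mathbb{Z}_2^\tau\ltimes(\mathrm{SO}(3)\times\mathrm{SO}(3))$, all as defined in the context), and let $e_{\mathrm{crit}}\simeq 0.952887$ be the zero in $(0,1)$ of the function $S_2$ defined in the context. For a relative equilibrium $z$ let $G_z$ be its stabilizer. Then: (a) (Type $I$.) For every $e_0\in(0,1)$ there is a family of relative equilibria $\tilde z_v$, defined for all nonzero $v$ close enough to the origin in a two-dimensional real vector space, bifurcating from the MacLaurin family at $z_{e_0}$ (with $\tilde z_v\to z_{e_0}$ as $v\to 0$), such that no $\tilde z_v$ lies in the $G$-orbit of a MacLaurin spheroid, $G_{\tilde z_v}$ is trivial, and every $\tilde z_v$ is a type $I$ ellipsoid (with ellipsoidal configuration). (b) (Type $S$.) For every $e_0\in(0,e_{\mathrm{crit}})$ there is a family of relative equilibria $\tilde z_v$, defined for all nonzero $v$ close enough to the origin in a two-dimensional real vector space, bifurcating from the MacLaurin family at $z_{e_0}$ (with $\tilde z_v\to z_{e_0}$ as $v\to 0$), such that no $\tilde z_v$ lies in the $G$-orbit of a MacLaurin spheroid, $G_{\tilde z_v}$ is the group of order two generated by $(e;R_{\mathbf{e}_3}(\pi),R_{\mathbf{e}_3}(\pi))$, and every $\tilde z_v$ is a type $S$ ellipsoid (with ellipsoidal configuration) for which $\xi_L,\xi_R\neq 0$ are parallel and of different lengths. (c) (Adjoint $S$.)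 For $e_0=e_{\mathrm{crit}}$ there is a family of relative equilibria $\tilde z_v$, defined for all nonzero $v$ close enough to the origin in a one-dimensional real vector space, bifurcating from the MacLaurin family at $z_{e_0}$ (with $\tilde z_v\to z_{e_0}$ as $v\to 0$), such that no $\tilde z_v$ lies in the $G$-orbit of a MacLaurin spheroid, $G_{\tilde z_v}$ is the group of order four generated by $(e;R_{\mathbf{e}_3}(\pi),R_{\mathbf{e}_3}(\pi))$ and $(\sigma;R_{\mathbf{e}_1}(\pi),R_{\mathbf{e}_1}(\pi))$, and every $\tilde z_v$ is an adjoint $S$ ellipsoid (with ellipsoidal configuration), that is, a type $S$ ellipsoid with $\xi_L=-\xi_R\neq 0$. (d) There are no other bifurcations from the MacLaurin family than the ones in (a), (b) and (c).
   Context: **Dirichlet's Hamiltonian system.** $\mathrm{SL}(3)$ is the group of real $3\times 3$ matrices of determinant $1$, with Riemannian metric $\ll A,B\gg=T\,\mathrm{tr}(A^TB)$ for $A,B\in T_F\mathrm{SL}(3)$, where $T=\frac{4\pi}{15}\rho_0$, and $\rho_0>0$ (density) and $\mathcal{G}>0$ (gravitational constant) are constants. Put $R=\frac{8}{15}\pi^2\mathcal{G}\rho_0^2$ and $$V(F)=-R\int_0^\infty\frac{ds}{\sqrt{s^3+I_1(F)s^2+I_2(F)s+1}},$$ $$I_1(F)=\mathrm{tr}(FF^T),\qquad I_2(F)=\tfrac12\left(\mathrm{tr}(FF^T)^2-\mathrm{tr}(FF^TFF^T)\right),$$ where $\mathrm{tr}(FF^T)^2$ means the square of the trace. The phase space is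 $T^*\mathrm{SL}(3)$ with its canonical symplectic form, and the Hamiltonian is $h(P_F)=\frac12\|P_F\|^2+V(F)$ for $P_F\in T_F^*\mathrm{SL}(3)$, where $\|\cdot\|$ is the fiberwise norm on covectors induced by $\ll\cdot,\cdot\gg$ (written $\frac{1}{2T}\mathrm{tr}(P_F^TP_F)$ for the kinetic energy in matrix form). **Symmetry.** $G=\mathbb{Z}_2^\tau\ltimes(\mathrm{SO}(3)\times\mathrm{SO}(3))$, where the nontrivial element $\sigma$ of $\mathbb{Z}_2^\tau$ swaps the two factors $\mathrm{SO}(3)$. Elements are written $(\gamma;g,k)$ with $\gamma\in\{e,\sigma\}$ and $g,k\in\mathrm{SO}(3)$. $G$ acts on $\mathrm{SL}(3)$ by $(e;g,k)\cdot F=gFk^T$ and $(\sigma;g,k)\cdot F=kF^Tg^T$, and on $T^*\mathrm{SL}(3)$ by the cotangent lift; $h$ is $G$-invariant. The Lie algebra of $G$ is identified with $\mathbb{R}^3\oplus\mathbb{R}^3\ni(\xi_L,\xi_R)$; the fundamental vector field is $(\xi_L,\xi_R)_{\mathrm{SL}(3)}(F)=\hat\xi_LF-F\hat\xi_R$, where $\hat\xi u=\xi\times u$. $G_z$ denotes the stabilizer of $z\in T^*\mathrm{SL}(3)$ in $G$. $R_{\mathbf{k}}(\theta)$ is the rotation of angle $\theta$ about the vector $\mathbf{k}$, and $\mathbf{e}_1,\mathbf{e}_2,\mathbf{e}_3$ is the standard basis of $\mathbb{R}^3$. **Relative equilibria.** $z\in T^*\mathrm{SL}(3)$ is a relative equilibrium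 with velocity $\xi=(\xi_L,\xi_R)$ if the Hamiltonian trajectory through $z$ is $z(t)=e^{t\xi}\cdot z$. Then $z=P_F=\ll(\xi_L,\xi_R)_{\mathrm{SL}(3)}(F),\cdot\gg$. All points of a $G$-orbit are regarded as the same relative equilibrium. By the singular value decomposition every $G$-orbit contains a point whose configuration $F$ is diagonal with positive entries $(a_1,a_2,a_3)$ (the semiaxes); the types below refer to such a representative. The configuration is called spherical, spheroidal or ellipsoidal if the number of distinct semiaxes is $1$, $2$ or $3$, respectively. The principal axes are the lines spanned by $\mathbf{e}_1,\mathbf{e}_2,\mathbf{e}_3$, and a principal plane $ij$ is the span of $\mathbf{e}_i,\mathbf{e}_j$. **Bifurcations.** A bifurcation occurs when, at specific values of the parameters, two or more distinct families (branches) of relative equilibria intersect; by convention the bifurcating relative equilibria must be of a distinct type from those of the original branch. **Types of relative equilibria with ellipsoidal configuration.** * Type $S$: $\xi_L$ and $\xi_R$ are parallel to the same principal axis. * Adjoint $S$: the type $S$ ellipsoids for which $\xi_L=-\xi_R\neq0$. * Type $I$: not of type $S$, $\xi_L$ and $\xi_R$ lie in the same principal plane $ij$, and $a_k\ge\frac12(a_i+a_j)$, where $\{i,j,k\}=\{1,2,3\}$. **MacLaurin spheroids.** For $e\in(0,1)$, the MacLaurin spheroid $z_e$ of eccentricity $e$ is the relative equilibrium $z_e=P_F$ with $$F=\mathrm{diag}\left((1-e^2)^{-1/6},(1-e^2)^{-1/6},(1-e^2)^{1/3}\right),\qquad(\xi_L,\xi_R)=\frac{\Omega(e)}{2}(\mathbf{e}_3,-\mathbf{e}_3),$$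 where $\Omega(e)>0$ is given by $$\frac{\Omega^2}{\pi\rho_0\mathcal{G}}=2\frac{\sqrt{1-e^2}}{e^3}(3-2e^2)\arcsin(e)-\frac{6}{e^2}(1-e^2).$$ (Velocities obtained by adding $\eta(\mathbf{e}_3,\mathbf{e}_3)$, $\eta\in\mathbb{R}$, give the same point $z_e$.) The MacLaurin family is the set of $G$-orbits of the points $z_e$, $e\in(0,1)$. **Critical eccentricity.** $e_{\mathrm{crit}}\simeq0.952887$ is the value of $e\in(0,1)$ at which $S_2(e)=0$, where $$S_2(e)=\frac{R}{e^5}\left(e(1-e^2)(3+4e^2)-\sqrt{1-e^2}\,(3+2e^2-4e^4)\arcsin(e)\right).$$ One has $S_2>0$ for $e<e_{\mathrm{crit}}$ and $S_2<0$ for $e>e_{\mathrm{crit}}$. *)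

theory Defs
  imports "HOL-Analysis.Analysis" "HOL-Algebra.Group_Action" "HOL-Algebra.Generated_Groups"
begin

type_synonym mat3 = "real^3^3"

type_synonym phase = "mat3 \<times> mat3"

text \<open>A velocity \<open>(\<xi>\<^sub>L, \<xi>\<^sub>R)\<close>.\<close>
type_synonym velocity = "(real^3) \<times> (real^3)"


section \<open>The phase space\<close>

definition SL3 :: "mat3 set" where
  "SL3 = {F. det F = 1}"

text \<open>For an embedded submanifold \<open>M\<close> of a normed space, \<open>tangent_space M x\<close> is the usual
  tangent space at \<open>x\<close>, realised as a subspace of the ambient space. Curves need only be
  differentiable at the base point; this gives the same velocities as smooth curves.\<close>

definition curve_in :: "'a::real_normed_vector set \<Rightarrow> (real \<Rightarrow> 'a) \<Rightarrow> 'a \<Rightarrow> 'a \<Rightarrow> bool" where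
  "curve_in M c x w \<longleftrightarrow> (\<forall>s. c s \<in> M) \<and> c 0 = x \<and> (c has_vector_derivative w) (at 0)"

definition tangent_space :: "'a::real_normed_vector set \<Rightarrow> 'a \<Rightarrow> 'a set" where
  "tangent_space M x = {w. \<exists>c. curve_in M c x w}"

text \<open>The phase space \<open>T\<^sup>*SL(3)\<close>. A covector at \<open>F\<close> is written \<open>A \<mapsto> tr (P\<^sup>T A)\<close> with the unique
  representing matrix \<open>P\<close> in \<open>T\<^sub>F SL(3)\<close>; this matrix does not contain the factor \<open>T\<close> of the metric.\<close>

definition phase_space :: "phase set" where
  "phase_space = {(F, P). F \<in> SL3 \<and> P \<in> tangent_space SL3 F}"

text \<open>The canonical form \<open>dF \<and> dP\<close>. In these coordinates the canonical one-form is
  \<open>(A, B) \<mapsto> tr (P\<^sup>T A)\<close>, so the canonical symplectic form of \<open>T\<^sup>*SL(3)\<close> is the restriction of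
  \<open>symp\<close> to the tangent spaces of \<^const>\<open>phase_space\<close>.\<close>

fun symp :: "phase \<Rightarrow> phase \<Rightarrow> real" where
  "symp (A, B) (A', B') = trace (transpose A ** B') - trace (transpose A' ** B)"


section \<open>Dirichlet's Hamiltonian\<close>

definition metric_const :: "real \<Rightarrow> real" where
  "metric_const rho0 = 4 * pi / 15 * rho0"

definition R_const :: "real \<Rightarrow> real \<Rightarrow> real" where
  "R_const rho0 grav = 8 / 15 * pi\<^sup>2 * grav * rho0\<^sup>2"

definition I1 :: "mat3 \<Rightarrow> real" where
  "I1 F = trace (F ** transpose F)"

definition I2 :: "mat3 \<Rightarrow> real" where
  "I2 F = ((trace (F ** transpose F))\<^sup>2
            - trace (F ** transpose F ** F ** transpose F)) / 2"

definition potential :: "real \<Rightarrow> real \<Rightarrow> mat3 \<Rightarrow> real" where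
  "potential rho0 grav F =
     - R_const rho0 grav * integral {0..} (\<lambda>s. 1 / sqrt (s^3 + I1 F * s\<^sup>2 + I2 F * s + 1))"

fun hamiltonian :: "real \<Rightarrow> real \<Rightarrow> phase \<Rightarrow> real" where
  "hamiltonian rho0 grav (F, P) =
     trace (transpose P ** P) / (2 * metric_const rho0) + potential rho0 grav F"

text \<open>\<open>X\<close> is the value at \<open>z\<close> of the Hamiltonian vector field of \<open>h\<close>, i.e.
  \<open>\<omega>(X, w) = dh(z) w\<close> for all \<open>w\<close> tangent to the phase space, \<open>dh(z) w\<close> being computed along a
  curve with velocity \<open>w\<close>.\<close>

definition is_ham_vector :: "(phase \<Rightarrow> real) \<Rightarrow> phase \<Rightarrow> phase \<Rightarrow> bool" where
  "is_ham_vector h z X \<longleftrightarrow>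
     X \<in> tangent_space phase_space z \<and>
     (\<forall>c w. curve_in phase_space c z w \<longrightarrow>
        ((\<lambda>s. h (c s)) has_real_derivative symp X w) (at 0))"

definition ham_trajectory :: "(phase \<Rightarrow> real) \<Rightarrow> (real \<Rightarrow> phase) \<Rightarrow> bool" where
  "ham_trajectory h c \<longleftrightarrow>
     (\<forall>t. c t \<in> phase_space \<and>
          (\<exists>X. (c has_vector_derivative X) (at t) \<and> is_ham_vector h (c t) X))"


section \<open>The symmetry group\<close>

text \<open>An element \<open>(\<gamma>; g, k)\<close> is the triple \<open>(s, g, k)\<close> with \<open>s = True\<close> iff \<open>\<gamma> = \<sigma>\<close>.\<close>
type_synonym sym = "bool \<times> mat3 \<times> mat3"

text \<open>The product is the one for which \<open>(\<gamma>; g, k) \<cdot> F\<close> is a left action, see \<open>act_mult\<close>; as the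
  action on \<open>SL(3)\<close> is faithful, there is no other choice.\<close>

fun sym_mult :: "sym \<Rightarrow> sym \<Rightarrow> sym" where
  "sym_mult (s, g, k) (s', g', k') =
     (s \<noteq> s', if s' then (k ** g', g ** k') else (g ** g', k ** k'))"

definition sym_group :: "sym monoid" where
  "sym_group = \<lparr> carrier = {(s, g, k). rotation_matrix g \<and> rotation_matrix k},
                 mult = sym_mult, one = (False, mat 1, mat 1) \<rparr>"

text \<open>Each group element acts on matrices by a map that is orthogonal for \<open>tr (A\<^sup>T B)\<close>. So in terms
  of the representing matrix \<open>P\<close> the cotangent lift is given by the same formula as the action.\<close>

fun act :: "sym \<Rightarrow> phase \<Rightarrow> phase" where
  "act (s, g, k) (F, P) =
     (if s then (k ** transpose F ** transpose g, k ** transpose P ** transpose g)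
      else (g ** F ** transpose k, g ** P ** transpose k))"

lemma act_mult: "act (sym_mult x y) z = act x (act y z)"
  by (cases x; cases y; cases z)
     (simp add: matrix_transpose_mul matrix_mul_assoc)

definition hat :: "real^3 \<Rightarrow> mat3" where
  "hat u = matrix (cross3 u)"

text \<open>The matrix exponential. The function \<^const>\<open>exp\<close> is not applicable, since the library's
  multiplication \<open>*\<close> on vectors and matrices is componentwise.\<close>

definition mexp :: "mat3 \<Rightarrow> mat3" where
  "mexp A = (\<Sum>n. (1 / fact n) *\<^sub>R (((**) A) ^^ n) (mat 1))"

definition exp_sym :: "velocity \<Rightarrow> sym" where
  "exp_sym xi = (False, mexp (hat (fst xi)), mexp (hat (snd xi)))"

definition fund :: "velocity \<Rightarrow> mat3 \<Rightarrow> mat3" where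
  "fund xi F = hat (fst xi) ** F - F ** hat (snd xi)"

text \<open>Rotation of angle \<open>\<theta>\<close> about the unit vector \<open>u\<close> (Rodrigues' formula).\<close>

definition rot :: "real^3 \<Rightarrow> real \<Rightarrow> mat3" where
  "rot u \<theta> = matrix (\<lambda>x. cos \<theta> *\<^sub>R x + sin \<theta> *\<^sub>R cross3 u x + ((1 - cos \<theta>) * (u \<bullet> x)) *\<^sub>R u)"


section \<open>Relative equilibria and their types\<close>

definition rel_equilibrium_vel :: "real \<Rightarrow> real \<Rightarrow> phase \<Rightarrow> velocity \<Rightarrow> bool" where
  "rel_equilibrium_vel rho0 grav z xi \<longleftrightarrow>
     z \<in> phase_space \<and>
     ham_trajectory (hamiltonian rho0 grav) (\<lambda>t. act (exp_sym (t *\<^sub>R xi)) z)"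

definition rel_equilibrium :: "real \<Rightarrow> real \<Rightarrow> phase \<Rightarrow> bool" where
  "rel_equilibrium rho0 grav z \<longleftrightarrow> (\<exists>xi. rel_equilibrium_vel rho0 grav z xi)"

abbreviation sym_orbit :: "phase \<Rightarrow> phase set" where
  "sym_orbit z \<equiv> orbit sym_group act z"

abbreviation isotropy :: "phase \<Rightarrow> sym set" where
  "isotropy z \<equiv> stabilizer sym_group act z"

definition diag :: "real^3 \<Rightarrow> mat3" where
  "diag a = (\<chi> i j. if i = j then a $ i else 0)"

text \<open>The orbit of \<open>z\<close> contains a relative equilibrium with diagonal ellipsoidal configuration
  whose semiaxes \<open>a\<close> and velocity \<open>xi\<close> satisfy \<open>Q\<close>. The velocity is unique, because the \<open>a $ i\<close>
  are positive and distinct.\<close>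

definition ellipsoid_with ::
  "real \<Rightarrow> real \<Rightarrow> (real^3 \<Rightarrow> velocity \<Rightarrow> bool) \<Rightarrow> phase \<Rightarrow> bool" where
  "ellipsoid_with rho0 grav Q z \<longleftrightarrow>
     (\<exists>a P xi. (diag a, P) \<in> sym_orbit z \<and> rel_equilibrium_vel rho0 grav (diag a, P) xi \<and>
        (\<forall>i. a $ i > 0) \<and> card (range (\<lambda>i. a $ i)) = 3 \<and> Q a xi)"

definition type_S :: "real^3 \<Rightarrow> velocity \<Rightarrow> bool" where
  "type_S a xi \<longleftrightarrow> (\<exists>i. fst xi \<in> span {axis i 1} \<and> snd xi \<in> span {axis i 1})"

definition adjoint_S :: "real^3 \<Rightarrow> velocity \<Rightarrow> bool" where
  "adjoint_S a xi \<longleftrightarrow> type_S a xi \<and> fst xi = - snd xi \<and> fst xi \<noteq> 0"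

definition type_I :: "real^3 \<Rightarrow> velocity \<Rightarrow> bool" where
  "type_I a xi \<longleftrightarrow>
     \<not> type_S a xi \<and>
     (\<exists>i j k. {i, j, k} = UNIV \<and>
        fst xi \<in> span {axis i 1, axis j 1} \<and> snd xi \<in> span {axis i 1, axis j 1} \<and>
        a $ k \<ge> (a $ i + a $ j) / 2)"


section \<open>MacLaurin spheroids\<close>

definition maclaurin_Omega :: "real \<Rightarrow> real \<Rightarrow> real \<Rightarrow> real" where
  "maclaurin_Omega rho0 grav e =
     sqrt (pi * rho0 * grav *
       (2 * sqrt (1 - e\<^sup>2) / e^3 * (3 - 2 * e\<^sup>2) * arcsin e - 6 / e\<^sup>2 * (1 - e\<^sup>2)))"

definition maclaurin_config :: "real \<Rightarrow> mat3" where
  "maclaurin_config e =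
     diag (vector [(1 - e\<^sup>2) powr (-1/6), (1 - e\<^sup>2) powr (-1/6), (1 - e\<^sup>2) powr (1/3)])"

definition maclaurin_vel :: "real \<Rightarrow> real \<Rightarrow> real \<Rightarrow> velocity" where
  "maclaurin_vel rho0 grav e =
     ((maclaurin_Omega rho0 grav e / 2) *\<^sub>R axis 3 1, - ((maclaurin_Omega rho0 grav e / 2) *\<^sub>R axis 3 1))"

text \<open>The factor \<^const>\<open>metric_const\<close> comes from the covector \<open>\<lless>\<xi>(F), \<cdot>\<ggreater>\<close>.\<close>

definition maclaurin :: "real \<Rightarrow> real \<Rightarrow> real \<Rightarrow> phase" where
  "maclaurin rho0 grav e =
     (maclaurin_config e,
      metric_const rho0 *\<^sub>R fund (maclaurin_vel rho0 grav e) (maclaurin_config e))"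

definition maclaurin_family :: "real \<Rightarrow> real \<Rightarrow> phase set" where
  "maclaurin_family rho0 grav = (\<Union>e\<in>{0<..<1}. sym_orbit (maclaurin rho0 grav e))"

definition S2 :: "real \<Rightarrow> real \<Rightarrow> real \<Rightarrow> real" where
  "S2 rho0 grav e =
     R_const rho0 grav / e^5 *
       (e * (1 - e\<^sup>2) * (3 + 4 * e\<^sup>2)
         - sqrt (1 - e\<^sup>2) * (3 + 2 * e\<^sup>2 - 4 * e^4) * arcsin e)"

definition e_crit :: "real \<Rightarrow> real \<Rightarrow> real" where
  "e_crit rho0 grav = (THE e. e \<in> {0<..<1} \<and> S2 rho0 grav e = 0)"


section \<open>Bifurcating families\<close>

text \<open>A branch of relative equilibria \<open>f v\<close>, for small \<open>v \<noteq> 0\<close>, that emanates from the MacLaurin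
  family at \<open>maclaurin e\<close>, consists of relative equilibria outside that family, and has
  property \<open>Q\<close>.\<close>

definition bifurcating_family ::
  "real \<Rightarrow> real \<Rightarrow> real \<Rightarrow> (phase \<Rightarrow> bool) \<Rightarrow> ('v::real_normed_vector \<Rightarrow> phase) \<Rightarrow> bool" where
  "bifurcating_family rho0 grav e Q f \<longleftrightarrow>
     (\<exists>\<epsilon>>0. continuous_on (ball 0 \<epsilon> - {0}) f \<and>
        (\<forall>v\<in>ball 0 \<epsilon> - {0}. rel_equilibrium rho0 grav (f v) \<and>
                             f v \<notin> maclaurin_family rho0 grav \<and> Q (f v))) \<and>
     (f \<longlongrightarrow> maclaurin rho0 grav e) (at 0)"

definition K_S :: "sym set" where
  "K_S = generate sym_group {(False, rot (axis 3 1) pi, rot (axis 3 1) pi)}"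

definition K_adj :: "sym set" where
  "K_adj = generate sym_group {(False, rot (axis 3 1) pi, rot (axis 3 1) pi),
                               (True, rot (axis 1 1) pi, rot (axis 1 1) pi)}"

end

theory Submission
  imports Defs
begin

text \<open>The symmetry reduces the whole problem to algebra at a diagonal configuration. If a state moves
along a one-parameter group with velocity \<open>\<xi>\<close>, its momentum must be the metric constant times
\<open>fund \<xi> F\<close>, and the only condition that remains is that the matrix \<open>force\<close> (centrifugal term plus
gravitational term) is normal to \<open>SL(3)\<close> at \<open>F\<close>, that is, a multiple of the gradient of the
determinant. Multiplied by \<open>F\<^sup>T\<close> this becomes the condition \<open>balanced\<close> that a certain matrix is
scalar (\<open>rel_equilibrium_vel_iff\<close>), which is equivariant under pairs of rotations. By the singular
value decomposition (\<open>singular_values\<close>) it suffices to study diagonal \<open>F\<close>, where it consists of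
six off-diagonal equations, bilinear in the velocity and free of the potential, and of two
equalities between diagonal entries (\<open>balanced_diag_iff\<close>). The potential enters the latter only
through its partial derivatives in \<open>I\<^sub>1\<close> and \<open>I\<^sub>2\<close>, which are multiples of the moments
\<open>m\<^sub>j = \<integral> s\<^sup>j (s\<^sup>3 + I\<^sub>1 s\<^sup>2 + I\<^sub>2 s + 1) powr (-3/2) ds\<close> for \<open>j = 1, 2\<close>.

Velocities along the third axis, of rates \<open>l\<close> and \<open>m\<close>. Every off-diagonal equation holds. In the
shape variables \<open>\<sigma> = (a\<^sub>1\<^sup>2 + a\<^sub>2\<^sup>2) / (a\<^sub>1 a\<^sub>2)\<close> and \<open>\<kappa> = a\<^sub>3\<^sup>2 / (a\<^sub>1 a\<^sub>2)\<close>, for \<open>a\<^sub>1 \<noteq> a\<^sub>2\<close>, the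
diagonal ones say that \<open>(l + m)\<^sup>2\<close> and \<open>(l - m)\<^sup>2\<close> are the same positive multiple of \<open>crit 1\<close> and of
\<open>crit 1 - 2 crit 0\<close> (\<open>type_S_balanced_iff\<close>). The second quantity is positive near an oblate
spheroid, so type S ellipsoids exist exactly where \<open>crit 1 \<ge> 0\<close>, and they are adjoint exactly
where \<open>crit 1 = 0\<close>. At spheroids (\<open>\<sigma> = 2\<close>) the function \<open>crit 1\<close> is a positive multiple of \<open>S\<^sub>2\<close>
(\<open>S2_eq_crit\<close>). Both \<open>crit 0\<close> and \<open>crit 1\<close> change sign at most once in \<open>\<kappa>\<close> (\<open>crit_mono\<close>), because
they are integrals of linear functions whose coefficients grow with \<open>\<kappa>\<close>, against weights whose
ratio for two values of \<open>\<kappa>\<close> is monotone. This makes \<open>e\<^sub>c\<^sub>r\<^sub>i\<^sub>t\<close> well defined and also gives, for each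
\<open>\<sigma>\<close> close to 2, a zero of \<open>crit 1\<close> that depends continuously on \<open>\<sigma>\<close>
(\<open>crit_root_branch\<close>); the adjoint S family runs along this curve (\<open>adjoint_S_bifurcation\<close>). For
\<open>e < e\<^sub>c\<^sub>r\<^sub>i\<^sub>t\<close> there is freedom in choosing \<open>\<kappa>\<close>, used to avoid the zeros of \<open>crit 0\<close>, at which one of
\<open>l\<close> and \<open>m\<close> vanishes (\<open>type_S_bifurcation\<close>).

Tilted velocities, in the plane of the first and third axes. The off-diagonal equations fix the ratios of the left
to the right components as roots of two quadratic equations. Then the diagonal equations are
linear in the products of left and right components, and the product belonging to the first axis
comes out as a positive multiple of \<open>a\<^sub>1\<^sup>2 - a\<^sub>2\<^sup>2\<close>. Hence every oblate spheroid starts a branch with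
\<open>a\<^sub>1 > a\<^sub>2\<close> (\<open>type_I_bifurcation\<close>).

All three families come from continuous paths composed with the norm
(\<open>bifurcating_family_from_path\<close>).

Conversely, compactness of the rotations shows that a relative equilibrium close to a MacLaurin
spheroid has singular values close to its semiaxes (\<open>singular_values_near_spheroid\<close>). If the two
largest ones coincide, then the velocity is axial and the state lies in the MacLaurin family
(\<open>spheroid_in_maclaurin_family\<close>). Otherwise the off-diagonal equations exclude velocities with
components along both the first and the second axis (\<open>tilted_velocity_condition\<close>). What remains is
type I, since the inequality between the semiaxes holds near an oblate spheroid, or an axial
velocity, for which the sign of \<open>crit 1\<close> decides
(\<open>classification_near_maclaurin\<close>).\<close>

section \<open>Moments of cubic polynomials\<close>

definition cub :: "real \<Rightarrow> real \<Rightarrow> real \<Rightarrow> real \<Rightarrow> real" where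
  "cub p q r s = s^3 + p * s\<^sup>2 + q * s + r"

text \<open>The potential is an integral over a cubic with constant coefficient \<open>det F\<^sup>2 = 1\<close>. A general constant
coefficient \<open>r\<close> is kept so that the cubics of similar ellipsoids can be compared (see \<open>mom_scale\<close>).\<close>

definition mom :: "nat \<Rightarrow> real \<Rightarrow> real \<Rightarrow> real \<Rightarrow> real" where
  "mom j p q r = integral {0..} (\<lambda>s. s^j / (cub p q r s * sqrt (cub p q r s)))"

text \<open>Hence \<open>s\<^sup>j / (s\<^sup>3 + 1) \<le> 1\<close> for \<open>j \<le> 2\<close>: all integrals below have the same integrable majorant.\<close>

lemma cube_ge: fixes s :: real assumes "s \<ge> 0" shows "s \<le> s^3 + 1" "s\<^sup>2 \<le> s^3 + 1"
proof -
  show "s \<le> s^3 + 1"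
  proof (cases "s \<le> 1")
    case True then show ?thesis using assms by (smt (verit) zero_le_power)
  next
    case False then have "s^1 \<le> s^3" by (intro power_increasing) auto
    then show ?thesis by simp
  qed
  show "s\<^sup>2 \<le> s^3 + 1"
  proof (cases "s \<le> 1")
    case True then have "s\<^sup>2 \<le> 1" using assms by (simp add: power_le_one)
    then show ?thesis using assms by (smt (verit) zero_le_power)
  next
    case False then have "s^2 \<le> s^3" by (intro power_increasing) auto
    then show ?thesis by simp
  qed
qed

lemma integrable_base: "(\<lambda>s::real. 1 / sqrt (s^3 + 1)) integrable_on {0..}"
proof -
  have c: "continuous_on {0..} (\<lambda>s::real. 1 / sqrt (s^3 + 1))"
    by (intro continuous_intros) (auto simp: add_nonneg_eq_0_iff)
  have 1: "((\<lambda>x::real. x powr (-3/2)) has_integral -(1 powr (-3/2+1)) / (-3/2+1)) {1..}"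
    by (rule has_integral_powr_to_inf) auto
  have "(\<lambda>s::real. 1 / sqrt (s^3 + 1)) integrable_on {1..}"
  proof (rule measurable_bounded_by_integrable_imp_integrable[where g="\<lambda>x. x powr (-3/2)"])
    show "(\<lambda>s::real. 1 / sqrt (s^3 + 1)) \<in> borel_measurable (lebesgue_on {1..})"
      by (rule continuous_imp_measurable_on_sets_lebesgue[OF continuous_on_subset[OF c]]) auto
    show "(\<lambda>x::real. x powr (-3/2)) integrable_on {1..}" using 1 by blast
    fix x :: real assume "x \<in> {1..}"
    then have x: "x \<ge> 1" by simp
    have "x powr (3/2) = sqrt (x^3)"
      using x by (simp add: powr_half_sqrt[symmetric] powr_powr powr_realpow[symmetric] del: powr_numeral)
    then have "x powr (-3/2) = 1 / sqrt (x^3)"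
      by (simp add: powr_minus_divide)
    moreover have "1 / sqrt (x^3 + 1) \<le> 1 / sqrt (x^3)" using x
      by (intro frac_le) (auto intro: add_nonneg_pos)
    ultimately show "norm (1 / sqrt (x^3+1)) \<le> x powr (-3/2)" using x by simp
  qed auto
  moreover have "(\<lambda>s::real. 1 / sqrt (s^3 + 1)) integrable_on {0..1}"
    by (rule integrable_continuous_interval, rule continuous_on_subset[OF c]) auto
  moreover have "{0..1} \<union> {1..} = {0::real..}" by auto
  moreover have "{0..1} \<inter> {1..} = {1::real}" by auto
  ultimately show ?thesis
    using integrable_Un[of "{0..1::real}" "{1..}" "\<lambda>s::real. 1 / sqrt (s^3 + 1)"] by simp
qed

text \<open>The single majorant \<open>1 / sqrt (s\<^sup>3 + 1)\<close> serves for the potential, for its derivatives and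
for the dominated convergence arguments.\<close>

lemma integrable_dominated:
  fixes f :: "real \<Rightarrow> real"
  assumes "continuous_on {0..} f" "\<And>s. s \<ge> 0 \<Longrightarrow> \<bar>f s\<bar> \<le> K * (1 / sqrt (s^3 + 1))"
  shows "f integrable_on {0..}"
proof (rule measurable_bounded_by_integrable_imp_integrable[where g="\<lambda>s. K * (1 / sqrt (s^3 + 1))"])
  show "f \<in> borel_measurable (lebesgue_on {0..})"
    by (rule continuous_imp_measurable_on_sets_lebesgue[OF assms(1)]) auto
  show "(\<lambda>s. K * (1 / sqrt (s^3 + 1))) integrable_on {0..}"
    using integrable_on_cmult_left[OF integrable_base, of K] by simp
qed (use assms in auto)

lemma cub_ge:
  assumes "p \<ge> 0" "q \<ge> 0" "d \<le> 1" "d \<le> r" "s \<ge> 0"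
  shows "cub p q r s \<ge> d * (s^3 + 1)"
proof -
  have "d * s^3 \<le> s^3" using assms mult_right_mono[of d 1 "s^3"] by simp
  moreover have "p * s\<^sup>2 \<ge> 0" "q * s \<ge> 0" using assms by auto
  ultimately show ?thesis using assms unfolding cub_def distrib_left by linarith
qed

lemma cub_pos:
  assumes "p \<ge> 0" "q \<ge> 0" "0 < r" "s \<ge> 0"
  shows "cub p q r s > 0"
  using assms unfolding cub_def by (simp add: add_nonneg_pos)

lemma mom_integrand_bound:
  assumes "p \<ge> 0" "q \<ge> 0" "0 < d" "d \<le> 1" "d \<le> r" "s \<ge> 0" "j \<le> 2"
  shows "\<bar>s^j / (cub p q r s * sqrt (cub p q r s))\<bar> \<le> (1 / (d * sqrt d)) * (1 / sqrt (s^3 + 1))"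
proof -
  have p: "s^3 + 1 > 0" using assms by (simp add: add_nonneg_pos)
  have g: "cub p q r s \<ge> d * (s^3 + 1)" using assms by (intro cub_ge) auto
  have j: "s^j \<le> s^3 + 1"
  proof -
    have "j = 0 \<or> j = 1 \<or> j = 2" using assms by auto
    then show ?thesis using cube_ge[OF assms(6)] assms(6) by auto
  qed
  have "s^j / (cub p q r s * sqrt (cub p q r s)) \<le> (s^3+1) / ((d * (s^3 + 1)) * sqrt (d * (s^3 + 1)))"
    using g j p assms cub_pos[of p q r s] by (intro frac_le mult_mono mult_pos_pos) auto
  also have "\<dots> = (1 / (d * sqrt d)) * (1 / sqrt (s^3 + 1))"
    unfolding real_sqrt_mult using p assms by simp
  finally show ?thesis using cub_pos[of p q r s] assms by simp
qed

lemma mom_integrand_nonneg: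
  assumes "p \<ge> 0" "q \<ge> 0" "0 < r" "s \<ge> 0"
  shows "s^j / (cub p q r s * sqrt (cub p q r s)) \<ge> 0"
  using cub_pos[OF assms] assms by simp

lemma continuous_on_cub [continuous_intros]: "continuous_on S (cub p q r)"
  unfolding cub_def by (intro continuous_intros)

lemma mom_integrable:
  assumes "p \<ge> 0" "q \<ge> 0" "0 < r" "j \<le> 2"
  shows "(\<lambda>s. s^j / (cub p q r s * sqrt (cub p q r s))) integrable_on {0..}"
proof (rule integrable_dominated)
  have "cub p q r s \<noteq> 0" if "s \<ge> 0" for s using cub_pos[of p q r s] assms that by auto
  then show "continuous_on {0..} (\<lambda>s. s^j / (cub p q r s * sqrt (cub p q r s)))"
    by (intro continuous_intros) auto
  show "\<bar>s^j / (cub p q r s * sqrt (cub p q r s))\<bar> \<le> (1 / (min 1 r * sqrt (min 1 r))) * (1 / sqrt (s^3 + 1))"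
    if "s \<ge> 0" for s using assms that by (intro mom_integrand_bound) auto
qed

lemma mom_pos:
  assumes "p \<ge> 0" "q \<ge> 0" "0 < r" "j \<le> 2"
  shows "mom j p q r > 0"
proof -
  let ?f = "\<lambda>s. s^j / (cub p q r s * sqrt (cub p q r s))"
  let ?c = "1 / (cub p q r 2 * sqrt (cub p q r 2))"
  have c2: "cub p q r 2 > 0" using assms by (intro cub_pos) auto
  have i: "?f integrable_on {1..2}"
    by (rule integrable_on_subinterval[OF mom_integrable[OF assms]]) auto
  have "?c = integral {1..2::real} (\<lambda>s. ?c)" by simp
  also have "\<dots> \<le> integral {1..2} ?f"
  proof (rule integral_le)
    show "?f integrable_on {1..2}" by (rule i)
    fix s :: real assume s: "s \<in> {1..2}"
    have "cub p q r s \<le> cub p q r 2" unfolding cub_def using s assms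
      by (intro add_mono mult_left_mono power_mono) auto
    moreover have "cub p q r s > 0" using s assms by (intro cub_pos) auto
    ultimately show "?c \<le> ?f s" using s
      by (intro frac_le mult_mono mult_pos_pos) auto
  qed auto
  also have "\<dots> \<le> integral {0..} ?f"
  proof (rule integral_subset_le)
    show "?f integrable_on {1..2}" by (rule i)
    show "?f integrable_on {0..}" by (rule mom_integrable[OF assms])
    show "\<forall>s\<in>{0..}. 0 \<le> ?f s"
      using mom_integrand_nonneg[OF assms(1-3)] by simp
  qed auto
  finally have "?c \<le> mom j p q r" unfolding mom_def .
  moreover have "?c > 0" using c2 by simp
  ultimately show ?thesis by (rule less_le_trans[rotated])
qed

lemma continuous_on_mom:
  assumes j: "j \<le> 2"
  shows "continuous_on ({0..} \<times> {0..} \<times> {0<..}) (\<lambda>z. mom j (fst z) (fst (snd z)) (snd (snd z)))"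
  unfolding continuous_on_sequentially
proof (intro allI ballI impI, elim conjE)
  fix x :: "nat \<Rightarrow> real \<times> real \<times> real" and a
  assume a: "a \<in> {0..} \<times> {0..} \<times> {0<..}" and xm: "\<forall>n. x n \<in> {0..} \<times> {0..} \<times> {0<..}"
    and xa: "x \<longlonglongrightarrow> a"
  obtain p q r where apqr: "a = (p, q, r)" by (cases a) auto
  have pqr: "p \<ge> 0" "q \<ge> 0" "r > 0" using a by (auto simp: apqr)
  define P Q D where "P = (\<lambda>n. fst (x n))" and "Q = (\<lambda>n. fst (snd (x n)))" and "D = (\<lambda>n. snd (snd (x n)))"
  have nn: "P n \<ge> 0" "Q n \<ge> 0" for n using xm[rule_format, of n] by (auto simp: P_def Q_def mem_Times_iff)
  have lim: "P \<longlonglongrightarrow> p" "Q \<longlonglongrightarrow> q" "D \<longlonglongrightarrow> r"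
    using tendsto_fst[OF xa] tendsto_fst[OF tendsto_snd[OF xa]] tendsto_snd[OF tendsto_snd[OF xa]]
    unfolding P_def Q_def D_def apqr fst_conv snd_conv by this+
  define d where "d = min 1 (r/2)"
  have d: "0 < d" "d \<le> 1" "d < r" using pqr by (auto simp: d_def)
  obtain N where N: "\<And>n. n \<ge> N \<Longrightarrow> D n > d"
    using order_tendstoD(1)[OF lim(3) d(3)] unfolding eventually_sequentially by blast
  have "(\<lambda>k. integral {0..} (\<lambda>s. s^j / (cub (P (k+N)) (Q (k+N)) (D (k+N)) s * sqrt (cub (P (k+N)) (Q (k+N)) (D (k+N)) s))))
     \<longlonglongrightarrow> integral {0..} (\<lambda>s. s^j / (cub p q r s * sqrt (cub p q r s)))"
  proof (rule dominated_convergence(2)[where h="\<lambda>s. (1 / (d * sqrt d)) * (1 / sqrt (s^3 + 1))"])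
    show "(\<lambda>s. s^j / (cub (P (k+N)) (Q (k+N)) (D (k+N)) s * sqrt (cub (P (k+N)) (Q (k+N)) (D (k+N)) s))) integrable_on {0..}" for k
      using nn N[of "k+N"] d j by (intro mom_integrable) auto
    show "(\<lambda>s. (1 / (d * sqrt d)) * (1 / sqrt (s^3 + 1))) integrable_on {0..}"
      using integrable_on_cmult_left[OF integrable_base, of "1 / (d * sqrt d)"] by simp
    fix k and s :: real assume s: "s \<in> {0..}"
    show "norm (s^j / (cub (P (k+N)) (Q (k+N)) (D (k+N)) s * sqrt (cub (P (k+N)) (Q (k+N)) (D (k+N)) s))) \<le> (1 / (d * sqrt d)) * (1 / sqrt (s^3 + 1))"
      unfolding real_norm_def
      using nn N[of "k+N"] d s j by (intro mom_integrand_bound) auto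
  next
    fix s :: real assume s: "s \<in> {0..}"
    have "cub p q r s > 0" using pqr s by (intro cub_pos) auto
    moreover have "(\<lambda>k. cub (P (k+N)) (Q (k+N)) (D (k+N)) s) \<longlonglongrightarrow> cub p q r s"
      unfolding cub_def by (intro tendsto_intros LIMSEQ_ignore_initial_segment lim)
    ultimately show "(\<lambda>k. s^j / (cub (P (k+N)) (Q (k+N)) (D (k+N)) s * sqrt (cub (P (k+N)) (Q (k+N)) (D (k+N)) s)))
       \<longlonglongrightarrow> s^j / (cub p q r s * sqrt (cub p q r s))"
      by (intro tendsto_intros) auto
  qed
  then have "(\<lambda>k. mom j (P (k+N)) (Q (k+N)) (D (k+N))) \<longlonglongrightarrow> mom j p q r"
    unfolding mom_def .
  from LIMSEQ_offset[OF this]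
  show "((\<lambda>z. mom j (fst z) (fst (snd z)) (snd (snd z))) \<circ> x) \<longlonglongrightarrow> mom j (fst a) (fst (snd a)) (snd (snd a))"
    unfolding comp_def P_def Q_def D_def apqr fst_conv snd_conv .
qed

lemma tendsto_mom:
  assumes "j \<le> 2" "(P \<longlongrightarrow> p) F" "(Q \<longlongrightarrow> q) F" "(D \<longlongrightarrow> r) F"
    and "p \<ge> 0" "q \<ge> 0" "r > 0" "\<forall>\<^sub>F x in F. P x \<ge> 0 \<and> Q x \<ge> 0 \<and> D x > 0"
  shows "((\<lambda>x. mom j (P x) (Q x) (D x)) \<longlongrightarrow> mom j p q r) F"
proof -
  have "\<forall>\<^sub>F x in F. (P x, Q x, D x) \<in> {0..} \<times> {0..} \<times> {0<..}"
    by (rule eventually_mono[OF assms(8)]) simp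
  moreover have "(p, q, r) \<in> {0..} \<times> {0..} \<times> {0<..}" using assms(5-7) by simp
  moreover have "((\<lambda>x. (P x, Q x, D x)) \<longlongrightarrow> (p, q, r)) F"
    by (intro tendsto_Pair assms(2-4))
  ultimately have "((\<lambda>x. (\<lambda>z. mom j (fst z) (fst (snd z)) (snd (snd z))) (P x, Q x, D x)) \<longlongrightarrow>
      (\<lambda>z. mom j (fst z) (fst (snd z)) (snd (snd z))) (p, q, r)) F"
    using continuous_on_tendsto_compose[OF continuous_on_mom[OF assms(1)]] by blast
  then show ?thesis by simp
qed

text \<open>Substitution of \<open>t * s\<close> for \<open>s\<close>: the cubic with roots multiplied by \<open>t\<close> takes
at \<open>t * s\<close> the value \<open>t\<^sup>3\<close> times that of the original one at \<open>s\<close>.\<close>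

lemma mom_scale:
  assumes "t > 0" "p \<ge> 0" "q \<ge> 0" "r > 0" "j \<le> 2"
  shows "mom j (t * p) (t\<^sup>2 * q) (t^3 * r) = t^(j + 1) / (t^3 * sqrt (t^3)) * mom j p q r"
proof -
  let ?f = "\<lambda>s. s^j / (cub (t * p) (t\<^sup>2 * q) (t^3 * r) s * sqrt (cub (t * p) (t\<^sup>2 * q) (t^3 * r) s))"
  let ?g = "\<lambda>s. s^j / (cub p q r s * sqrt (cub p q r s))"
  have c: "cub (t * p) (t\<^sup>2 * q) (t^3 * r) (t * s) = t^3 * cub p q r s" for s
    unfolding cub_def by (simp add: algebra_simps power2_eq_square power3_eq_cube)
  have f: "?f absolutely_integrable_on {0..}"
  proof (rule nonnegative_absolutely_integrable_1)
    show "?f integrable_on {0..}" using assms by (intro mom_integrable) auto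
    show "?f s \<ge> 0" if "s \<in> {0..}" for s using assms that by (intro mom_integrand_nonneg) auto
  qed
  have g: "(?g has_integral mom j p q r) {0..}"
    unfolding mom_def using assms by (intro integrable_integral mom_integrable) auto
  have im: "(\<lambda>x. t * x) ` {0..} = {0..}"
  proof (intro equalityI subsetI)
    fix x :: real assume "x \<in> {0..}"
    then show "x \<in> (\<lambda>x. t * x) ` {0..}" using assms(1) by (intro image_eqI[of _ _ "x / t"]) auto
  qed (use assms(1) in auto)
  have S: "{0::real..} \<in> sets lebesgue" by auto
  have der: "((*) t has_field_derivative t) (at x within {0..})" for x
    by (auto intro!: derivative_eq_intros)
  have inj: "inj_on ((*) t) {0..}" using assms(1) by (auto simp: inj_on_def)
  have "integral {0..} (\<lambda>x. \<bar>t\<bar> * ?f (t * x)) = mom j (t * p) (t\<^sup>2 * q) (t^3 * r)"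
    by (rule has_absolute_integral_change_of_variables_1'[OF S der inj, THEN iffD2, THEN conjunct2, unfolded im])
      (rule conjI[OF f mom_def[symmetric]])
  moreover have "\<bar>t\<bar> * ?f (t * x) = t^(j+1) / (t^3 * sqrt (t^3)) * ?g x" for x
    unfolding c real_sqrt_mult power_mult_distrib using assms(1) by (simp add: mult.assoc mult.left_commute)
  ultimately show ?thesis
    using integral_unique[OF has_integral_mult_right[OF g, of "t^(j+1) / (t^3 * sqrt (t^3))"]] by simp
qed


section \<open>Differentiability of the potential integral\<close>

definition pot_int :: "real \<Rightarrow> real \<Rightarrow> real" where
  "pot_int x y = integral {0..} (\<lambda>s. 1 / sqrt (cub x y 1 s))"

text \<open>With \<open>r = sqrt u\<close> and \<open>t = sqrt u'\<close> the remainder of the first-order expansion equals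
\<open>(t - r)\<^sup>2 (t + 2 r) / (2 r\<^sup>3 t)\<close>. The bound is homogeneous in \<open>u\<close>, so that with \<open>u' - u\<close> of the order
of \<open>u\<close> it is integrable in \<open>s\<close>.\<close>

lemma inv_sqrt_taylor:
  fixes u u' :: real
  assumes "u > 0" "u' \<ge> u / 2"
  shows "\<bar>1 / sqrt u' - 1 / sqrt u + (u' - u) / (2 * (u * sqrt u))\<bar> \<le> 2 * (u' - u)\<^sup>2 / (u\<^sup>2 * sqrt u)"
proof -
  define r t where "r = sqrt u" and "t = sqrt u'"
  have r: "r > 0" "u = r * r" and t: "t > 0" "u' = t * t" using assms by (auto simp: r_def t_def)
  have "t \<ge> r / 2"
  proof -
    have "sqrt (u / 4) \<le> sqrt u'" using assms by simp
    then show ?thesis by (simp add: r_def t_def real_sqrt_divide)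
  qed
  have e: "1 / t - 1 / r + (t * t - r * r) / (2 * (r * r * r)) = (t - r)\<^sup>2 * (t + 2 * r) / (2 * r^3 * t)"
    using r t by (simp add: field_simps power2_eq_square power3_eq_cube)
  have "(t + 2 * r) * r\<^sup>2 \<le> 4 * t * (t + r)\<^sup>2"
  proof -
    have "(t + 2 * r) * r\<^sup>2 \<le> 2 * r * (t + r)\<^sup>2"
      using r t by (simp add: power2_eq_square algebra_simps)
    also have "\<dots> \<le> 4 * t * (t + r)\<^sup>2" using \<open>t \<ge> r / 2\<close> by (intro mult_right_mono) auto
    finally show ?thesis .
  qed
  then have "(t + 2 * r) / (2 * r^3 * t) \<le> 2 * (t + r)\<^sup>2 / r^5"
    using r t by (simp add: divide_simps power2_eq_square eval_nat_numeral) (simp add: algebra_simps)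
  then have "(t - r)\<^sup>2 * ((t + 2 * r) / (2 * r^3 * t)) \<le> (t - r)\<^sup>2 * (2 * (t + r)\<^sup>2 / r^5)"
    by (intro mult_left_mono) auto
  also have "\<dots> = 2 * (t * t - r * r)\<^sup>2 / ((r * r)\<^sup>2 * r)"
    using r by (simp add: field_simps power2_eq_square eval_nat_numeral)
  finally have "(t - r)\<^sup>2 * (t + 2 * r) / (2 * r^3 * t) \<le> 2 * (t * t - r * r)\<^sup>2 / ((r * r)\<^sup>2 * r)" by simp
  moreover have "(t - r)\<^sup>2 * (t + 2 * r) / (2 * r^3 * t) \<ge> 0" using r t by auto
  ultimately have "\<bar>1 / t - 1 / r + (t * t - r * r) / (2 * (r * r * r))\<bar> \<le> 2 * (t * t - r * r)\<^sup>2 / ((r * r)\<^sup>2 * r)"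
    unfolding e by simp
  then show ?thesis by (simp only: r(2)[symmetric] t(2)[symmetric] r_def[symmetric] t_def[symmetric])
qed

text \<open>A quadratic error bound that is uniform in the base point replaces differentiation under the
integral sign. The perturbation \<open>h s\<^sup>2 + k s\<close> of the cubic is at most \<open>(\<bar>h\<bar> + \<bar>k\<bar>) (s\<^sup>3 + 1)\<close>,
so it is at most half of the cubic when \<open>h\<close> and \<open>k\<close> are at most 1/4.\<close>

lemma pot_int_taylor:
  assumes x: "x \<ge> 0" "y \<ge> 0" and h: "\<bar>h\<bar> \<le> 1/4" "\<bar>k\<bar> \<le> 1/4"
  shows "\<bar>pot_int (x + h) (y + k) - pot_int x y - (- (mom 2 x y 1 * h + mom 1 x y 1 * k) / 2)\<bar>
    \<le> 2 * (\<bar>h\<bar> + \<bar>k\<bar>)\<^sup>2 * integral {0..} (\<lambda>s::real. 1 / sqrt (s^3 + 1))"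
proof -
  let ?u = "cub x y 1" and ?v = "cub (x + h) (y + k) 1"
  have vu: "?v s - ?u s = h * s\<^sup>2 + k * s" for s by (simp add: cub_def algebra_simps)
  have w: "s^3 + 1 > 0" "?u s \<ge> s^3 + 1" if "s \<ge> 0" for s :: real
    using that x cub_ge[of x y 1 1 s] by (auto intro: add_nonneg_pos)
  have d: "\<bar>?v s - ?u s\<bar> \<le> (\<bar>h\<bar> + \<bar>k\<bar>) * (s^3 + 1)" if "s \<ge> 0" for s
  proof -
    have "\<bar>h * s\<^sup>2 + k * s\<bar> \<le> \<bar>h\<bar> * s\<^sup>2 + \<bar>k\<bar> * s"
      using that by (metis abs_mult abs_of_nonneg abs_triangle_ineq zero_le_power2)
    also have "\<dots> \<le> \<bar>h\<bar> * (s^3 + 1) + \<bar>k\<bar> * (s^3 + 1)"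
      using cube_ge[OF that] by (intro add_mono mult_left_mono) auto
    finally show ?thesis unfolding vu by (simp add: algebra_simps)
  qed
  have v: "?v s \<ge> ?u s / 2" "?v s \<ge> (s^3 + 1) / 2" if "s \<ge> 0" for s
  proof -
    have "(\<bar>h\<bar> + \<bar>k\<bar>) * (s^3 + 1) \<le> 1/2 * (s^3 + 1)" using h w[OF that] by (intro mult_right_mono) auto
    moreover have "\<bar>?v s - ?u s\<bar> \<le> (\<bar>h\<bar> + \<bar>k\<bar>) * (s^3 + 1)" "?u s \<ge> s^3 + 1"
      using d[OF that] w[OF that] by auto
    ultimately have "\<bar>?v s - ?u s\<bar> \<le> (s^3 + 1) / 2 \<and> ?u s \<ge> s^3 + 1" by simp
    moreover have "v \<ge> u / 2 \<and> v \<ge> w / 2" if "\<bar>v - u\<bar> \<le> w / 2 \<and> u \<ge> w" for u v w :: real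
      using that by linarith
    ultimately have "?v s \<ge> ?u s / 2 \<and> ?v s \<ge> (s^3 + 1) / 2" by blast
    then show "?v s \<ge> ?u s / 2" "?v s \<ge> (s^3 + 1) / 2" by auto
  qed
  let ?b = "\<lambda>s::real. 1 / sqrt (s^3 + 1)"
  have iu: "(\<lambda>s. 1 / sqrt (?u s)) integrable_on {0..}"
  proof (rule integrable_dominated[where K=1])
    show "continuous_on {0..} (\<lambda>s. 1 / sqrt (?u s))"
      using w by (intro continuous_intros) (force simp: real_sqrt_eq_zero_cancel_iff)
    show "\<bar>1 / sqrt (?u s)\<bar> \<le> 1 * ?b s" if "s \<ge> 0" for s
      using w[OF that] by (simp add: frac_le)
  qed
  have iv: "(\<lambda>s. 1 / sqrt (?v s)) integrable_on {0..}"
  proof (rule integrable_dominated[where K="sqrt 2"])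
    show "continuous_on {0..} (\<lambda>s. 1 / sqrt (?v s))"
      using v w by (intro continuous_intros) (force simp: real_sqrt_eq_zero_cancel_iff)
    show "\<bar>1 / sqrt (?v s)\<bar> \<le> sqrt 2 * ?b s" if "s \<ge> 0" for s
    proof -
      have vp: "?v s > 0" using v[OF that] w[OF that] by linarith
      have "sqrt (s^3 + 1) \<le> sqrt (2 * ?v s)" using v[OF that] by simp
      then show ?thesis using vp w[OF that] by (simp add: divide_simps real_sqrt_mult mult.commute)
    qed
  qed
  have i1: "(\<lambda>s. s^2 / (?u s * sqrt (?u s))) integrable_on {0..}"
    and i2: "(\<lambda>s. s^1 / (?u s * sqrt (?u s))) integrable_on {0..}"
    using x by (intro mom_integrable; simp)+
  let ?e = "\<lambda>s. 1 / sqrt (?v s) - 1 / sqrt (?u s) + (h / 2 * (s^2 / (?u s * sqrt (?u s))) + k / 2 * (s^1 / (?u s * sqrt (?u s))))"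
  have he: "(?e has_integral (pot_int (x + h) (y + k) - pot_int x y + (h / 2 * mom 2 x y 1 + k / 2 * mom 1 x y 1))) {0..}"
    unfolding pot_int_def mom_def
    by (intro has_integral_add has_integral_diff has_integral_mult_right integrable_integral iu iv i1 i2)
  have hb: "((\<lambda>s. 2 * (\<bar>h\<bar> + \<bar>k\<bar>)\<^sup>2 * ?b s) has_integral (2 * (\<bar>h\<bar> + \<bar>k\<bar>)\<^sup>2 * integral {0..} ?b)) {0..}"
    by (intro has_integral_mult_right integrable_integral integrable_base)
  have "norm (pot_int (x + h) (y + k) - pot_int x y + (h / 2 * mom 2 x y 1 + k / 2 * mom 1 x y 1)) \<le> 2 * (\<bar>h\<bar> + \<bar>k\<bar>)\<^sup>2 * integral {0..} ?b"
    unfolding integral_unique[OF he, symmetric] integral_unique[OF hb, symmetric]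
  proof (rule integral_norm_bound_integral)
    show "?e integrable_on {0..}" using he by blast
    show "(\<lambda>s. 2 * (\<bar>h\<bar> + \<bar>k\<bar>)\<^sup>2 * ?b s) integrable_on {0..}" using hb by blast
    fix s :: real assume "s \<in> {0..}"
    then have s: "s \<ge> 0" by simp
    have up: "?u s > 0" using w[OF s] by linarith
    have "?e s = 1 / sqrt (?v s) - 1 / sqrt (?u s) + (?v s - ?u s) / (2 * (?u s * sqrt (?u s)))"
      unfolding vu by (simp add: add_divide_distrib)
    then have "\<bar>?e s\<bar> \<le> 2 * (?v s - ?u s)\<^sup>2 / ((?u s)\<^sup>2 * sqrt (?u s))"
      using inv_sqrt_taylor[OF up v(1)[OF s]] by simp
    also have "\<dots> \<le> 2 * ((\<bar>h\<bar> + \<bar>k\<bar>) * (s^3 + 1))\<^sup>2 / ((s^3 + 1)\<^sup>2 * sqrt (s^3 + 1))"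
    proof (rule frac_le)
      show "2 * (?v s - ?u s)\<^sup>2 \<le> 2 * ((\<bar>h\<bar> + \<bar>k\<bar>) * (s^3 + 1))\<^sup>2"
        using d[OF s] by (metis abs_ge_zero mult_left_mono power2_abs power_mono zero_le_numeral)
      show "(s^3 + 1)\<^sup>2 * sqrt (s^3 + 1) \<le> (?u s)\<^sup>2 * sqrt (?u s)"
        using w[OF s] by (intro mult_mono power_mono) auto
    qed (use w[OF s] in auto)
    also have "\<dots> = 2 * (\<bar>h\<bar> + \<bar>k\<bar>)\<^sup>2 * ?b s" using w[OF s] by (simp add: power_mult_distrib)
    finally show "norm (?e s) \<le> 2 * (\<bar>h\<bar> + \<bar>k\<bar>)\<^sup>2 * ?b s" by simp
  qed
  then show ?thesis by (simp add: field_simps)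
qed

lemma pot_int_has_derivative:
  assumes "x \<ge> 0" "y \<ge> 0"
  shows "((\<lambda>z. pot_int (fst z) (snd z)) has_derivative
     (\<lambda>z. - (mom 2 x y 1 * fst z + mom 1 x y 1 * snd z) / 2)) (at (x, y))"
  unfolding has_derivative_at_alt
proof (intro conjI allI impI)
  show "bounded_linear (\<lambda>z. - (mom 2 x y 1 * fst z + mom 1 x y 1 * snd z) / 2)"
    by (intro linear_conv_bounded_linear[THEN iffD1] linearI) (simp_all add: field_simps)
  fix e :: real assume e: "e > 0"
  define B where "B = integral {0..} (\<lambda>s::real. 1 / sqrt (s^3 + 1))"
  have B: "B \<ge> 0" unfolding B_def
    by (rule integral_nonneg[OF integrable_base]) (auto intro: add_nonneg_nonneg)
  define d where "d = min (1/4) (e / (8 * B + 8))"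
  have d: "d > 0" "8 * B * d \<le> e"
  proof -
    show "d > 0" using e B by (simp add: d_def)
    have "8 * B * d \<le> 8 * B * (e / (8 * B + 8))" using B by (intro mult_left_mono) (auto simp: d_def)
    also have "\<dots> \<le> e" using B e by (simp add: field_simps)
    finally show "8 * B * d \<le> e" .
  qed
  show "\<exists>d>0. \<forall>z. norm (z - (x, y)) < d \<longrightarrow>
      norm (pot_int (fst z) (snd z) - pot_int (fst (x, y)) (snd (x, y)) -
         - (mom 2 x y 1 * fst (z - (x, y)) + mom 1 x y 1 * snd (z - (x, y))) / 2) \<le> e * norm (z - (x, y))"
  proof (intro exI[of _ d] conjI allI impI)
    show "d > 0" by (rule d(1))
    fix z :: "real \<times> real" assume z: "norm (z - (x, y)) < d"
    define h k where "h = fst (z - (x, y))" and "k = snd (z - (x, y))"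
    have hk: "\<bar>h\<bar> \<le> norm (z - (x, y))" "\<bar>k\<bar> \<le> norm (z - (x, y))"
      unfolding h_def k_def using norm_fst_le[of "fst (z - (x, y))" "snd (z - (x, y))"]
        norm_snd_le[of "snd (z - (x, y))" "fst (z - (x, y))"] by (simp_all only: prod.collapse real_norm_def)
    have "\<bar>pot_int (x + h) (y + k) - pot_int x y - (- (mom 2 x y 1 * h + mom 1 x y 1 * k) / 2)\<bar> \<le> 2 * (\<bar>h\<bar> + \<bar>k\<bar>)\<^sup>2 * B"
      unfolding B_def using hk z assms by (intro pot_int_taylor) (auto simp: d_def)
    also have "\<dots> \<le> 2 * (2 * norm (z - (x, y)))\<^sup>2 * B"
      using hk B by (intro mult_right_mono mult_left_mono power_mono) auto
    also have "\<dots> = (8 * B * norm (z - (x, y))) * norm (z - (x, y))" by (simp add: power2_eq_square)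
    also have "\<dots> \<le> e * norm (z - (x, y))"
    proof (rule mult_right_mono)
      have "8 * B * norm (z - (x, y)) \<le> 8 * B * d" using z B by (intro mult_left_mono) auto
      then show "8 * B * norm (z - (x, y)) \<le> e" using d(2) by linarith
    qed auto
    finally show "norm (pot_int (fst z) (snd z) - pot_int (fst (x, y)) (snd (x, y)) -
         - (mom 2 x y 1 * fst (z - (x, y)) + mom 1 x y 1 * snd (z - (x, y))) / 2) \<le> e * norm (z - (x, y))"
      by (simp add: h_def k_def)
  qed
qed


section \<open>Sign changes of the critical functions\<close>

text \<open>The moments of an ellipsoid scaled to \<open>a\<^sub>1 a\<^sub>2 = 1\<close>, in the shape variables
\<open>\<sigma> = a\<^sub>1\<^sup>2 + a\<^sub>2\<^sup>2\<close> and \<open>\<kappa> = a\<^sub>3\<^sup>2\<close>. This scaling makes the cubic factor as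
\<open>(s\<^sup>2 + \<sigma> s + 1) (s + \<kappa>)\<close>, in which \<open>\<kappa>\<close> is separated from \<open>\<sigma>\<close>.\<close>

definition nmom :: "nat \<Rightarrow> real \<Rightarrow> real \<Rightarrow> real" where
  "nmom j \<sigma> \<kappa> = mom j (\<sigma> + \<kappa>) (1 + \<sigma> * \<kappa>) \<kappa>"

lemma nmom_pos: "\<sigma> \<ge> 0 \<Longrightarrow> \<kappa> > 0 \<Longrightarrow> j \<le> 2 \<Longrightarrow> nmom j \<sigma> \<kappa> > 0"
  unfolding nmom_def by (intro mom_pos) auto

lemma tendsto_nmom:
  assumes "j \<le> 2" "(S \<longlongrightarrow> \<sigma>) F" "(K \<longlongrightarrow> \<kappa>) F" "\<sigma> > 0" "\<kappa> > 0"
  shows "((\<lambda>x. nmom j (S x) (K x)) \<longlongrightarrow> nmom j \<sigma> \<kappa>) F"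
  unfolding nmom_def
proof (rule tendsto_mom)
  have "\<forall>\<^sub>F x in F. S x > 0" "\<forall>\<^sub>F x in F. K x > 0"
    using order_tendstoD(1)[OF assms(2,4)] order_tendstoD(1)[OF assms(3,5)] by auto
  then show "\<forall>\<^sub>F x in F. S x + K x \<ge> 0 \<and> 1 + S x * K x \<ge> 0 \<and> K x > 0"
    by eventually_elim auto
qed (use assms in \<open>auto intro!: tendsto_intros\<close>)

text \<open>For rotation rates \<open>l\<close> and \<open>m\<close> about the third axis, \<open>crit 1\<close> is proportional to \<open>(l + m)\<^sup>2\<close> and \<open>crit 0\<close>
to \<open>2 l m\<close>. The parameter \<open>\<theta>\<close> lets one argument treat the zeros of both.\<close>

definition crit :: "real \<Rightarrow> real \<Rightarrow> real \<Rightarrow> real" where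
  "crit \<theta> \<sigma> \<kappa> = (\<kappa> * (\<sigma> + \<theta>) - 1) * nmom 1 \<sigma> \<kappa> + (\<kappa> + \<theta>) * nmom 2 \<sigma> \<kappa>"

lemma tendsto_crit:
  assumes "(S \<longlongrightarrow> \<sigma>) F" "(K \<longlongrightarrow> \<kappa>) F" "\<sigma> > 0" "\<kappa> > 0"
  shows "((\<lambda>x. crit \<theta> (S x) (K x)) \<longlongrightarrow> crit \<theta> \<sigma> \<kappa>) F"
  unfolding crit_def using assms by (intro tendsto_intros tendsto_nmom) auto

lemma cub_factor: "cub (\<sigma> + \<kappa>) (1 + \<sigma> * \<kappa>) \<kappa> s = (s\<^sup>2 + \<sigma> * s + 1) * (s + \<kappa>)"
  unfolding cub_def by (simp add: algebra_simps power2_eq_square power3_eq_cube)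

text \<open>Going from \<open>\<kappa>\<^sub>1\<close> to \<open>\<kappa>\<^sub>2\<close> multiplies the integrand of \<open>p m\<^sub>1 + q m\<^sub>2\<close> by
\<open>((x + \<kappa>\<^sub>1) / (x + \<kappa>\<^sub>2)) powr (3/2)\<close>, which increases with \<open>x\<close>. The factor \<open>p + q x\<close> is negative
to the left of \<open>- p / q\<close> and positive to the right of it, so replacing this weight by its value at the sign change can only
decrease the integral.\<close>

lemma nmom_compare:
  assumes s: "\<sigma> \<ge> 0" and k: "0 < \<kappa>\<^sub>1" "\<kappa>\<^sub>1 \<le> \<kappa>\<^sub>2" and q: "q > 0"
    and nn: "p * nmom 1 \<sigma> \<kappa>\<^sub>1 + q * nmom 2 \<sigma> \<kappa>\<^sub>1 \<ge> 0"
  shows "p * nmom 1 \<sigma> \<kappa>\<^sub>2 + q * nmom 2 \<sigma> \<kappa>\<^sub>2 \<ge> 0"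
proof -
  \<comment> \<open>the sign change of \<open>p + q x\<close>, moved into the domain of integration\<close>
  define m where "m = max 0 (- p / q)"
  define t where "t x = (x + \<kappa>\<^sub>1) / (x + \<kappa>\<^sub>2)" for x
  define C where "C \<kappa> x = cub (\<sigma> + \<kappa>) (1 + \<sigma> * \<kappa>) \<kappa> x" for \<kappa> x
  define f where "f \<kappa> x = (p + q * x) * x / (C \<kappa> x * sqrt (C \<kappa> x))" for \<kappa> x
  have fi: "(f \<kappa> has_integral p * nmom 1 \<sigma> \<kappa> + q * nmom 2 \<sigma> \<kappa>) {0..}" if "\<kappa> > 0" for \<kappa>
  proof -
    have "((\<lambda>x. p * (x^1 / (C \<kappa> x * sqrt (C \<kappa> x))) + q * (x^2 / (C \<kappa> x * sqrt (C \<kappa> x)))) has_integral p * nmom 1 \<sigma> \<kappa> + q * nmom 2 \<sigma> \<kappa>) {0..}"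
      unfolding nmom_def mom_def C_def using that s
      by (intro has_integral_add has_integral_mult_right integrable_integral mom_integrable) auto
    then show ?thesis unfolding f_def
      by (simp add: power2_eq_square algebra_simps add_divide_distrib)
  qed
  have tmono: "t x \<le> t y" if "0 \<le> x" "x \<le> y" for x y
  proof -
    have "0 \<le> (y - x) * (\<kappa>\<^sub>2 - \<kappa>\<^sub>1)" using that k by simp
    then have "(x + \<kappa>\<^sub>1) * (y + \<kappa>\<^sub>2) \<le> (y + \<kappa>\<^sub>1) * (x + \<kappa>\<^sub>2)" by (simp add: algebra_simps)
    moreover have "x + \<kappa>\<^sub>2 > 0" "y + \<kappa>\<^sub>2 > 0" using that k by auto
    ultimately show ?thesis unfolding t_def by (simp only: pos_divide_le_eq times_divide_eq_left pos_le_divide_eq)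
  qed
  have tpos: "t x > 0" if "x \<ge> 0" for x using that k by (simp add: t_def)
  define w where "w x = t x * sqrt (t x)" for x
  have wmono: "w x \<le> w y" if "0 \<le> x" "x \<le> y" for x y
    unfolding w_def using tmono[OF that] tpos[of x] that by (intro mult_mono) auto
  have f2: "f \<kappa>\<^sub>2 x = w x * f \<kappa>\<^sub>1 x" if "x \<ge> 0" for x
  proof -
    have C2: "C \<kappa>\<^sub>2 x = C \<kappa>\<^sub>1 x / t x" using that k unfolding C_def cub_factor t_def by simp
    have "C \<kappa>\<^sub>1 x > 0" using that k s unfolding C_def by (intro cub_pos) auto
    then show ?thesis unfolding f_def C2 w_def using tpos[OF that] by (simp add: real_sqrt_divide)
  qed
  have le: "w m * f \<kappa>\<^sub>1 x \<le> f \<kappa>\<^sub>2 x" if x: "x \<ge> 0" for x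
  proof (cases "x \<ge> m")
    case True
    then have "- p / q \<le> x" by (simp add: m_def)
    then have "p + q * x \<ge> 0" using q by (simp add: divide_simps mult.commute)
    then have "f \<kappa>\<^sub>1 x \<ge> 0" unfolding f_def C_def using x k s cub_pos[of "\<sigma> + \<kappa>\<^sub>1" "1 + \<sigma> * \<kappa>\<^sub>1" \<kappa>\<^sub>1 x] by simp
    then show ?thesis unfolding f2[OF x] using wmono[of m x] True by (intro mult_right_mono) (auto simp: m_def)
  next
    case False
    then have "x \<le> - p / q" using x by (auto simp: m_def max_def split: if_splits)
    then have "p + q * x \<le> 0" using q by (simp add: divide_simps mult.commute)
    then have "f \<kappa>\<^sub>1 x \<le> 0" unfolding f_def C_def using x k s cub_pos[of "\<sigma> + \<kappa>\<^sub>1" "1 + \<sigma> * \<kappa>\<^sub>1" \<kappa>\<^sub>1 x]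
      by (intro divide_nonpos_pos mult_nonpos_nonneg) auto
    then show ?thesis unfolding f2[OF x] using wmono[of x m] False x by (intro mult_right_mono_neg) auto
  qed
  have k2: "\<kappa>\<^sub>2 > 0" using k by simp
  have "w m * (p * nmom 1 \<sigma> \<kappa>\<^sub>1 + q * nmom 2 \<sigma> \<kappa>\<^sub>1) \<le> p * nmom 1 \<sigma> \<kappa>\<^sub>2 + q * nmom 2 \<sigma> \<kappa>\<^sub>2"
    by (rule has_integral_le[OF has_integral_mult_right[OF fi[OF k(1)]] fi[OF k2]]) (use le in auto)
  moreover have "w m \<ge> 0" using tpos[of m] by (simp add: w_def m_def)
  ultimately show ?thesis using nn mult_nonneg_nonneg[of "w m"] by (meson order_trans)
qed

text \<open>At most one sign change in \<open>\<kappa>\<close>, from negative to positive: with the coefficients frozen at \<open>\<kappa>\<^sub>1\<close> this is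
\<open>nmom_compare\<close>, and both coefficients increase strictly with \<open>\<kappa>\<close>.\<close>

lemma crit_mono:
  assumes "\<theta> \<ge> 0" "\<sigma> > 0" "0 < \<kappa>\<^sub>1" "\<kappa>\<^sub>1 < \<kappa>\<^sub>2" "crit \<theta> \<sigma> \<kappa>\<^sub>1 \<ge> 0"
  shows "crit \<theta> \<sigma> \<kappa>\<^sub>2 > 0"
proof -
  define a b where "a = nmom 1 \<sigma> \<kappa>\<^sub>2" and "b = nmom 2 \<sigma> \<kappa>\<^sub>2"
  have "\<kappa>\<^sub>2 > 0" using assms(3,4) by simp
  then have ab: "a > 0" "b > 0" unfolding a_def b_def using assms(2) by (simp_all add: nmom_pos)
  have "(\<kappa>\<^sub>1 * (\<sigma> + \<theta>) - 1) * a + (\<kappa>\<^sub>1 + \<theta>) * b \<ge> 0"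
    unfolding a_def b_def
  proof (rule nmom_compare[of \<sigma> \<kappa>\<^sub>1])
    show "(\<kappa>\<^sub>1 * (\<sigma> + \<theta>) - 1) * nmom 1 \<sigma> \<kappa>\<^sub>1 + (\<kappa>\<^sub>1 + \<theta>) * nmom 2 \<sigma> \<kappa>\<^sub>1 \<ge> 0"
      using assms(5) unfolding crit_def .
  qed (use assms(1-4) in simp_all)
  moreover have "(\<kappa>\<^sub>2 - \<kappa>\<^sub>1) * (\<sigma> + \<theta>) * a + (\<kappa>\<^sub>2 - \<kappa>\<^sub>1) * b > 0"
    using assms(4) ab add_pos_nonneg[OF assms(2,1)] by (simp add: add_pos_pos)
  ultimately show ?thesis unfolding crit_def a_def[symmetric] b_def[symmetric] by (simp add: algebra_simps)
qed

text \<open>Monotonicity replaces the implicit function theorem: since the sign of \<open>crit \<theta> \<sigma>\<close> at a point tells on which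
side of it the zero lies, continuity of \<open>crit\<close> gives continuity of the zero.\<close>

lemma crit_root_branch:
  assumes th: "\<theta> \<ge> 0" and k0: "\<kappa>\<^sub>0 > 0" and z: "crit \<theta> 2 \<kappa>\<^sub>0 = 0"
  obtains k \<sigma>\<^sub>1 where "\<sigma>\<^sub>1 > 2" "continuous_on {2..<\<sigma>\<^sub>1} k" "k 2 = \<kappa>\<^sub>0"
    "\<And>\<sigma>. \<sigma> \<in> {2..<\<sigma>\<^sub>1} \<Longrightarrow> k \<sigma> > 0 \<and> crit \<theta> \<sigma> (k \<sigma>) = 0"
proof -
  have neg: "crit \<theta> 2 (\<kappa>\<^sub>0 / 2) < 0"
    using crit_mono[OF th, of 2 "\<kappa>\<^sub>0/2" \<kappa>\<^sub>0] k0 z by force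
  have pos: "crit \<theta> 2 (2 * \<kappa>\<^sub>0) > 0"
    using crit_mono[OF th, of 2 \<kappa>\<^sub>0 "2 * \<kappa>\<^sub>0"] k0 z by force
  have ts: "((\<lambda>s. crit \<theta> s x) \<longlongrightarrow> crit \<theta> s0 x) (at s0 within A)" if "s0 > 0" "x > 0" for x s0 A
    using that by (intro tendsto_crit tendsto_intros) auto
  have "\<forall>\<^sub>F s in at 2. crit \<theta> s (\<kappa>\<^sub>0 / 2) < 0 \<and> crit \<theta> s (2 * \<kappa>\<^sub>0) > 0"
    using order_tendstoD(2)[OF ts[of 2 "\<kappa>\<^sub>0/2" UNIV] neg] order_tendstoD(1)[OF ts[of 2 "2 * \<kappa>\<^sub>0" UNIV] pos] k0
    by (auto intro: eventually_conj)
  then obtain d where d: "d > 0" "\<And>s. s \<noteq> 2 \<Longrightarrow> dist s 2 < d \<Longrightarrow> crit \<theta> s (\<kappa>\<^sub>0 / 2) < 0 \<and> crit \<theta> s (2 * \<kappa>\<^sub>0) > 0"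
    unfolding eventually_at by blast
  have sg: "crit \<theta> s (\<kappa>\<^sub>0 / 2) < 0 \<and> crit \<theta> s (2 * \<kappa>\<^sub>0) > 0" if "s \<in> {2..<2+d}" for s
    using d(2)[of s] neg pos that by (cases "s = 2") (auto simp: dist_real_def)
  have ex: "\<exists>x\<ge>\<kappa>\<^sub>0/2. x \<le> 2 * \<kappa>\<^sub>0 \<and> crit \<theta> s x = 0" if "s \<in> {2..<2+d}" for s
  proof (rule IVT')
    show "continuous_on {\<kappa>\<^sub>0/2..2*\<kappa>\<^sub>0} (crit \<theta> s)"
      unfolding continuous_on_def using k0 that by (intro ballI tendsto_crit tendsto_intros) auto
  qed (use sg[OF that] k0 in auto)
  then obtain k where k: "\<And>s. s \<in> {2..<2+d} \<Longrightarrow> k s \<ge> \<kappa>\<^sub>0 / 2 \<and> crit \<theta> s (k s) = 0" by metis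
  have kp: "k s > 0" if "s \<in> {2..<2+d}" for s using k[OF that] k0 by auto
  have lt: "x < k s \<longleftrightarrow> crit \<theta> s x < 0" and gt: "x > k s \<longleftrightarrow> crit \<theta> s x > 0"
    if s: "s \<in> {2..<2+d}" and x: "x > 0" for s x
  proof -
    have "s > 0" "k s > 0" "crit \<theta> s (k s) = 0" using s k[OF s] kp[OF s] by auto
    then have "k s < x \<Longrightarrow> crit \<theta> s x > 0" "x < k s \<Longrightarrow> \<not> crit \<theta> s x \<ge> 0" "x = k s \<Longrightarrow> crit \<theta> s x = 0"
      using crit_mono[OF th, of s "k s" x] crit_mono[OF th, of s x "k s"] x by auto
    then show "x < k s \<longleftrightarrow> crit \<theta> s x < 0" "x > k s \<longleftrightarrow> crit \<theta> s x > 0" by linarith+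
  qed
  have "k 2 = \<kappa>\<^sub>0" using lt[of 2 \<kappa>\<^sub>0] gt[of 2 \<kappa>\<^sub>0] d(1) k0 z by auto
  moreover have "continuous_on {2..<2+d} k"
    unfolding continuous_on_def
  proof (intro ballI order_tendstoI)
    fix s y assume s: "s \<in> {2..<2+d}" and y: "y < k s"
    have ev: "\<forall>\<^sub>F s' in at s within {2..<2+d}. s' \<in> {2..<2+d}" by (simp add: eventually_at_filter)
    \<comment> \<open>\<open>y\<close> may be negative, while \<open>crit\<close> is controlled at positive arguments only\<close>
    define y' where "y' = max y (k s / 2)"
    have y': "y' > 0" "y' < k s" "y \<le> y'" using y kp[OF s] by (auto simp: y'_def)
    have "\<forall>\<^sub>F s' in at s within {2..<2+d}. crit \<theta> s' y' < 0"
      using order_tendstoD(2)[OF ts[of s y']] lt[OF s y'(1)] y' s by auto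
    then show "\<forall>\<^sub>F s' in at s within {2..<2+d}. y < k s'"
      using ev by eventually_elim (use lt y' in fastforce)
  next
    fix s y assume s: "s \<in> {2..<2+d}" and y: "k s < y"
    have ev: "\<forall>\<^sub>F s' in at s within {2..<2+d}. s' \<in> {2..<2+d}" by (simp add: eventually_at_filter)
    have y': "y > 0" using y kp[OF s] by auto
    have "\<forall>\<^sub>F s' in at s within {2..<2+d}. crit \<theta> s' y > 0"
      using order_tendstoD(1)[OF ts[of s y]] gt[OF s y'(1)] y y' s by auto
    then show "\<forall>\<^sub>F s' in at s within {2..<2+d}. k s' < y"
      using ev by eventually_elim (use gt y' in fastforce)
  qed
  ultimately show ?thesis using that[of "2 + d" k] d(1) k kp by auto
qed


section \<open>Closed forms at spheroids and the critical eccentricity\<close>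

lemma arctan_complement_arcsin:
  assumes "0 < e" "e < 1"
  shows "pi / 2 - arctan (sqrt (1 - e\<^sup>2) / e) = arcsin e"
proof -
  have "e\<^sup>2 < 1" using assms by (simp add: power_less_one_iff)
  then have "sqrt (1 - e\<^sup>2) / e > 0" using assms by simp
  then have "arctan (1 / (sqrt (1 - e\<^sup>2) / e)) = pi / 2 - arctan (sqrt (1 - e\<^sup>2) / e)"
    using arctan_inverse[of "sqrt (1 - e\<^sup>2) / e"] by simp
  then show ?thesis using arcsin_arctan[of e] assms by simp
qed

lemma mult_div_sqrt: "x > 0 \<Longrightarrow> x * c / sqrt x = sqrt x * (c::real)"
  using real_div_sqrt[of x] by (simp flip: times_divide_eq_left)

text \<open>With \<open>X = sqrt (s + \<kappa>)\<close> the moment of a spheroid is the integral of a rational function of \<open>X\<close>. Its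
antiderivative is sought in the form \<open>a / e * arctan (X / e) + N / (X (s + 1)\<^sup>2)\<close> with \<open>N\<close>
quadratic in \<open>s + \<kappa>\<close>, and the assumed polynomial identity says that its derivative is the
integrand.\<close>

lemma spheroid_nmom:
  assumes e: "0 < e" "e < 1" and k: "\<kappa> = 1 - e\<^sup>2" and j: "j \<le> 2"
    and id: "\<And>s. s \<ge> 0 \<Longrightarrow> a * (s + \<kappa>) * (s + 1)\<^sup>2 + 2 * (b1 + 2 * a * (s + \<kappa>)) * (s + \<kappa>) * (s + 1)
        - (b0 + b1 * (s + \<kappa>) + a * (s + \<kappa>)\<^sup>2) * ((s + 1) + 4 * (s + \<kappa>)) = 2 * s^j"
  shows "nmom j 2 \<kappa> = a / e * arcsin e - (b0 + b1 * \<kappa> + a * \<kappa>\<^sup>2) / sqrt \<kappa>"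
proof -
  define N where "N s = b0 + b1 * (s + \<kappa>) + a * (s + \<kappa>)\<^sup>2" for s
  define F where "F s = a / e * arctan (sqrt (s + \<kappa>) / e) + N s / (sqrt (s + \<kappa>) * (s + 1)\<^sup>2)" for s
  let ?f = "\<lambda>s. s^j / (cub (2 + \<kappa>) (1 + 2 * \<kappa>) \<kappa> s * sqrt (cub (2 + \<kappa>) (1 + 2 * \<kappa>) \<kappa> s))"
  have k0: "\<kappa> > 0" using e unfolding k by (simp add: power_less_one_iff)
  have fe: "?f s = s^j / ((s + 1)^3 * (s + \<kappa>) * sqrt (s + \<kappa>))" if "s \<ge> 0" for s
  proof -
    have "cub (2 + \<kappa>) (1 + 2 * \<kappa>) \<kappa> s = (s + 1)\<^sup>2 * (s + \<kappa>)"
      unfolding cub_factor by (simp add: power2_eq_square algebra_simps)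
    then show ?thesis using that by (simp add: real_sqrt_mult power2_eq_square power3_eq_cube mult_ac)
  qed
  have der: "(F has_real_derivative ?f s) (at s)" if s: "s \<ge> 0" for s
  proof -
    define X where "X = sqrt (s + \<kappa>)"
    have X: "X > 0" "X * X = s + \<kappa>" using s k0 by (auto simp: X_def)
    have s1: "e * e + X * X = s + 1" using X(2) k by (simp add: power2_eq_square)
    have Np: "(N has_real_derivative b1 + 2 * a * (s + \<kappa>)) (at s)"
      unfolding N_def by (auto intro!: derivative_eq_intros)
    have sq: "((\<lambda>s. sqrt (s + \<kappa>)) has_real_derivative 1 / (2 * X)) (at s)"
      using X s k0 unfolding X_def by (auto intro!: derivative_eq_intros simp: divide_simps)
    have at: "((\<lambda>s. arctan (sqrt (s + \<kappa>) / e)) has_real_derivative e / (2 * X * (s + 1))) (at s)"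
    proof -
      have "((\<lambda>s. arctan (sqrt (s + \<kappa>) / e)) has_real_derivative inverse (1 + (sqrt (s + \<kappa>) / e)\<^sup>2) * (1 / (2 * X) / e)) (at s)"
        by (intro DERIV_chain'[OF _ DERIV_arctan] DERIV_cdivide sq)
      moreover have "inverse (1 + (sqrt (s + \<kappa>) / e)\<^sup>2) = e * e / (s + 1)"
        unfolding X_def[symmetric] s1[symmetric] using e X by (simp add: field_simps power2_eq_square)
      moreover have "e * e / (s + 1) * (1 / (2 * X) / e) = e / (2 * X * (s + 1))" using e by simp
      ultimately show ?thesis by simp
    qed
    have pw: "((\<lambda>s. (s + 1)\<^sup>2) has_real_derivative 2 * (s + 1)) (at s)"
      by (auto intro!: derivative_eq_intros)
    have "X * (s + 1)\<^sup>2 \<noteq> 0" using X s by simp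
    then have "(F has_real_derivative a / e * (e / (2 * X * (s + 1))) +
        ((b1 + 2 * a * (s + \<kappa>)) * (X * (s + 1)\<^sup>2) - N s * (1 / (2 * X) * (s + 1)\<^sup>2 + 2 * (s + 1) * X)) / ((X * (s + 1)\<^sup>2) * (X * (s + 1)\<^sup>2))) (at s)"
      unfolding F_def X_def
      by (intro DERIV_add DERIV_cmult DERIV_divide DERIV_mult at[unfolded X_def] sq[unfolded X_def] Np pw)
    moreover have "a / e * (e / (2 * X * (s + 1))) +
        ((b1 + 2 * a * (s + \<kappa>)) * (X * (s + 1)\<^sup>2) - N s * (1 / (2 * X) * (s + 1)\<^sup>2 + 2 * (s + 1) * X)) / ((X * (s + 1)\<^sup>2) * (X * (s + 1)\<^sup>2))
      = (a * (X * X) * (s + 1)\<^sup>2 + 2 * (b1 + 2 * a * (s + \<kappa>)) * (X * X) * (s + 1) - N s * ((s + 1) + 4 * (X * X))) / (2 * (X * X) * X * (s + 1)^3)"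
    proof -
      define n m w where "n = N s" and "m = b1 + 2 * a * (s + \<kappa>)" and "w = s + 1"
      have "w > 0" using s by (simp add: w_def)
      then show ?thesis unfolding n_def[symmetric] m_def[symmetric] w_def[symmetric] using X(1) e
        by (simp add: divide_simps) (simp add: eval_nat_numeral algebra_simps)
    qed
    moreover have "\<dots> = ?f s"
      unfolding fe[OF s] N_def X_def[symmetric] unfolding X(2) id[OF s]
      using mult_divide_mult_cancel_left[of "2::real" "s^j" "(s + 1)^3 * (s + \<kappa>) * X"] by (simp only: mult_ac)
    ultimately show ?thesis by simp
  qed
  have "(?f has_integral (a / e * (pi / 2) - F 0)) {0..}"
  proof (rule has_integral_to_inf)
    have I: "(?f has_integral (F y - F 0)) {0..y}" if "y \<ge> 0" for y
      using that der by (intro fundamental_theorem_of_calculus)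
        (auto simp flip: has_real_derivative_iff_has_vector_derivative intro: has_field_derivative_at_within)
    show "?f integrable_on {0..y}" for y
      using I[of y] by (cases "y \<ge> 0") (auto simp: integrable_on_empty)
    have l1: "((\<lambda>s. arctan (sqrt (s + \<kappa>) / e)) \<longlongrightarrow> pi / 2) at_top"
      using e by real_asymp
    have l2: "((\<lambda>s. N s / (sqrt (s + \<kappa>) * (s + 1)\<^sup>2)) \<longlongrightarrow> 0) at_top"
      unfolding N_def by real_asymp
    have "((\<lambda>y. F y - F 0) \<longlongrightarrow> a / e * (pi / 2) + 0 - F 0) at_top"
      unfolding F_def[of y for y] by (intro tendsto_intros l1 l2)
    moreover have "\<forall>\<^sub>F y in at_top. F y - F 0 = integral {0..y} ?f"
      using eventually_ge_at_top[of 0] by (rule eventually_mono) (simp add: integral_unique[OF I])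
    ultimately show "((\<lambda>y. integral {0..y} ?f) \<longlongrightarrow> a / e * (pi / 2) - F 0) at_top"
      using Lim_transform_eventually[of "\<lambda>y. F y - F 0"] by simp
    show "?f y \<ge> 0" if "y \<ge> 0" for y using that k0 by (intro mom_integrand_nonneg) auto
  qed
  then have "nmom j 2 \<kappa> = a / e * (pi / 2) - F 0"
    unfolding nmom_def mom_def by (rule integral_unique)
  also have "\<dots> = a / e * (pi / 2 - arctan (sqrt \<kappa> / e)) - (b0 + b1 * \<kappa> + a * \<kappa>\<^sup>2) / sqrt \<kappa>"
    by (simp add: F_def N_def right_diff_distrib)
  finally show ?thesis using arctan_complement_arcsin[OF e] by (simp add: k)
qed

lemma spheroid_nmom_1:
  assumes e: "0 < e" "e < 1"
  shows "nmom 1 2 (1 - e\<^sup>2) = (15/4 - 3 * e\<^sup>2) / e^7 * arcsin e - sqrt (1 - e\<^sup>2) * (15/4 - e\<^sup>2 / 2) / e^6"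
proof -
  let ?k = "1 - e\<^sup>2" and ?a = "(15/4 - 3 * e\<^sup>2) / e^6"
  let ?b1 = "(25/4 - 5 * e\<^sup>2) / e^4" and ?b0 = "2 * (1 - e\<^sup>2) / e\<^sup>2"
  have "?k > 0" using e by (simp add: power_less_one_iff)
  have "nmom 1 2 ?k = ?a / e * arcsin e - (?b0 + ?b1 * ?k + ?a * ?k\<^sup>2) / sqrt ?k"
    using e by (intro spheroid_nmom[OF e refl])
      (simp_all add: divide_simps, simp_all add: algebra_simps eval_nat_numeral)
  also have "?b0 + ?b1 * ?k + ?a * ?k\<^sup>2 = ?k * ((15/4 - e\<^sup>2 / 2) / e^6)"
    using e by (simp add: divide_simps) (simp add: algebra_simps eval_nat_numeral)
  also have "?k * ((15/4 - e\<^sup>2 / 2) / e^6) / sqrt ?k = sqrt ?k * ((15/4 - e\<^sup>2 / 2) / e^6)"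
    using \<open>?k > 0\<close> by (intro mult_div_sqrt)
  finally show ?thesis by (simp add: eval_nat_numeral)
qed


lemma spheroid_nmom_2:
  assumes e: "0 < e" "e < 1"
  shows "nmom 2 2 (1 - e\<^sup>2) = (6 * e\<^sup>2 - 2 * e^4 - 15/4) / e^7 * arcsin e - sqrt (1 - e\<^sup>2) * (7/2 * e\<^sup>2 - 15/4) / e^6"
proof -
  let ?k = "1 - e\<^sup>2" and ?a = "(6 * e\<^sup>2 - 2 * e^4 - 15/4) / e^6"
  let ?b1 = "(5 * ((6 * e\<^sup>2 - 2 * e^4 - 15/4) / e^4) - 2) / 3" and ?b0 = "- 2 * (1 - e\<^sup>2)\<^sup>2 / e\<^sup>2"
  have "?k > 0" using e by (simp add: power_less_one_iff)
  have "nmom 2 2 ?k = ?a / e * arcsin e - (?b0 + ?b1 * ?k + ?a * ?k\<^sup>2) / sqrt ?k"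
    using e by (intro spheroid_nmom[OF e refl])
      (simp_all add: divide_simps, simp_all add: algebra_simps eval_nat_numeral)
  also have "?b0 + ?b1 * ?k + ?a * ?k\<^sup>2 = ?k * ((7/2 * e\<^sup>2 - 15/4) / e^6)"
    using e by (simp add: divide_simps) (simp add: algebra_simps eval_nat_numeral)
  also have "?k * ((7/2 * e\<^sup>2 - 15/4) / e^6) / sqrt ?k = sqrt ?k * ((7/2 * e\<^sup>2 - 15/4) / e^6)"
    using \<open>?k > 0\<close> by (intro mult_div_sqrt)
  finally show ?thesis by (simp add: eval_nat_numeral)
qed

lemma S2_eq_crit:
  assumes e: "0 < e" "e < 1"
  shows "S2 rho0 grav e = 2 * R_const rho0 grav * sqrt (1 - e\<^sup>2) * crit 1 2 (1 - e\<^sup>2)"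
proof -
  define w where "w = sqrt (1 - e\<^sup>2)"
  define A where "A = arcsin e"
  have "e\<^sup>2 < 1" using e by (simp add: power_less_one_iff)
  then have w: "1 - e\<^sup>2 = w * w" by (simp add: w_def)
  have "2 * w * crit 1 2 (1 - e\<^sup>2) = (e * (w * w) * (3 + 4 * e\<^sup>2) - w * (3 + 2 * e\<^sup>2 - 4 * e^4) * A) / e^5"
  proof -
    have "crit 1 2 (1 - e\<^sup>2) = (2 - 3 * e\<^sup>2) * nmom 1 2 (1 - e\<^sup>2) + (2 - e\<^sup>2) * nmom 2 2 (1 - e\<^sup>2)"
      unfolding crit_def by (simp add: algebra_simps)
    also have "\<dots> = (w * (e * (3 + 4 * e\<^sup>2)) - (3 + 2 * e\<^sup>2 - 4 * e^4) * A) / (2 * e^5)"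
      unfolding spheroid_nmom_1[OF e] spheroid_nmom_2[OF e] w_def[symmetric] A_def[symmetric]
      using e by (simp add: divide_simps) (simp add: algebra_simps eval_nat_numeral)
    finally have "crit 1 2 (1 - e\<^sup>2) = (w * (e * P) - Q * A) / (2 * e^5)"
      if "P = 3 + 4 * e\<^sup>2" "Q = 3 + 2 * e\<^sup>2 - 4 * e^4" for P Q using that by simp
    moreover have "2 * w * ((w * (e * P) - Q * A) / (2 * e^5)) = (e * (w * w) * P - w * Q * A) / e^5" for P Q
      using e by (simp add: field_simps)
    ultimately show ?thesis by simp
  qed
  then have "R_const rho0 grav * (2 * w * crit 1 2 (1 - e\<^sup>2)) =
      R_const rho0 grav * ((e * (w * w) * (3 + 4 * e\<^sup>2) - w * (3 + 2 * e\<^sup>2 - 4 * e^4) * A) / e^5)"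
    by (rule arg_cong)
  then show ?thesis unfolding S2_def w_def[symmetric] A_def[symmetric] unfolding w
    by (simp only: times_divide_eq_left times_divide_eq_right mult.assoc mult.left_commute)
qed

lemma maclaurin_Omega_eq:
  assumes e: "0 < e" "e < 1" and pos: "rho0 > 0" "grav > 0"
  shows "(maclaurin_Omega rho0 grav e)\<^sup>2 =
      2 * pi * rho0 * grav * e\<^sup>2 * sqrt (1 - e\<^sup>2) * (nmom 1 2 (1 - e\<^sup>2) + nmom 2 2 (1 - e\<^sup>2))"
    and "maclaurin_Omega rho0 grav e > 0"
proof -
  define w where "w = sqrt (1 - e\<^sup>2)"
  define A where "A = arcsin e"
  have e1: "e\<^sup>2 < 1" using e by (simp add: power_less_one_iff)
  then have w: "1 - e\<^sup>2 = w * w" and w0: "w > 0" by (simp_all add: w_def)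
  have "2 * w / e^3 * (3 - 2 * e\<^sup>2) * A - 6 / e\<^sup>2 * (w * w)
     = 2 * e\<^sup>2 * w * (nmom 1 2 (1 - e\<^sup>2) + nmom 2 2 (1 - e\<^sup>2))"
    unfolding spheroid_nmom_1[OF e] spheroid_nmom_2[OF e] w_def[symmetric] A_def[symmetric]
    using e by (simp add: divide_simps) (simp add: algebra_simps eval_nat_numeral)
  then have q: "pi * rho0 * grav * (2 * sqrt (1 - e\<^sup>2) / e^3 * (3 - 2 * e\<^sup>2) * arcsin e - 6 / e\<^sup>2 * (1 - e\<^sup>2))
    = 2 * pi * rho0 * grav * e\<^sup>2 * w * (nmom 1 2 (1 - e\<^sup>2) + nmom 2 2 (1 - e\<^sup>2))"
    unfolding w_def[symmetric] A_def[symmetric] unfolding w by (simp only: mult.assoc mult.left_commute)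
  have p: "\<dots> > 0" using pos e w0 e1 by (intro mult_pos_pos add_pos_pos nmom_pos) auto
  show "(maclaurin_Omega rho0 grav e)\<^sup>2 =
      2 * pi * rho0 * grav * e\<^sup>2 * sqrt (1 - e\<^sup>2) * (nmom 1 2 (1 - e\<^sup>2) + nmom 2 2 (1 - e\<^sup>2))"
    unfolding maclaurin_Omega_def q unfolding w_def[symmetric] using p by (simp del: mult_pos_pos)
  show "maclaurin_Omega rho0 grav e > 0"
    unfolding maclaurin_Omega_def q using p by simp
qed

text \<open>Existence of a zero follows from opposite signs at \<open>e = 1/2\<close> and \<open>e = 99/100\<close>, uniqueness and the signs
on both sides from \<open>crit_mono\<close>, since \<open>\<kappa> = 1 - e\<^sup>2\<close> decreases with \<open>e\<close>.\<close>

lemma e_crit_sign: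
  assumes pos: "rho0 > 0" "grav > 0"
  shows "e_crit rho0 grav \<in> {0<..<1}"
    and "\<And>e. e \<in> {0<..<1} \<Longrightarrow> e < e_crit rho0 grav \<longleftrightarrow> crit 1 2 (1 - e\<^sup>2) > 0"
    and "\<And>e. e \<in> {0<..<1} \<Longrightarrow> e = e_crit rho0 grav \<longleftrightarrow> crit 1 2 (1 - e\<^sup>2) = 0"
proof -
  have R: "R_const rho0 grav > 0" unfolding R_const_def using pos by simp
  have s0: "S2 rho0 grav e = 0 \<longleftrightarrow> crit 1 2 (1 - e\<^sup>2) = 0" if "e \<in> {0<..<1}" for e
  proof -
    have "e\<^sup>2 < 1" using that by (simp add: power_less_one_iff)
    then show ?thesis using S2_eq_crit[of e rho0 grav] R that by auto
  qed
  have mono: "crit 1 2 (1 - a\<^sup>2) > 0" if "0 < a" "a < b" "b < 1" "crit 1 2 (1 - b\<^sup>2) \<ge> 0" for a b :: real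
  proof (rule crit_mono[of 1 2 "1 - b\<^sup>2"])
    show "0 < 1 - b\<^sup>2" using that by (simp add: power_less_one_iff)
    show "1 - b\<^sup>2 < 1 - a\<^sup>2" using that by (simp add: power_strict_mono)
  qed (use that in auto)
  have "\<exists>e\<ge>1/2. e \<le> 99/100 \<and> crit 1 2 (1 - e\<^sup>2) = 0"
  proof (rule IVT2')
    have "S2 rho0 grav (99/100) < 0"
    proof -
      have "arcsin (99/100) \<ge> 99/100"
      proof -
        have "sin (arcsin (99/100)) \<le> arcsin (99/100)"
          by (rule sin_x_le_x) (use arcsin_le_arcsin[of 0 "99/100"] in simp)
        then show ?thesis by simp
      qed
      \<comment> \<open>\<open>1 - 0.99\<^sup>2 = 0.0199 \<ge> 0.141\<^sup>2\<close>\<close>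
      moreover have "sqrt (1 - (99/100)\<^sup>2) \<ge> 141/1000"
        by (rule real_le_rsqrt) (simp add: power2_eq_square)
      ultimately have "141/1000 * (11178/10000) * (99/100) \<le> sqrt (1 - (99/100)\<^sup>2) * (3 + 2 * (99/100)\<^sup>2 - 4 * (99/100)^4) * arcsin (99/100)"
        by (intro mult_mono) (auto simp: power2_eq_square eval_nat_numeral)
      moreover have "99/100 * (1 - (99/100)\<^sup>2) * (3 + 4 * (99/100)\<^sup>2) < (141/1000 * (11178/10000) * (99/100) :: real)"
        by (simp add: power2_eq_square)
      ultimately have "99/100 * (1 - (99/100)\<^sup>2) * (3 + 4 * (99/100)\<^sup>2) - sqrt (1 - (99/100)\<^sup>2) * (3 + 2 * (99/100)\<^sup>2 - 4 * (99/100)^4) * arcsin (99/100) < 0"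
        by linarith
      then show ?thesis unfolding S2_def using R by (intro mult_pos_neg divide_pos_pos) auto
    qed
    moreover have "2 * R_const rho0 grav * sqrt (1 - (99/100)\<^sup>2) > 0" using R by (simp add: power2_eq_square)
    ultimately show "crit 1 2 (1 - (99/100)\<^sup>2) \<le> 0"
      using S2_eq_crit[of "99/100" rho0 grav] mult_pos_pos[of "2 * R_const rho0 grav * sqrt (1 - (99/100)\<^sup>2)" "crit 1 2 (1 - (99/100)\<^sup>2)"]
      by linarith
    show "crit 1 2 (1 - (1/2)\<^sup>2) \<ge> 0"
      unfolding crit_def using nmom_pos[of 2 "1 - (1/2)\<^sup>2" 1] nmom_pos[of 2 "1 - (1/2)\<^sup>2" 2]
      by (intro add_nonneg_nonneg mult_nonneg_nonneg) (auto simp: power2_eq_square)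
    show "continuous_on {1/2..99/100} (\<lambda>e. crit 1 2 (1 - e\<^sup>2))"
      unfolding continuous_on_def
    proof (intro ballI tendsto_crit tendsto_intros)
      fix x :: real assume "x \<in> {1/2..99/100}"
      then have "x\<^sup>2 < 1" by (simp add: power_less_one_iff)
      then show "0 < 1 - x\<^sup>2" by simp
    qed auto
  qed auto
  then obtain c where "c \<ge> 1/2" "c \<le> 99/100" and c0: "crit 1 2 (1 - c\<^sup>2) = 0" by blast
  then have c: "c \<in> {0<..<1}" "crit 1 2 (1 - c\<^sup>2) = 0" by auto
  have lt: "e < c \<longleftrightarrow> crit 1 2 (1 - e\<^sup>2) > 0" and eq: "e = c \<longleftrightarrow> crit 1 2 (1 - e\<^sup>2) = 0" if "e \<in> {0<..<1}" for e
  proof -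
    have "e < c \<Longrightarrow> crit 1 2 (1 - e\<^sup>2) > 0" "c < e \<Longrightarrow> \<not> crit 1 2 (1 - e\<^sup>2) \<ge> 0" "e = c \<Longrightarrow> crit 1 2 (1 - e\<^sup>2) = 0"
      using mono[of e c] mono[of c e] c that by auto
    then show "e < c \<longleftrightarrow> crit 1 2 (1 - e\<^sup>2) > 0" "e = c \<longleftrightarrow> crit 1 2 (1 - e\<^sup>2) = 0" by linarith+
  qed
  have "e_crit rho0 grav = c"
    unfolding e_crit_def
  proof (rule the_equality)
    show "c \<in> {0<..<1} \<and> S2 rho0 grav c = 0" using s0 c by auto
    show "e = c" if "e \<in> {0<..<1} \<and> S2 rho0 grav e = 0" for e using that s0[of e] eq[of e] by blast
  qed
  then show "e_crit rho0 grav \<in> {0<..<1}"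
    and "\<And>e. e \<in> {0<..<1} \<Longrightarrow> e < e_crit rho0 grav \<longleftrightarrow> crit 1 2 (1 - e\<^sup>2) > 0"
    and "\<And>e. e \<in> {0<..<1} \<Longrightarrow> e = e_crit rho0 grav \<longleftrightarrow> crit 1 2 (1 - e\<^sup>2) = 0"
    using c(1) lt eq by simp_all
qed


section \<open>Matrix calculus on SL(3)\<close>

lemma mat3_eq_iff: "(A::mat3) = B \<longleftrightarrow> (\<forall>i j. A $ i $ j = B $ i $ j)"
  by (simp add: vec_eq_iff)

lemma matmul_nth: "((A::mat3) ** (B::mat3)) $ i $ j = A$i$1 * B$1$j + A$i$2 * B$2$j + A$i$3 * B$3$j"
  by (simp add: matrix_matrix_mult_def sum_3)

lemma transpose_nth: "transpose A $ i $ j = A $ j $ i" by (simp add: transpose_def)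

lemma mat1_nth: "(mat 1 :: mat3) $ i $ j = (if i = j then 1 else 0)" by (simp add: mat_def)

lemma inner_mat3: "(A::mat3) \<bullet> B = (\<Sum>i\<in>UNIV. \<Sum>j\<in>UNIV. A$i$j * B$i$j)"
  by (simp add: inner_vec_def)

lemma trace_transpose_mul: "trace (transpose A ** B) = (A::mat3) \<bullet> (B::mat3)"
  unfolding inner_mat3 trace_def matmul_nth transpose_nth
  by (simp add: sum_3)

lemma inner_mul_left: "((A::mat3) ** (B::mat3)) \<bullet> C = A \<bullet> (C ** transpose B)"
  unfolding inner_mat3 matmul_nth transpose_nth by (simp add: sum_3 algebra_simps)

lemma inner_mul_right: "((A::mat3) ** (B::mat3)) \<bullet> C = B \<bullet> (transpose A ** C)"
  unfolding inner_mat3 matmul_nth transpose_nth by (simp add: sum_3 algebra_simps)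

lemma inner_transpose: "transpose (A::mat3) \<bullet> transpose B = A \<bullet> B"
  unfolding inner_mat3 transpose_nth by (simp add: sum_3)

lemma bounded_bilinear_matmul: "bounded_bilinear ((**) :: mat3 \<Rightarrow> mat3 \<Rightarrow> mat3)"
  unfolding bilinear_conv_bounded_bilinear[symmetric] bilinear_def
  by (auto intro!: linearI simp: mat3_eq_iff matmul_nth algebra_simps)

lemmas matmul_vd = bounded_bilinear.has_vector_derivative[OF bounded_bilinear_matmul]

lemma bounded_linear_transpose3: "bounded_linear (transpose :: mat3 \<Rightarrow> mat3)"
  unfolding linear_conv_bounded_linear[symmetric]
  by (auto intro!: linearI simp: mat3_eq_iff transpose_nth)

lemmas transpose_vd = bounded_linear.has_vector_derivative[OF bounded_linear_transpose3]

lemma entry_vd: "(c has_vector_derivative (w::mat3)) F \<Longrightarrow> ((\<lambda>s. c s $ i $ j) has_vector_derivative w $ i $ j) F"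
  by (intro bounded_linear.has_vector_derivative[OF bounded_linear_vec_nth])

lemma inner_vd:
  assumes "(c has_vector_derivative (w::mat3)) (at t)" "(d has_vector_derivative v) (at t)"
  shows "((\<lambda>s. c s \<bullet> d s) has_real_derivative (c t \<bullet> v + w \<bullet> d t)) (at t)"
  using bounded_bilinear.has_vector_derivative[OF bounded_bilinear_inner assms]
  by (simp add: has_real_derivative_iff_has_vector_derivative)

text \<open>The cofactor matrix, which is the gradient of the determinant; its rows are cross products of the rows
of \<open>F\<close>.\<close>

definition cof :: "mat3 \<Rightarrow> mat3" where
  "cof F = vector [cross3 (F$2) (F$3), cross3 (F$3) (F$1), cross3 (F$1) (F$2)]"

lemma cof_nth:
  "cof F $ 1 $ 1 = F$2$2 * F$3$3 - F$2$3 * F$3$2" "cof F $ 1 $ 2 = F$2$3 * F$3$1 - F$2$1 * F$3$3"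
  "cof F $ 1 $ 3 = F$2$1 * F$3$2 - F$2$2 * F$3$1"
  "cof F $ 2 $ 1 = F$3$2 * F$1$3 - F$3$3 * F$1$2" "cof F $ 2 $ 2 = F$3$3 * F$1$1 - F$3$1 * F$1$3"
  "cof F $ 2 $ 3 = F$3$1 * F$1$2 - F$3$2 * F$1$1"
  "cof F $ 3 $ 1 = F$1$2 * F$2$3 - F$1$3 * F$2$2" "cof F $ 3 $ 2 = F$1$3 * F$2$1 - F$1$1 * F$2$3"
  "cof F $ 3 $ 3 = F$1$1 * F$2$2 - F$1$2 * F$2$1"
  unfolding cof_def by (simp_all add: cross3_def)

lemma cof_mul_transpose: "cof F ** transpose F = det F *\<^sub>R mat 1" "transpose F ** cof F = det F *\<^sub>R mat 1"
  by (simp_all add: mat3_eq_iff matmul_nth transpose_nth forall_3 cof_nth det_3 mat1_nth algebra_simps)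

lemma det_vd:
  assumes "(c has_vector_derivative w) (at t)"
  shows "((\<lambda>s. det (c s)) has_real_derivative cof (c t) \<bullet> w) (at t)"
proof -
  have d: "((\<lambda>s. c s $ i $ j) has_real_derivative w $ i $ j) (at t)" for i j
    using entry_vd[OF assms] by (simp add: has_real_derivative_iff_has_vector_derivative)
  show ?thesis unfolding det_3
    by (rule derivative_eq_intros d refl)+ (simp add: inner_mat3 sum_3 cof_nth algebra_simps)
qed

lemma det_scaleR3: "det (k *\<^sub>R (F::mat3)) = k^3 * det F"
  unfolding det_3 by (simp add: power3_eq_cube algebra_simps)

text \<open>A line through \<open>F\<close> whose direction is orthogonal to the gradient of the determinant is moved
into \<open>SL(3)\<close> by dividing by the cube root of the determinant; this factor has derivative zero at
\<open>F\<close>, so the velocity does not change.\<close>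

lemma tangent_space_SL3:
  assumes F: "F \<in> SL3"
  shows "tangent_space SL3 F = {A. cof F \<bullet> A = 0}"
proof (intro equalityI subsetI)
  fix A assume "A \<in> tangent_space SL3 F"
  then obtain c where c: "\<And>s. det (c s) = 1" "c 0 = F" "(c has_vector_derivative A) (at 0)"
    unfolding tangent_space_def curve_in_def SL3_def by auto
  from det_vd[OF c(3)] have "((\<lambda>s. 1) has_real_derivative cof F \<bullet> A) (at 0)" by (simp add: c)
  then have "cof F \<bullet> A = 0" using DERIV_unique DERIV_const by blast
  then show "A \<in> {A. cof F \<bullet> A = 0}" by simp
next
  fix A assume "A \<in> {A. cof F \<bullet> A = 0}"
  then have A: "cof F \<bullet> A = 0" by simp
  define g where "g s = det (F + s *\<^sub>R A)" for s
  \<comment> \<open>the curve has to stay in \<open>SL(3)\<close> for all parameters, so it is constant where the determinant is not positive\<close>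
  define c where "c s = (if g s > 0 then inverse (root 3 (g s)) *\<^sub>R (F + s *\<^sub>R A) else F)" for s
  have F1: "det F = 1" using F by (simp add: SL3_def)
  have line: "((\<lambda>s. F + s *\<^sub>R A) has_vector_derivative A) (at 0)"
    by (auto intro!: derivative_eq_intros)
  have g0: "g 0 = 1" by (simp add: g_def F1)
  have gd: "(g has_real_derivative 0) (at 0)"
    using det_vd[OF line] unfolding g_def[abs_def] by (simp add: A)
  have "((\<lambda>s. inverse (root 3 (g s))) has_real_derivative - (0 * inverse ((root 3 (g 0))\<^sup>2))) (at 0)"
  proof -
    have "(root 3 has_real_derivative inverse (real 3 * root 3 (g 0) ^ (3 - Suc 0))) (at (g 0))"
      by (rule DERIV_real_root) (simp_all add: g0)
    from DERIV_chain2[OF this gd] have "((\<lambda>s. root 3 (g s)) has_real_derivative 0) (at 0)" by simp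
    from DERIV_inverse_fun[OF this] show ?thesis by (simp add: g0)
  qed
  then have hd: "((\<lambda>s. inverse (root 3 (g s))) has_real_derivative 0) (at 0)" by simp
  have "((\<lambda>s. inverse (root 3 (g s)) *\<^sub>R (F + s *\<^sub>R A)) has_vector_derivative A) (at 0)"
    using has_vector_derivative_scaleR[OF hd line] by (simp add: g0)
  moreover have "\<forall>\<^sub>F s in nhds 0. g s > 0"
  proof -
    have "isCont g 0" using gd DERIV_isCont by blast
    then have "(g \<longlongrightarrow> g 0) (nhds 0)" by (simp add: isCont_def tendsto_at_iff_tendsto_nhds)
    then show ?thesis using order_tendstoD(1)[of g "g 0" "nhds 0" 0] g0 by simp
  qed
  then have "\<forall>\<^sub>F s in nhds 0. inverse (root 3 (g s)) *\<^sub>R (F + s *\<^sub>R A) = c s"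
    by eventually_elim (simp add: c_def)
  ultimately have "(c has_vector_derivative A) (at 0)"
    using has_vector_derivative_cong_ev[of UNIV "\<lambda>s. inverse (root 3 (g s)) *\<^sub>R (F + s *\<^sub>R A)" c 0 A]
    by (simp add: c_def g0 eventually_mono)
  moreover have "det (c s) = 1" for s
    unfolding c_def g_def by (auto simp: det_scaleR3 F1 power_inverse)
  moreover have "c 0 = F" by (simp add: c_def g0)
  ultimately show "A \<in> tangent_space SL3 F"
    unfolding tangent_space_def curve_in_def SL3_def by auto
qed

lemma I1_inner: "I1 F = F \<bullet> F"
  unfolding I1_def inner_mat3 trace_def matmul_nth transpose_nth by (simp add: sum_3)

lemma I2_inner: "I2 F = ((F \<bullet> F)\<^sup>2 - (F ** transpose F) \<bullet> (F ** transpose F)) / 2"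
proof -
  have "trace (F ** transpose F ** F ** transpose F) = trace (transpose (F ** transpose F) ** (F ** transpose F))"
    by (simp add: matrix_transpose_mul matrix_mul_assoc)
  then show ?thesis unfolding I2_def trace_transpose_mul using I1_inner[of F] unfolding I1_def by simp
qed

text \<open>This form shows that the second invariant is nonnegative.\<close>

lemma I2_cof: "I2 F = cof F \<bullet> cof F"
proof -
  have "(F \<bullet> F)\<^sup>2 - (F ** transpose F) \<bullet> (F ** transpose F) = 2 * (cof F \<bullet> cof F)"
    unfolding inner_mat3 matmul_nth transpose_nth
    by (simp add: sum_3 cof_nth power2_eq_square algebra_simps)
  then show ?thesis unfolding I2_inner by simp
qed

lemma I1_vd:
  assumes "(c has_vector_derivative w) (at t)"
  shows "((\<lambda>s. I1 (c s)) has_real_derivative 2 * (c t \<bullet> w)) (at t)"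
  using inner_vd[OF assms assms] unfolding I1_inner by (simp add: inner_commute)

lemma I2_vd:
  assumes "(c has_vector_derivative w) (at t)"
  shows "((\<lambda>s. I2 (c s)) has_real_derivative
     2 * ((I1 (c t) *\<^sub>R c t - c t ** transpose (c t) ** c t) \<bullet> w)) (at t)"
proof -
  let ?F = "c t" let ?M = "?F ** transpose ?F"
  have M: "((\<lambda>s. c s ** transpose (c s)) has_vector_derivative (?F ** transpose w + w ** transpose ?F)) (at t)"
    by (rule matmul_vd[OF assms transpose_vd[OF assms]])
  have e: "?M \<bullet> (?F ** transpose w) = (?M ** ?F) \<bullet> w" "?M \<bullet> (w ** transpose ?F) = (?M ** ?F) \<bullet> w"
  proof -
    show e2: "?M \<bullet> (w ** transpose ?F) = (?M ** ?F) \<bullet> w" 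
      using inner_mul_left[of w "transpose ?F" ?M] by (simp only: inner_commute[of ?M] inner_commute[of w] transpose_transpose)
    have "transpose ?M = ?M" by (simp add: matrix_transpose_mul)
    then show "?M \<bullet> (?F ** transpose w) = (?M ** ?F) \<bullet> w"
      using inner_transpose[of ?M "w ** transpose ?F"] e2 by (simp add: matrix_transpose_mul)
  qed
  have "((\<lambda>s. ((c s \<bullet> c s)\<^sup>2 - (c s ** transpose (c s)) \<bullet> (c s ** transpose (c s))) / 2) has_real_derivative
     (2 * (?F \<bullet> ?F) * (?F \<bullet> w + w \<bullet> ?F) - (?M \<bullet> (?F ** transpose w + w ** transpose ?F) + (?F ** transpose w + w ** transpose ?F) \<bullet> ?M)) / 2) (at t)"
    by (rule derivative_eq_intros inner_vd[OF assms assms] inner_vd[OF M M] refl)+ simp_all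
  then show ?thesis
    unfolding I2_inner I1_inner
  proof (rule DERIV_cong)
    have "(?F ** transpose w + w ** transpose ?F) \<bullet> ?M = 2 * ((?M ** ?F) \<bullet> w)"
      "?M \<bullet> (?F ** transpose w + w ** transpose ?F) = 2 * ((?M ** ?F) \<bullet> w)" "w \<bullet> ?F = ?F \<bullet> w"
      unfolding inner_commute[of _ ?M] inner_add_right e by (simp_all add: inner_commute)
    then show "(2 * (?F \<bullet> ?F) * (?F \<bullet> w + w \<bullet> ?F) - (?M \<bullet> (?F ** transpose w + w ** transpose ?F) + (?F ** transpose w + w ** transpose ?F) \<bullet> ?M)) / 2
      = 2 * (((?F \<bullet> ?F) *\<^sub>R ?F - ?M ** ?F) \<bullet> w)"
      by (simp add: inner_diff_left)
  qed
qed

text \<open>The negative gradient of \<open>pot_int (I1 F) (I2 F)\<close> with respect to the trace inner product: the factors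
2 from the derivatives of \<open>I1\<close> and \<open>I2\<close> cancel the factor 1/2 in the derivative of \<open>pot_int\<close>.\<close>

definition grad_pot :: "mat3 \<Rightarrow> mat3" where
  "grad_pot F = mom 2 (I1 F) (I2 F) 1 *\<^sub>R F + mom 1 (I1 F) (I2 F) 1 *\<^sub>R (I1 F *\<^sub>R F - F ** transpose F ** F)"

lemma potential_pot_int: "potential rho0 grav F = - R_const rho0 grav * pot_int (I1 F) (I2 F)"
  unfolding potential_def pot_int_def cub_def by simp

lemma potential_vd:
  assumes "(c has_vector_derivative w) (at t)"
  shows "((\<lambda>s. potential rho0 grav (c s)) has_real_derivative R_const rho0 grav * (grad_pot (c t) \<bullet> w)) (at t)"
proof -
  let ?x = "I1 (c t)" and ?y = "I2 (c t)"
  have nn: "?x \<ge> 0" "?y \<ge> 0" by (simp_all only: I1_inner I2_cof inner_ge_zero)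
  have d: "((\<lambda>s. (I1 (c s), I2 (c s))) has_derivative (\<lambda>h. (h * (2 * (c t \<bullet> w)), h * (2 * ((?x *\<^sub>R c t - c t ** transpose (c t) ** c t) \<bullet> w))))) (at t)"
  proof -
    have "(f has_derivative (\<lambda>h. h * k)) (at t)" if "(f has_real_derivative k) (at t)" for f k
      using that unfolding has_field_derivative_def by (rule has_derivative_eq_rhs) (simp add: fun_eq_iff)
    then show ?thesis
      using I1_vd[OF assms] I2_vd[OF assms] by (intro has_derivative_Pair) blast+
  qed
  have "((\<lambda>s. pot_int (I1 (c s)) (I2 (c s))) has_derivative
     (\<lambda>h. - (mom 2 ?x ?y 1 * (h * (2 * (c t \<bullet> w))) + mom 1 ?x ?y 1 * (h * (2 * ((?x *\<^sub>R c t - c t ** transpose (c t) ** c t) \<bullet> w)))) / 2)) (at t)"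
    using has_derivative_compose[OF d pot_int_has_derivative[OF nn]] unfolding fst_conv snd_conv .
  also have "(\<lambda>h. - (mom 2 ?x ?y 1 * (h * (2 * (c t \<bullet> w))) + mom 1 ?x ?y 1 * (h * (2 * ((?x *\<^sub>R c t - c t ** transpose (c t) ** c t) \<bullet> w)))) / 2)
     = (\<lambda>h. - (grad_pot (c t) \<bullet> w) * h)"
  proof (rule ext)
    fix h
    let ?G = "?x *\<^sub>R c t - c t ** transpose (c t) ** c t"
    have "grad_pot (c t) \<bullet> w = mom 2 ?x ?y 1 * (c t \<bullet> w) + mom 1 ?x ?y 1 * (?G \<bullet> w)"
      unfolding grad_pot_def by (simp only: inner_add_left inner_scaleR_left)
    moreover have "- (m * (h * (2 * a)) + n * (h * (2 * b))) / 2 = - (m * a + n * b) * h" for m n a b :: real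
      by (simp add: field_simps)
    ultimately show "- (mom 2 ?x ?y 1 * (h * (2 * (c t \<bullet> w))) + mom 1 ?x ?y 1 * (h * (2 * (?G \<bullet> w)))) / 2 = - (grad_pot (c t) \<bullet> w) * h"
      by (simp only:)
  qed
  finally have "((\<lambda>s. pot_int (I1 (c s)) (I2 (c s))) has_real_derivative - (grad_pot (c t) \<bullet> w)) (at t)"
    unfolding has_field_derivative_def .
  from DERIV_cmult[OF this, of "- R_const rho0 grav"] show ?thesis unfolding potential_pot_int by simp
qed


section \<open>Rotations and the matrix exponential\<close>

lemma hat_nth:
  "hat u $ 1 $ 1 = 0" "hat u $ 1 $ 2 = - u$3" "hat u $ 1 $ 3 = u$2"
  "hat u $ 2 $ 1 = u$3" "hat u $ 2 $ 2 = 0" "hat u $ 2 $ 3 = - u$1"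
  "hat u $ 3 $ 1 = - u$2" "hat u $ 3 $ 2 = u$1" "hat u $ 3 $ 3 = 0"
  unfolding hat_def matrix_def by (simp_all add: cross3_def axis_def)

lemma hat_scaleR: "hat (t *\<^sub>R u) = t *\<^sub>R hat u"
  by (simp add: mat3_eq_iff forall_3 hat_nth)

lemma transpose_hat: "transpose (hat u) = - hat u"
  by (simp add: mat3_eq_iff forall_3 hat_nth transpose_nth)

lemma hat_inj: "hat u = hat v \<Longrightarrow> u = v"
  by (simp add: mat3_eq_iff forall_3 hat_nth vec_eq_iff)

lemma hat_mul_vec: "hat u *v x = cross3 u x"
  by (simp add: vec_eq_iff forall_3 matrix_vector_mult_def sum_3 hat_nth cross3_def)

lemma rotationD:
  assumes "rotation_matrix (g :: mat3)"
  shows "transpose g ** g = mat 1" "g ** transpose g = mat 1" "det g = 1"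
  using assms by (auto simp: rotation_matrix_def orthogonal_matrix_def)

lemma rotationI:
  assumes "g ** transpose g = mat 1" "det g = 1"
  shows "rotation_matrix (g :: mat3)"
  using assms matrix_left_right_inverse[of g "transpose g"] by (auto simp: rotation_matrix_def orthogonal_matrix_def)

lemma hat_rotate:
  assumes g: "rotation_matrix g"
  shows "hat (g *v u) = g ** hat u ** transpose g"
proof -
  have "hat (g *v u) *v x = (g ** hat u ** transpose g) *v x" for x
  proof -
    have "(g ** hat u ** transpose g) *v x = g *v cross3 u (transpose g *v x)"
      by (simp add: matrix_vector_mul_assoc[symmetric] hat_mul_vec)
    also have "\<dots> = cross3 (g *v u) (g *v (transpose g *v x))"
      by (rule cross_rotation_matrix[OF g, symmetric])
    also have "g *v (transpose g *v x) = x"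
      by (simp only: matrix_vector_mul_assoc rotationD[OF g] matrix_vector_mul_lid)
    finally show ?thesis by (simp add: hat_mul_vec)
  qed
  then show ?thesis by (simp add: matrix_eq)
qed

lemma matmul_scaleR: "(r *\<^sub>R A) ** (B::mat3) = r *\<^sub>R (A ** B)" "(A::mat3) ** (r *\<^sub>R B) = r *\<^sub>R (A ** B)"
  by (simp_all add: mat3_eq_iff matmul_nth algebra_simps)

lemma matmul_uminus: "(- A) ** (B::mat3) = - (A ** B)" "(A::mat3) ** (- B) = - (A ** B)"
  by (simp_all add: mat3_eq_iff matmul_nth algebra_simps)

lemma matmul_diff: "(A - A') ** (B::mat3) = A ** B - A' ** B" "(A::mat3) ** (B - B') = A ** B - A ** B'"
  by (simp_all add: mat3_eq_iff matmul_nth algebra_simps)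

lemma matmul_add: "(A + A') ** (B::mat3) = A ** B + A' ** B" "(A::mat3) ** (B + B') = A ** B + A ** B'"
  by (simp_all add: mat3_eq_iff matmul_nth algebra_simps)

definition mpow :: "mat3 \<Rightarrow> nat \<Rightarrow> mat3" where
  "mpow A n = (((**) A) ^^ n) (mat 1)"

lemma mpow_simps: "mpow A 0 = mat 1" "mpow A (Suc n) = A ** mpow A n"
  by (simp_all add: mpow_def)

lemma mpow_scaleR: "mpow (t *\<^sub>R A) n = t ^ n *\<^sub>R mpow A n"
  by (induction n) (simp_all add: mpow_simps matmul_scaleR)

lemma mpow_commute: "A ** mpow A n = mpow A n ** A"
proof (induction n)
  case (Suc n)
  have "A ** mpow A (Suc n) = A ** (mpow A n ** A)" using Suc by (simp add: mpow_simps)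
  then show ?case by (simp add: mpow_simps matrix_mul_assoc)
qed (simp add: mpow_simps)

lemma summable_mexp: "summable (\<lambda>n. (1 / fact n) *\<^sub>R mpow A n)"
proof -
  from bounded_bilinear.pos_bounded[OF bounded_bilinear_matmul]
  obtain K where K: "K > 0" "\<forall>(A::mat3) (B::mat3). norm (A ** B) \<le> norm A * norm B * K"
    by blast
  have n: "norm (mpow A n) \<le> norm (mat 1 :: mat3) * (norm A * K) ^ n" for n
  proof (induction n)
    case (Suc n)
    have "norm (mpow A (Suc n)) \<le> norm A * norm (mpow A n) * K" unfolding mpow_simps by (rule K(2)[rule_format])
    also have "\<dots> \<le> norm A * (norm (mat 1 :: mat3) * (norm A * K) ^ n) * K"
      by (rule mult_right_mono[OF mult_left_mono[OF Suc]]) (use K(1) in simp_all)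
    also have "\<dots> = norm (mat 1 :: mat3) * (norm A * K) ^ Suc n" unfolding power_Suc by (simp only: mult_ac)
    finally show ?case .
  qed (simp add: mpow_simps)
  have "summable (\<lambda>n. norm (mat 1 :: mat3) * (inverse (fact n) * (norm A * K) ^ n))"
    by (intro summable_mult summable_exp)
  then show ?thesis
  proof (rule summable_comparison_test'[where N=0])
    fix k :: nat
    show "norm ((1 / fact k) *\<^sub>R mpow A k) \<le> norm (mat 1 :: mat3) * (inverse (fact k) * (norm A * K) ^ k)"
    proof -
      have "norm ((1 / fact k) *\<^sub>R mpow A k) = inverse (fact k) * norm (mpow A k)" by (simp add: divide_inverse)
      also have "\<dots> \<le> inverse (fact k) * (norm (mat 1 :: mat3) * (norm A * K) ^ k)"
        by (rule mult_left_mono[OF n]) simp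
      finally show ?thesis by (simp only: mult.left_commute)
    qed
  qed
qed

lemma mexp_alt: "mexp A = (\<Sum>n. (1 / fact n) *\<^sub>R mpow A n)"
  unfolding mexp_def mpow_def ..

text \<open>As a function of \<open>t\<close> every entry is a real power series, so the theory of termwise differentiation
in one variable applies.\<close>

lemma mexp_entry: "mexp (t *\<^sub>R A) $ i $ j = (\<Sum>n. (mpow A n $ i $ j / fact n) * t ^ n)"
  and summable_mexp_entry: "summable (\<lambda>n. (mpow A n $ i $ j / fact n) * t ^ n)"
proof -
  have bl: "bounded_linear (\<lambda>M::mat3. M $ i $ j)"
    using bounded_linear_compose[OF bounded_linear_vec_nth bounded_linear_vec_nth] .
  have "(\<lambda>n. ((1 / fact n) *\<^sub>R mpow (t *\<^sub>R A) n) $ i $ j) sums (mexp (t *\<^sub>R A) $ i $ j)"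
    unfolding mexp_alt by (intro bounded_linear.sums[OF bl] summable_sums summable_mexp)
  then have "(\<lambda>n. (mpow A n $ i $ j / fact n) * t ^ n) sums (mexp (t *\<^sub>R A) $ i $ j)"
    by (simp add: mpow_scaleR mult.commute)
  then show "mexp (t *\<^sub>R A) $ i $ j = (\<Sum>n. (mpow A n $ i $ j / fact n) * t ^ n)"
    and "summable (\<lambda>n. (mpow A n $ i $ j / fact n) * t ^ n)"
    by (simp_all add: sums_iff)
qed

lemma mexp_commute: "A ** mexp (t *\<^sub>R A) = mexp (t *\<^sub>R A) ** A"
proof -
  have s: "(\<lambda>n. (1 / fact n) *\<^sub>R mpow (t *\<^sub>R A) n) sums mexp (t *\<^sub>R A)"
    unfolding mexp_alt by (intro summable_sums summable_mexp)
  have "(\<lambda>n. A ** ((1 / fact n) *\<^sub>R mpow (t *\<^sub>R A) n)) sums (A ** mexp (t *\<^sub>R A))"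
    by (rule bounded_linear.sums[OF bounded_bilinear.bounded_linear_right[OF bounded_bilinear_matmul] s])
  moreover have "(\<lambda>n. ((1 / fact n) *\<^sub>R mpow (t *\<^sub>R A) n) ** A) sums (mexp (t *\<^sub>R A) ** A)"
    by (rule bounded_linear.sums[OF bounded_bilinear.bounded_linear_left[OF bounded_bilinear_matmul] s])
  ultimately show ?thesis
    by (intro sums_unique2) (simp_all add: mpow_scaleR matmul_scaleR mpow_commute)
qed

lemma mat3_vdI:
  assumes "\<And>i j. ((\<lambda>s. c s $ i $ j) has_real_derivative (w::mat3) $ i $ j) (at t)"
  shows "(c has_vector_derivative w) (at t)"
  unfolding has_vector_derivative_def
proof (subst has_derivative_componentwise_within, rule ballI)
  fix b :: mat3 assume "b \<in> Basis"
  then obtain i j where b: "b = axis i (axis j 1)" by (auto simp: Basis_vec_def)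
  have e: "x \<bullet> b = x $ i $ j" for x by (simp add: b inner_axis)
  have "((\<lambda>x. c x $ i $ j) has_derivative (*) (w $ i $ j)) (at t)"
    using assms[of i j] unfolding has_field_derivative_def .
  then show "((\<lambda>x. c x \<bullet> b) has_derivative (\<lambda>h. (h *\<^sub>R w) \<bullet> b)) (at t)"
    unfolding e by (rule has_derivative_eq_rhs) (simp add: fun_eq_iff mult.commute)
qed

lemma mexp_vd: "((\<lambda>t. mexp (t *\<^sub>R A)) has_vector_derivative A ** mexp (t *\<^sub>R A)) (at t)"
proof (rule mat3_vdI)
  fix i j :: 3
  have "((\<lambda>t. \<Sum>n. (mpow A n $ i $ j / fact n) * t ^ n) has_real_derivative
     (\<Sum>n. diffs (\<lambda>n. mpow A n $ i $ j / fact n) n * t ^ n)) (at t)"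
    by (rule termdiffs_strong_converges_everywhere) (rule summable_mexp_entry)
  moreover have "(\<Sum>n. diffs (\<lambda>n. mpow A n $ i $ j / fact n) n * t ^ n) = (A ** mexp (t *\<^sub>R A)) $ i $ j"
  proof -
    have "diffs (\<lambda>n. mpow A n $ i $ j / fact n) n * t ^ n =
      A$i$1 * ((mpow A n $ 1 $ j / fact n) * t ^ n) + A$i$2 * ((mpow A n $ 2 $ j / fact n) * t ^ n) + A$i$3 * ((mpow A n $ 3 $ j / fact n) * t ^ n)" for n
    proof -
      have "diffs (\<lambda>n. mpow A n $ i $ j / fact n) n = mpow A (Suc n) $ i $ j / fact n"
        unfolding diffs_def by (simp add: field_simps del: of_nat_Suc)
      then show ?thesis unfolding mpow_simps matmul_nth by (simp add: algebra_simps add_divide_distrib)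
    qed
    moreover have "(\<lambda>n. A$i$1 * ((mpow A n $ 1 $ j / fact n) * t ^ n) + A$i$2 * ((mpow A n $ 2 $ j / fact n) * t ^ n) + A$i$3 * ((mpow A n $ 3 $ j / fact n) * t ^ n))
       sums (A ** mexp (t *\<^sub>R A)) $ i $ j"
      unfolding matmul_nth mexp_entry by (intro sums_add sums_mult summable_sums summable_mexp_entry)
    ultimately show ?thesis by (simp add: sums_iff)
  qed
  ultimately show "((\<lambda>t. mexp (t *\<^sub>R A) $ i $ j) has_real_derivative (A ** mexp (t *\<^sub>R A)) $ i $ j) (at t)"
    by (simp add: mexp_entry)
qed

lemma mexp_0: "mexp 0 = mat 1"
proof -
  have "mexp (0 *\<^sub>R 0) $ i $ j = (mat 1 :: mat3) $ i $ j" for i j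
    unfolding mexp_entry powser_zero by (simp add: mpow_simps)
  then show ?thesis by (simp add: mat3_eq_iff)
qed

lemma const_of_vd_zero:
  fixes f :: "real \<Rightarrow> 'a::real_normed_vector"
  assumes "\<And>t. (f has_vector_derivative 0) (at t)"
  shows "f t = f 0"
proof -
  obtain c where "\<And>x. x \<in> UNIV \<Longrightarrow> f x = c"
    using has_vector_derivative_zero_constant[of UNIV f] assms by (auto simp: has_vector_derivative_at_within)
  then show ?thesis by simp
qed

text \<open>For \<open>E t = mexp (t *\<^sub>R hat u)\<close> the product \<open>E E\<^sup>T\<close> and the determinant are constant: their derivatives
vanish because \<open>hat u\<close> is skew.\<close>

lemma rotation_mexp: "rotation_matrix (mexp (t *\<^sub>R hat u))"
proof -
  let ?E = "\<lambda>t. mexp (t *\<^sub>R hat u)"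
  have "((\<lambda>t. ?E t ** transpose (?E t)) has_vector_derivative 0) (at t)" for t
  proof -
    have "((\<lambda>t. ?E t ** transpose (?E t)) has_vector_derivative
        (?E t ** transpose (hat u ** ?E t) + (hat u ** ?E t) ** transpose (?E t))) (at t)"
      by (rule matmul_vd[OF mexp_vd transpose_vd[OF mexp_vd]])
    moreover have "?E t ** transpose (hat u ** ?E t) + (hat u ** ?E t) ** transpose (?E t) = 0"
      unfolding mexp_commute by (simp add: matrix_transpose_mul transpose_hat matmul_uminus matrix_mul_assoc)
    ultimately show ?thesis by simp
  qed
  from const_of_vd_zero[of "\<lambda>t. ?E t ** transpose (?E t)", OF this, of t]
  have 1: "?E t ** transpose (?E t) = mat 1" by (simp add: mexp_0)
  have "((\<lambda>t. det (?E t)) has_vector_derivative 0) (at t)" for t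
  proof -
    have "((\<lambda>t. det (?E t)) has_real_derivative cof (?E t) \<bullet> (hat u ** ?E t)) (at t)"
      by (rule det_vd[OF mexp_vd])
    moreover have "cof (?E t) \<bullet> (hat u ** ?E t) = hat u \<bullet> (cof (?E t) ** transpose (?E t))"
      using inner_mul_left[of "hat u" "?E t" "cof (?E t)"] by (simp add: inner_commute)
    moreover have "\<dots> = 0"
      unfolding cof_mul_transpose by (simp add: inner_mat3 sum_3 hat_nth mat1_nth)
    ultimately show ?thesis by (simp add: has_real_derivative_iff_has_vector_derivative)
  qed
  from const_of_vd_zero[of "\<lambda>t. det (?E t)", OF this, of t]
  have "det (?E t) = 1" by (simp add: mexp_0)
  with 1 show ?thesis by (rule rotationI)
qed

lemma mexp_hat_fix: "mexp (t *\<^sub>R hat u) *v u = u"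
proof (rule hat_inj)
  let ?g = "mexp (t *\<^sub>R hat u)"
  have "hat (?g *v u) = ?g ** hat u ** transpose ?g" by (rule hat_rotate[OF rotation_mexp])
  also have "\<dots> = hat u ** (?g ** transpose ?g)" by (simp add: mexp_commute[symmetric] matrix_mul_assoc)
  finally show "hat (?g *v u) = hat u" by (simp add: rotationD[OF rotation_mexp])
qed


section \<open>Relative equilibria as balanced configurations\<close>

text \<open>The second derivative of the motion \<open>e\<^sup>t\<^sup>\<xi> \<cdot> F\<close>, weighted with the metric constant, plus
the gradient of the potential.\<close>

definition force :: "real \<Rightarrow> real \<Rightarrow> mat3 \<Rightarrow> velocity \<Rightarrow> mat3" where
  "force rho0 grav F xi = metric_const rho0 *\<^sub>R fund xi (fund xi F) + R_const rho0 grav *\<^sub>R grad_pot F"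

text \<open>Newton's equation with a Lagrange multiplier for the constraint \<open>det F = 1\<close>. It is multiplied by
\<open>F\<^sup>T\<close> because a scalar matrix on the right-hand side is invariant under conjugation by rotations.\<close>

definition balanced :: "real \<Rightarrow> real \<Rightarrow> mat3 \<Rightarrow> velocity \<Rightarrow> bool" where
  "balanced rho0 grav F xi \<longleftrightarrow> (\<exists>l. force rho0 grav F xi ** transpose F = l *\<^sub>R mat 1)"

lemma balanced_iff_cof:
  assumes "det F = 1"
  shows "balanced rho0 grav F xi \<longleftrightarrow> (\<exists>l. force rho0 grav F xi = l *\<^sub>R cof F)"
proof -
  have "X ** transpose F = l *\<^sub>R mat 1 \<longleftrightarrow> X = l *\<^sub>R cof F" for X l
  proof
    assume "X ** transpose F = l *\<^sub>R mat 1"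
    then have "X ** (transpose F ** cof F) = l *\<^sub>R mat 1 ** cof F" by (simp add: matrix_mul_assoc)
    then show "X = l *\<^sub>R cof F" by (simp add: cof_mul_transpose assms matmul_scaleR)
  next
    assume "X = l *\<^sub>R cof F"
    then show "X ** transpose F = l *\<^sub>R mat 1" by (simp add: matmul_scaleR cof_mul_transpose assms)
  qed
  then show ?thesis unfolding balanced_def by simp
qed

definition transform :: "mat3 \<Rightarrow> mat3 \<Rightarrow> mat3 \<Rightarrow> mat3" where
  "transform g k F = g ** F ** transpose k"

lemma transform_mul:
  assumes "rotation_matrix k"
  shows "transform g k A ** transform k m B = transform g m (A ** B)"
  using rotationD(1)[OF assms] unfolding transform_def
  by (metis matrix_mul_assoc matrix_mul_lid)

lemma transpose_transform: "transpose (transform g k F) = transform k g (transpose F)"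
  unfolding transform_def by (simp add: matrix_transpose_mul matrix_mul_assoc)

lemma transform_add: "transform g k (A + B) = transform g k A + transform g k B"
  and transform_diff: "transform g k (A - B) = transform g k A - transform g k B"
  and transform_scaleR: "transform g k (r *\<^sub>R A) = r *\<^sub>R transform g k A"
  unfolding transform_def by (simp_all add: matmul_add matmul_diff matmul_scaleR)

lemma hat_rotate_transform: "rotation_matrix g \<Longrightarrow> hat (g *v u) = transform g g (hat u)"
  by (simp add: hat_rotate transform_def)

lemma transform_one: "rotation_matrix g \<Longrightarrow> transform g g (mat 1) = mat 1"
  by (simp add: transform_def rotationD)

lemma fund_transform:
  assumes "rotation_matrix g" "rotation_matrix k"
  shows "fund (g *v fst xi, k *v snd xi) (transform g k F) = transform g k (fund xi F)"
  using assms by (simp add: fund_def hat_rotate_transform transform_mul transform_diff)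

lemma inner_transform:
  assumes "rotation_matrix g" "rotation_matrix k"
  shows "transform g k A \<bullet> transform g k B = A \<bullet> B"
proof -
  have "transform g k A \<bullet> transform g k B = (g ** (A ** transpose k)) \<bullet> (g ** (B ** transpose k))"
    by (simp add: transform_def matrix_mul_assoc)
  also have "\<dots> = (A ** transpose k) \<bullet> (transpose g ** g ** (B ** transpose k))"
    using inner_mul_right[of g "A ** transpose k" "g ** (B ** transpose k)"] by (simp add: matrix_mul_assoc)
  also have "\<dots> = A \<bullet> (B ** (transpose k ** k))"
    using inner_mul_left[of A "transpose k" "B ** transpose k"] by (simp add: rotationD[OF assms(1)] matrix_mul_assoc)
  finally show ?thesis by (simp add: rotationD[OF assms(2)])
qed

lemma I1_transform: "rotation_matrix g \<Longrightarrow> rotation_matrix k \<Longrightarrow> I1 (transform g k F) = I1 F"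
  by (simp add: I1_inner inner_transform)

lemma I2_transform: "rotation_matrix g \<Longrightarrow> rotation_matrix k \<Longrightarrow> I2 (transform g k F) = I2 F"
  by (simp add: I2_inner inner_transform transpose_transform transform_mul)

lemma det_transform: "rotation_matrix g \<Longrightarrow> rotation_matrix k \<Longrightarrow> det (transform g k F) = det F"
  by (simp add: transform_def det_mul rotationD)

lemma grad_pot_transform:
  "rotation_matrix g \<Longrightarrow> rotation_matrix k \<Longrightarrow> grad_pot (transform g k F) = transform g k (grad_pot F)"
  by (simp add: grad_pot_def I1_transform I2_transform transpose_transform transform_mul transform_add transform_diff transform_scaleR)

lemma balanced_transform:
  assumes "rotation_matrix g" "rotation_matrix k" "balanced rho0 grav F xi"
  shows "balanced rho0 grav (transform g k F) (g *v fst xi, k *v snd xi)"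
proof -
  obtain l where l: "force rho0 grav F xi ** transpose F = l *\<^sub>R mat 1"
    using assms(3) by (auto simp: balanced_def)
  have "force rho0 grav (transform g k F) (g *v fst xi, k *v snd xi) = transform g k (force rho0 grav F xi)"
    unfolding force_def fund_transform[OF assms(1,2)] grad_pot_transform[OF assms(1,2)]
    by (simp add: transform_add transform_scaleR)
  then have "force rho0 grav (transform g k F) (g *v fst xi, k *v snd xi) ** transpose (transform g k F) = l *\<^sub>R mat 1"
    by (simp add: transpose_transform transform_mul[OF assms(2)] l transform_scaleR transform_one[OF assms(1)])
  then show ?thesis unfolding balanced_def by blast
qed

text \<open>The infinitesimal symmetries are tangent to \<open>SL(3)\<close>.\<close>

lemma cof_fund: "cof F \<bullet> fund xi F = 0"
proof -
  have h: "hat u \<bullet> (r *\<^sub>R mat 1) = 0" for u r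
    by (simp add: inner_mat3 sum_3 hat_nth mat1_nth)
  have "cof F \<bullet> (hat (fst xi) ** F) = hat (fst xi) \<bullet> (cof F ** transpose F)"
    using inner_mul_left[of "hat (fst xi)" F "cof F"] by (simp add: inner_commute)
  moreover have "cof F \<bullet> (F ** hat (snd xi)) = hat (snd xi) \<bullet> (transpose F ** cof F)"
    using inner_mul_right[of F "hat (snd xi)" "cof F"] by (simp add: inner_commute)
  ultimately show ?thesis
    unfolding fund_def by (simp add: inner_diff_right cof_mul_transpose h[of _ 1, simplified])
qed

lemma matmul_zero: "0 ** (A::mat3) = 0" "(A::mat3) ** 0 = 0"
  by (simp_all add: mat3_eq_iff matmul_nth)

definition traj :: "velocity \<Rightarrow> mat3 \<Rightarrow> real \<Rightarrow> mat3" where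
  "traj xi F t = transform (mexp (t *\<^sub>R hat (fst xi))) (mexp (t *\<^sub>R hat (snd xi))) F"

lemma act_exp_sym: "act (exp_sym (t *\<^sub>R xi)) (F, P) = (traj xi F t, traj xi P t)"
  by (simp add: exp_sym_def traj_def transform_def hat_scaleR)

lemma traj_0: "traj xi F 0 = F" by (simp add: traj_def transform_def mexp_0)

lemma traj_vd: "(traj xi F has_vector_derivative fund xi (traj xi F t)) (at t)"
proof -
  let ?g = "\<lambda>t. mexp (t *\<^sub>R hat (fst xi))" and ?k = "\<lambda>t. mexp (t *\<^sub>R hat (snd xi))"
  have "((\<lambda>t. ?g t ** F ** transpose (?k t)) has_vector_derivative
      (?g t ** F) ** transpose (hat (snd xi) ** ?k t) + (?g t ** 0 + (hat (fst xi) ** ?g t) ** F) ** transpose (?k t)) (at t)"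
    by (intro matmul_vd transpose_vd mexp_vd has_vector_derivative_const)
  moreover have "(?g t ** F) ** transpose (hat (snd xi) ** ?k t) + (?g t ** 0 + (hat (fst xi) ** ?g t) ** F) ** transpose (?k t)
      = fund xi (traj xi F t)"
  proof -
    have "?g t ** 0 = (0 :: mat3)" by (simp add: mat3_eq_iff matmul_nth)
    then show ?thesis unfolding traj_def transform_def fund_def
      by (simp add: matrix_transpose_mul transpose_hat matmul_uminus matrix_mul_assoc)
  qed
  ultimately show ?thesis unfolding traj_def[abs_def] transform_def by simp
qed

lemma fund_traj: "fund xi (traj xi F t) = traj xi (fund xi F) t"
  using fund_transform[OF rotation_mexp[of t "fst xi"] rotation_mexp[of t "snd xi"], of xi F]
  unfolding traj_def mexp_hat_fix by simp

lemma det_traj: "det (traj xi F t) = det F"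
  unfolding traj_def by (rule det_transform[OF rotation_mexp rotation_mexp])

lemma balanced_traj: "balanced rho0 grav F xi \<Longrightarrow> balanced rho0 grav (traj xi F t) xi"
  using balanced_transform[OF rotation_mexp[of t "fst xi"] rotation_mexp[of t "snd xi"], of rho0 grav F xi]
  unfolding traj_def mexp_hat_fix by simp

lemma fund_scaleR: "fund xi (r *\<^sub>R F) = r *\<^sub>R fund xi F"
  by (simp add: fund_def matmul_scaleR scaleR_diff_right)

lemma phase_space_iff: "(F, P) \<in> phase_space \<longleftrightarrow> det F = 1 \<and> cof F \<bullet> P = 0"
  unfolding phase_space_def using tangent_space_SL3[of F] by (auto simp: SL3_def)

lemma hamiltonian_vd:
  assumes "rho0 > 0" "(c has_vector_derivative (A, B)) (at t)"
  shows "((\<lambda>s. hamiltonian rho0 grav (c s)) has_real_derivative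
     (snd (c t) \<bullet> B) / metric_const rho0 + R_const rho0 grav * (grad_pot (fst (c t)) \<bullet> A)) (at t)"
proof -
  have f: "((\<lambda>s. fst (c s)) has_vector_derivative A) (at t)" and p: "((\<lambda>s. snd (c s)) has_vector_derivative B) (at t)"
    using bounded_linear.has_vector_derivative[OF bounded_linear_fst assms(2)]
      bounded_linear.has_vector_derivative[OF bounded_linear_snd assms(2)] by simp_all
  have e: "hamiltonian rho0 grav (c s) = (snd (c s) \<bullet> snd (c s)) / (2 * metric_const rho0) + potential rho0 grav (fst (c s))" for s
    by (cases "c s") (simp add: trace_transpose_mul)
  have "metric_const rho0 \<noteq> 0" using assms(1) by (simp add: metric_const_def)
  then have "(snd (c t) \<bullet> B + B \<bullet> snd (c t)) / (2 * metric_const rho0) = (snd (c t) \<bullet> B) / metric_const rho0"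
    by (simp add: inner_commute field_simps)
  with DERIV_add[OF DERIV_cdivide[OF inner_vd[OF p p], of "2 * metric_const rho0"] potential_vd[OF f, of rho0 grav]]
  show ?thesis unfolding e by simp
qed

lemma symp_inner: "symp (A, B) (A', B') = A \<bullet> B' - A' \<bullet> B"
  by (simp add: trace_transpose_mul)

lemma phase_curveD:
  assumes "curve_in phase_space c (F, P) (A, B)"
  shows "det F = 1" "cof F \<bullet> A = 0" "((\<lambda>s. fst (c s)) has_vector_derivative A) (at 0)" "c 0 = (F, P)"
    "(c has_vector_derivative (A, B)) (at 0)"
proof -
  have c: "c s \<in> phase_space" "c 0 = (F, P)" "(c has_vector_derivative (A, B)) (at 0)" for s
    using assms unfolding curve_in_def by auto
  then show "c 0 = (F, P)" "(c has_vector_derivative (A, B)) (at 0)" by auto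
  show f: "((\<lambda>s. fst (c s)) has_vector_derivative A) (at 0)"
    using bounded_linear.has_vector_derivative[OF bounded_linear_fst c(3)] by simp
  have d: "det (fst (c s)) = 1" for s
    using c(1)[of s] phase_space_iff[of "fst (c s)" "snd (c s)"] by simp
  show "det F = 1" using d[of 0] c(2) by simp
  have "((\<lambda>s. 1) has_real_derivative cof F \<bullet> A) (at 0)" using det_vd[OF f] d c(2) by simp
  then show "cof F \<bullet> A = 0" using DERIV_unique DERIV_const by blast
qed

lemma traj_in_phase_space:
  assumes "det F = 1" "P = r *\<^sub>R fund xi F"
  shows "(traj xi F t, traj xi P t) \<in> phase_space"
proof -
  have "traj xi P t = r *\<^sub>R fund xi (traj xi F t)"
    using assms(2) by (simp add: fund_traj) (simp add: traj_def transform_scaleR)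
  then show ?thesis by (simp add: phase_space_iff det_traj assms(1) cof_fund)
qed

text \<open>The kinetic parts of both sides agree by the choice of \<open>P\<close>; the difference of the remaining terms
is the inner product of \<open>force\<close> with a tangent vector of \<open>SL(3)\<close>, which vanishes because
\<open>force\<close> is normal.\<close>

lemma ham_vector_of_balanced:
  assumes rho: "rho0 > 0" and F: "det F = 1" and P: "P = metric_const rho0 *\<^sub>R fund xi F"
    and bal: "balanced rho0 grav F xi"
  shows "is_ham_vector (hamiltonian rho0 grav) (F, P) (fund xi F, fund xi P)"
  unfolding is_ham_vector_def
proof (intro conjI allI impI)
  have "curve_in phase_space (\<lambda>t. (traj xi F t, traj xi P t)) (F, P) (fund xi F, fund xi P)"
    unfolding curve_in_def using traj_in_phase_space[OF F P] traj_vd[of xi F 0] traj_vd[of xi P 0]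
    by (auto simp: traj_0 intro!: has_vector_derivative_Pair)
  then show "(fund xi F, fund xi P) \<in> tangent_space phase_space (F, P)"
    unfolding tangent_space_def by blast
  fix c w assume "curve_in phase_space c (F, P) w"
  then obtain A B where w: "w = (A, B)" and c: "curve_in phase_space c (F, P) (A, B)" by (cases w) auto
  note cD = phase_curveD[OF c]
  obtain l where "force rho0 grav F xi = l *\<^sub>R cof F" using bal balanced_iff_cof[OF F] by blast
  then have "force rho0 grav F xi \<bullet> A = 0" using cD(2) by simp
  then have "R_const rho0 grav * (grad_pot F \<bullet> A) = - (A \<bullet> fund xi P)"
    unfolding force_def P fund_scaleR inner_commute[of A] by (simp add: inner_add_left)
  moreover have "metric_const rho0 \<noteq> 0" using rho by (simp add: metric_const_def)
  then have "(P \<bullet> B) / metric_const rho0 = fund xi F \<bullet> B" by (simp add: P)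
  ultimately show "((\<lambda>s. hamiltonian rho0 grav (c s)) has_real_derivative symp (fund xi F, fund xi P) w) (at 0)"
    using hamiltonian_vd[OF rho cD(5), of grav] unfolding cD(4) w symp_inner by simp
qed

text \<open>Two kinds of curves test the equation \<open>\<omega>(X, w) = dh(w)\<close>. Curves with fixed \<open>F\<close> determine \<open>P\<close>.
Curves over an arbitrary curve \<open>c\<close> in \<open>SL(3)\<close>, with momentum the orthogonal projection of
\<open>P\<close> to the tangent space at \<open>c s\<close>, show that \<open>force\<close> is orthogonal to every tangent
vector, hence a multiple of the cofactor matrix.\<close>

lemma balanced_of_ham_vector:
  assumes rho: "rho0 > 0" and FP: "(F, P) \<in> phase_space"
    and ham: "is_ham_vector (hamiltonian rho0 grav) (F, P) (fund xi F, fund xi P)"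
  shows "P = metric_const rho0 *\<^sub>R fund xi F" "balanced rho0 grav F xi"
proof -
  have F: "det F = 1" and cP: "cof F \<bullet> P = 0" using FP by (auto simp: phase_space_iff)
  have T0: "metric_const rho0 \<noteq> 0" using rho by (simp add: metric_const_def)
  have key: "(P \<bullet> B) / metric_const rho0 + R_const rho0 grav * (grad_pot F \<bullet> A) = fund xi F \<bullet> B - A \<bullet> fund xi P"
    if c: "curve_in phase_space c (F, P) (A, B)" for c A B
  proof -
    note cD = phase_curveD[OF c]
    have "((\<lambda>s. hamiltonian rho0 grav (c s)) has_real_derivative symp (fund xi F, fund xi P) (A, B)) (at 0)"
      using ham c unfolding is_ham_vector_def by blast
    from DERIV_unique[OF this hamiltonian_vd[OF rho cD(5)]] show ?thesis
      unfolding cD(4) symp_inner by simp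
  qed
  have "(1 / metric_const rho0) *\<^sub>R P = fund xi F"
  proof -
    \<comment> \<open>the variation of \<open>P\<close> in the direction of the defect forces the defect to vanish\<close>
    define B where "B = (1 / metric_const rho0) *\<^sub>R P - fund xi F"
    have cB: "cof F \<bullet> B = 0" by (simp add: B_def inner_diff_right cP cof_fund)
    have "curve_in phase_space (\<lambda>s. (F, P + s *\<^sub>R B)) (F, P) (0, B)"
      unfolding curve_in_def
    proof (intro conjI allI)
      show "(F, P + s *\<^sub>R B) \<in> phase_space" for s
        by (simp add: phase_space_iff F inner_add_right cP cB)
      show "((\<lambda>s. (F, P + s *\<^sub>R B)) has_vector_derivative (0, B)) (at 0)"
        by (intro has_vector_derivative_Pair) (auto intro!: derivative_eq_intros)
    qed simp
    from key[OF this] have "(P \<bullet> B) / metric_const rho0 = fund xi F \<bullet> B" by simp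
    moreover have "B \<bullet> B = (P \<bullet> B) / metric_const rho0 - fund xi F \<bullet> B"
      by (subst (1) B_def) (simp add: inner_diff_left)
    ultimately have "B \<bullet> B = 0" by simp
    then show ?thesis by (simp add: B_def)
  qed
  from arg_cong[OF this, of "(*\<^sub>R) (metric_const rho0)"]
  show P: "P = metric_const rho0 *\<^sub>R fund xi F" using T0 by simp
  have zero: "force rho0 grav F xi \<bullet> A = 0" if A: "cof F \<bullet> A = 0" for A
  proof -
    have "A \<in> tangent_space SL3 F" using tangent_space_SL3[of F] F A by (simp add: SL3_def)
    then obtain c where c: "\<And>s. det (c s) = 1" "c 0 = F" "(c has_vector_derivative A) (at 0)"
      unfolding tangent_space_def curve_in_def SL3_def by auto
    have cd: "c differentiable (at 0)" using c(3) by (auto simp: has_vector_derivative_def differentiable_def)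
    let ?C = "\<lambda>s. cof (c s)"
    define n where "n s = ?C s \<bullet> ?C s" for s
    have n0: "n s \<noteq> 0" for s
    proof
      assume "n s = 0"
      then have "?C s = 0" by (simp add: n_def)
      then have "(0::mat3) = mat 1" using cof_mul_transpose(1)[of "c s"] c(1)[of s] by (simp add: matmul_zero)
      then show False by (simp add: mat3_eq_iff mat1_nth forall_3)
    qed
    obtain C' where C': "(?C has_vector_derivative C') (at 0)"
    proof -
      have e: "((\<lambda>s. c s $ i $ j) has_real_derivative A $ i $ j) (at 0)" for i j
        using entry_vd[OF c(3)] by (simp add: has_real_derivative_iff_has_vector_derivative)
      have minor: "\<exists>d. ((\<lambda>s. c s $ i $ j * c s $ k $ l - c s $ m $ n * c s $ p $ q) has_real_derivative d) (at 0)"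
        for i j k l m n p q
        by (rule exI, rule DERIV_diff, rule DERIV_mult[OF e e], rule DERIV_mult[OF e e])
      have "\<exists>d. ((\<lambda>s. ?C s $ i $ j) has_real_derivative d) (at 0)" for i j
        using exhaust_3[of i] exhaust_3[of j] by (elim disjE) (simp_all only: cof_nth minor)
      then obtain d where "\<And>i j. ((\<lambda>s. ?C s $ i $ j) has_real_derivative d i j) (at 0)" by metis
      then have "(?C has_vector_derivative (\<chi> i j. d i j)) (at 0)" by (intro mat3_vdI) simp
      then show ?thesis by (rule that)
    qed
    have "((\<lambda>s. (?C s \<bullet> P) / n s) has_real_derivative ((C' \<bullet> P) * n 0 - (?C 0 \<bullet> P) * (?C 0 \<bullet> C' + C' \<bullet> ?C 0)) / (n 0 * n 0)) (at 0)"
      unfolding n_def using inner_vd[OF C' has_vector_derivative_const[of P]] 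
      by (intro DERIV_divide inner_vd[OF C' C']) (use n0[of 0] in \<open>auto simp: n_def\<close>)
    then obtain q' where q: "((\<lambda>s. (?C s \<bullet> P) / n s) has_real_derivative q') (at 0)" by blast
    \<comment> \<open>orthogonal projection of \<open>P\<close> to the tangent space at \<open>c s\<close>\<close>
    define D where "D s = P - ((?C s \<bullet> P) / n s) *\<^sub>R ?C s" for s
    have "(D has_vector_derivative 0 - (((?C 0 \<bullet> P) / n 0) *\<^sub>R C' + q' *\<^sub>R ?C 0)) (at 0)"
      unfolding D_def by (intro has_vector_derivative_diff has_vector_derivative_const has_vector_derivative_scaleR q C')
    then obtain B where B: "(D has_vector_derivative B) (at 0)" by blast
    have "curve_in phase_space (\<lambda>s. (c s, D s)) (F, P) (A, B)"
      unfolding curve_in_def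
    proof (intro conjI allI)
      show "(c s, D s) \<in> phase_space" for s
        using n0[of s] by (simp add: phase_space_iff c D_def inner_diff_right n_def)
      show "(c 0, D 0) = (F, P)" by (simp add: D_def c cP)
    qed (intro has_vector_derivative_Pair c(3) B)
    from key[OF this] show ?thesis
      unfolding force_def using T0 by (simp add: P fund_scaleR inner_add_left inner_add_right inner_commute)
  qed
  have "force rho0 grav F xi = ((force rho0 grav F xi \<bullet> cof F) / (cof F \<bullet> cof F)) *\<^sub>R cof F"
  proof -
    define X where "X = force rho0 grav F xi"
    define l where "l = (X \<bullet> cof F) / (cof F \<bullet> cof F)"
    have "cof F \<bullet> cof F \<noteq> 0"
    proof
      assume "cof F \<bullet> cof F = 0"
      then have "(0::mat3) = mat 1" using cof_mul_transpose(1)[of F] F by (simp add: matmul_zero)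
      then show False by (simp add: mat3_eq_iff mat1_nth forall_3)
    qed
    then have o: "cof F \<bullet> (X - l *\<^sub>R cof F) = 0" by (simp add: l_def inner_diff_right inner_commute)
    have "(X - l *\<^sub>R cof F) \<bullet> (X - l *\<^sub>R cof F) = X \<bullet> (X - l *\<^sub>R cof F) - l * (cof F \<bullet> (X - l *\<^sub>R cof F))"
      by (simp add: inner_diff_left)
    also have "\<dots> = 0" using zero[OF o] o by (simp add: X_def)
    finally have "X - l *\<^sub>R cof F = 0" by simp
    then show ?thesis by (simp add: X_def l_def)
  qed
  then show "balanced rho0 grav F xi" using balanced_iff_cof[OF F] by blast
qed

text \<open>The equations of motion need to be checked at one point of the trajectory only, since \<open>balanced\<close>
is preserved along it: the exponential of \<open>hat u\<close> fixes \<open>u\<close>.\<close>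

theorem rel_equilibrium_vel_iff:
  assumes rho: "rho0 > 0"
  shows "rel_equilibrium_vel rho0 grav (F, P) xi \<longleftrightarrow>
    det F = 1 \<and> P = metric_const rho0 *\<^sub>R fund xi F \<and> balanced rho0 grav F xi"
proof
  assume "rel_equilibrium_vel rho0 grav (F, P) xi"
  then have FP: "(F, P) \<in> phase_space"
    and tr: "ham_trajectory (hamiltonian rho0 grav) (\<lambda>t. (traj xi F t, traj xi P t))"
    unfolding rel_equilibrium_vel_def act_exp_sym by auto
  have "\<exists>X. ((\<lambda>t. (traj xi F t, traj xi P t)) has_vector_derivative X) (at 0) \<and>
      is_ham_vector (hamiltonian rho0 grav) (traj xi F 0, traj xi P 0) X"
    using tr unfolding ham_trajectory_def by blast
  then obtain X where X: "((\<lambda>t. (traj xi F t, traj xi P t)) has_vector_derivative X) (at 0)"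
    "is_ham_vector (hamiltonian rho0 grav) (F, P) X" by (auto simp: traj_0)
  have "((\<lambda>t. (traj xi F t, traj xi P t)) has_vector_derivative (fund xi F, fund xi P)) (at 0)"
    using traj_vd[of xi F 0] traj_vd[of xi P 0] by (auto simp: traj_0 intro!: has_vector_derivative_Pair)
  with X have "is_ham_vector (hamiltonian rho0 grav) (F, P) (fund xi F, fund xi P)"
    using vector_derivative_unique_at by blast
  then show "det F = 1 \<and> P = metric_const rho0 *\<^sub>R fund xi F \<and> balanced rho0 grav F xi"
    using balanced_of_ham_vector[OF rho FP] FP by (auto simp: phase_space_iff)
next
  assume a: "det F = 1 \<and> P = metric_const rho0 *\<^sub>R fund xi F \<and> balanced rho0 grav F xi"
  have ps: "(traj xi F t, traj xi P t) \<in> phase_space" for t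
    using a by (intro traj_in_phase_space) auto
  have "is_ham_vector (hamiltonian rho0 grav) (traj xi F t, traj xi P t) (fund xi (traj xi F t), fund xi (traj xi P t))" for t
  proof (rule ham_vector_of_balanced[OF rho])
    show "traj xi P t = metric_const rho0 *\<^sub>R fund xi (traj xi F t)"
      using a by (simp add: fund_traj) (simp add: traj_def transform_scaleR)
  qed (use a in \<open>simp_all add: det_traj balanced_traj\<close>)
  then have "ham_trajectory (hamiltonian rho0 grav) (\<lambda>t. (traj xi F t, traj xi P t))"
    unfolding ham_trajectory_def using ps traj_vd has_vector_derivative_Pair by blast
  moreover have "(F, P) \<in> phase_space" using ps[of 0] by (simp add: traj_0)
  ultimately show "rel_equilibrium_vel rho0 grav (F, P) xi"
    unfolding rel_equilibrium_vel_def act_exp_sym by simp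
qed


section \<open>Isotropy groups at diagonal configurations\<close>

lemma diag_nth: "diag a $ i $ j = (if i = j then a $ i else 0)" by (simp add: diag_def)

lemma det_diag3: "det (diag a) = a$1 * a$2 * a$3" by (simp add: det_3 diag_nth)

lemma transpose_diag: "transpose (diag a) = diag a"
  by (simp add: mat3_eq_iff transpose_nth diag_nth)

lemma diag_mul_diag: "diag a ** diag b = diag (\<chi> i. a $ i * b $ i)"
  by (simp add: mat3_eq_iff matmul_nth diag_nth forall_3)

lemma mul_diag_nth: "((M::mat3) ** diag d) $ i $ j = M $ i $ j * d $ j" "(diag d ** (M::mat3)) $ i $ j = d $ i * M $ i $ j"
  using exhaust_3[of i] exhaust_3[of j] by (auto simp: matmul_nth diag_nth)

lemma one_eq_diag: "mat 1 = diag (\<chi> i. 1)"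
  by (simp add: mat3_eq_iff mat1_nth diag_nth)

lemma diag_eq_iff: "diag a = diag b \<longleftrightarrow> a = b"
  by (auto simp: mat3_eq_iff diag_nth vec_eq_iff forall_3)

lemma I1_diag: "I1 (diag a) = (a$1)\<^sup>2 + (a$2)\<^sup>2 + (a$3)\<^sup>2"
  by (simp add: I1_inner inner_mat3 sum_3 diag_nth power2_eq_square)

lemma I2_diag: "I2 (diag a) = (a$1)\<^sup>2 * (a$2)\<^sup>2 + (a$2)\<^sup>2 * (a$3)\<^sup>2 + (a$3)\<^sup>2 * (a$1)\<^sup>2"
  by (simp add: I2_cof inner_mat3 sum_3 cof_nth diag_nth power2_eq_square)

lemma fund_diag_nth:
  "fund (L, R) (diag a) $ 1 $ 1 = 0" "fund (L, R) (diag a) $ 2 $ 2 = 0" "fund (L, R) (diag a) $ 3 $ 3 = 0"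
  "fund (L, R) (diag a) $ 1 $ 2 = - L$3 * a$2 + a$1 * R$3" "fund (L, R) (diag a) $ 2 $ 1 = L$3 * a$1 - a$2 * R$3"
  "fund (L, R) (diag a) $ 1 $ 3 = L$2 * a$3 - a$1 * R$2" "fund (L, R) (diag a) $ 3 $ 1 = - L$2 * a$1 + a$3 * R$2"
  "fund (L, R) (diag a) $ 2 $ 3 = - L$1 * a$3 + a$2 * R$1" "fund (L, R) (diag a) $ 3 $ 2 = L$1 * a$2 - a$3 * R$1"
  by (simp_all add: fund_def matmul_nth hat_nth diag_nth)

text \<open>The two numbers are the \<open>(i, j)\<close> and \<open>(j, i)\<close> entries of the momentum, up to a common sign. Together they
determine \<open>l\<close> and \<open>r\<close> because the linear system has determinant \<open>a\<^sup>2 - b\<^sup>2\<close> up to sign.\<close>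

lemma entry_sign_cases:
  assumes "a \<noteq> b" "a > 0" "b > 0" "s = 1 \<or> s = -1"
  shows "s * (- l * b + a * r) = - l * b + a * r \<and> s * (l * a - b * r) = l * a - b * r \<longleftrightarrow> s * l = l \<and> s * r = (r::real)"
    and "s * (l * a - b * r) = - l * b + a * r \<and> s * (- l * b + a * r) = l * a - b * r \<longleftrightarrow> s * r = l"
proof -
  have z: "(- l * b + a * r = 0 \<and> l * a - b * r = 0) \<longleftrightarrow> l = 0 \<and> r = 0"
  proof
    assume e: "- l * b + a * r = 0 \<and> l * a - b * r = 0"
    have "l * (a * a - b * b) = a * (l * a - b * r) + b * (- l * b + a * r)" by (simp add: algebra_simps)
    then have "l * ((a - b) * (a + b)) = 0" using e by (simp add: algebra_simps)
    then have "l = 0" using assms by auto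
    then show "l = 0 \<and> r = 0" using e assms by simp
  qed simp
  show "s * (- l * b + a * r) = - l * b + a * r \<and> s * (l * a - b * r) = l * a - b * r \<longleftrightarrow> s * l = l \<and> s * r = r"
    using assms(4)
  proof
    assume s: "s = -1"
    have n: "-1 * x = x \<longleftrightarrow> x = 0" for x :: real by auto
    show ?thesis unfolding s n by (rule z)
  qed simp
  have "l = r" if "l * a - b * r = - l * b + a * r"
  proof -
    have "(l - r) * (a + b) = 0" using that by (simp add: algebra_simps)
    then show ?thesis using assms by auto
  qed
  moreover have "l = - r" if "- (l * a - b * r) = - l * b + a * r"
  proof -
    have "(l + r) * (a - b) = 0" using that by (simp add: algebra_simps)
    then show ?thesis using assms by auto
  qed
  ultimately show "s * (l * a - b * r) = - l * b + a * r \<and> s * (- l * b + a * r) = l * a - b * r \<longleftrightarrow> s * r = l"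
    using assms(4) by (elim disjE) (auto simp: algebra_simps)
qed

text \<open>\<open>g\<close> commutes with the square of \<open>diag a\<close>, which has distinct eigenvalues, so \<open>g\<close> is diagonal;
then \<open>k\<close> must equal \<open>g\<close> because \<open>diag a\<close> is invertible.\<close>

lemma diag_fixed:
  assumes g: "rotation_matrix g" and k: "rotation_matrix k"
    and pos: "\<And>i. a $ i > 0" and dist: "inj (($) a)"
    and fx: "g ** diag a ** transpose k = diag a"
  obtains s where "g = diag s" "k = diag s" "\<And>i. s $ i = 1 \<or> s $ i = -1" "s$1 * s$2 * s$3 = 1"
proof -
  let ?D = "diag a"
  let ?E = "diag (\<chi> i. a $ i * a $ i)"
  have DD: "?D ** ?D = ?E" by (simp add: diag_mul_diag)
  have "g ** ?D ** transpose k ** transpose (g ** ?D ** transpose k) = ?E"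
    by (simp add: fx transpose_diag DD)
  then have "g ** (?D ** (transpose k ** k) ** ?D) ** transpose g = ?E"
    by (simp add: matrix_transpose_mul transpose_diag matrix_mul_assoc)
  then have "g ** ?E ** transpose g = ?E" by (simp add: rotationD[OF k] DD)
  then have "g ** ?E ** (transpose g ** g) = ?E ** g" by (simp add: matrix_mul_assoc)
  then have gE: "g ** ?E = ?E ** g" by (simp add: rotationD[OF g])
  have com: "g $ i $ j * (a $ j * a $ j) = a $ i * a $ i * g $ i $ j" for i j
    using arg_cong[of _ _ "\<lambda>M. M $ i $ j", OF gE] by (simp add: mul_diag_nth)
  have off: "g $ i $ j = 0" if "i \<noteq> j" for i j
  proof -
    have "g $ i $ j * ((a $ j - a $ i) * (a $ j + a $ i)) = 0" using com[of i j] by (simp add: algebra_simps)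
    then show ?thesis using injD[OF dist, of i j] that pos[of i] pos[of j] by auto
  qed
  define s where "s = (\<chi> i. g $ i $ i)"
  have gs: "g = diag s" using off by (auto simp: mat3_eq_iff diag_nth s_def)
  have ss: "diag s ** diag s = mat 1" using rotationD(2)[OF g] by (simp add: gs transpose_diag)
  have sq: "s $ i * s $ i = 1" for i
    using arg_cong[of _ _ "\<lambda>M. M $ i $ i", OF ss] by (simp add: mul_diag_nth diag_nth mat1_nth)
  have "diag s ** diag a ** transpose k = diag a" using fx gs by simp
  then have dd: "diag a ** (diag s ** transpose k) = diag a ** mat 1"
    by (simp add: matrix_mul_assoc diag_mul_diag mult.commute)
  have "a $ i * (diag s ** transpose k) $ i $ j = a $ i * (mat 1 :: mat3) $ i $ j" for i j
    using arg_cong[of _ _ "\<lambda>M. M $ i $ j", OF dd] by (simp only: mul_diag_nth(2)[of a])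
  then have "diag s ** transpose k = mat 1" using pos by (simp add: mat3_eq_iff less_imp_neq[symmetric])
  then have "diag s ** (transpose k ** k) = k" by (simp add: matrix_mul_assoc)
  then have "k = diag s" by (simp add: rotationD[OF k])
  moreover have "s $ i = 1 \<or> s $ i = -1" for i using sq[of i] by (simp add: square_eq_1_iff)
  moreover have "s$1 * s$2 * s$3 = 1" using rotationD(3)[OF g] by (simp add: gs det_diag3)
  ultimately show ?thesis using gs that by blast
qed

lemma rotation_diag:
  assumes "\<And>i. s $ i = 1 \<or> s $ i = -1" "s$1 * s$2 * s$3 = 1"
  shows "rotation_matrix (diag s)"
proof (rule rotationI)
  have "s $ i * s $ i = 1" for i using assms(1)[of i] by auto
  then show "diag s ** transpose (diag s) = mat 1"
    by (simp add: transpose_diag diag_mul_diag one_eq_diag)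
  show "det (diag s) = 1" using assms(2) by (simp add: det_diag3)
qed

lemma diag_conj_nth: "(diag s ** P ** diag s) $ i $ j = s $ i * s $ j * P $ i $ j"
  using exhaust_3[of i] exhaust_3[of j] by (auto simp: matmul_nth diag_nth)

lemma mem_isotropy:
  "(t, g, k) \<in> isotropy z \<longleftrightarrow> rotation_matrix g \<and> rotation_matrix k \<and> act (t, g, k) z = z"
  unfolding stabilizer_def by (auto simp: sym_group_def)

text \<open>A diagonal sign matrix \<open>diag s\<close> of determinant 1 acts on each component of an axial vector by \<open>s i\<close>, and
transposition exchanges the roles of \<open>L\<close> and \<open>R\<close>. So the stabilizer can be read off from the
velocity.\<close>

lemma isotropy_diag:
  assumes pos: "\<And>i. a $ i > 0" and dist: "inj (($) a)" and r: "r \<noteq> 0"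
  shows "(t, g, k) \<in> isotropy (diag a, r *\<^sub>R fund (L, R) (diag a)) \<longleftrightarrow>
     (\<exists>s. g = diag s \<and> k = diag s \<and> (\<forall>i. s $ i = 1 \<or> s $ i = -1) \<and> s$1 * s$2 * s$3 = 1 \<and>
        (\<forall>i. if t then s $ i * R $ i = L $ i else s $ i * L $ i = L $ i \<and> s $ i * R $ i = R $ i))"
    (is "?lhs \<longleftrightarrow> (\<exists>s. ?rhs s)")
proof -
  let ?f = "fund (L, R) (diag a)"
  have key: "act (t, diag s, diag s) (diag a, r *\<^sub>R ?f) = (diag a, r *\<^sub>R ?f) \<longleftrightarrow>
      (\<forall>i. if t then s $ i * R $ i = L $ i else s $ i * L $ i = L $ i \<and> s $ i * R $ i = R $ i)"
    if s: "\<forall>i. s $ i = 1 \<or> s $ i = -1" "s$1 * s$2 * s$3 = 1" for s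
  proof -
    have sq: "s $ i * s $ i = 1" for i using s(1)[rule_format, of i] by auto
    have p: "s$1 * s$2 = s$3" "s$2 * s$1 = s$3" "s$1 * s$3 = s$2" "s$3 * s$1 = s$2" "s$2 * s$3 = s$1" "s$3 * s$2 = s$1"
      using s(2) s(1)[rule_format, of 1] s(1)[rule_format, of 2] s(1)[rule_format, of 3] by auto
    have D: "diag s ** diag a ** diag s = diag a"
      by (simp add: mat3_eq_iff diag_conj_nth diag_nth sq)
    have n: "a$1 \<noteq> a$2" "a$3 \<noteq> a$1" "a$2 \<noteq> a$3" using injD[OF dist, of 1 2] injD[OF dist, of 3 1] injD[OF dist, of 2 3] by auto
    note c = entry_sign_cases[OF n(1) pos pos s(1)[rule_format, of 3], of "L$3" "R$3"]
      entry_sign_cases[OF n(2) pos pos s(1)[rule_format, of 2], of "L$2" "R$2"]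
      entry_sign_cases[OF n(3) pos pos s(1)[rule_format, of 1], of "L$1" "R$1"]
    show ?thesis
    proof (cases t)
      case True
      have "act (t, diag s, diag s) (diag a, r *\<^sub>R ?f) = (diag a, r *\<^sub>R ?f) \<longleftrightarrow> diag s ** transpose ?f ** diag s = ?f"
      proof -
        have "transpose (r *\<^sub>R ?f) = r *\<^sub>R transpose ?f" by (simp add: mat3_eq_iff transpose_nth)
        then show ?thesis using True r by (simp add: transpose_diag D matmul_scaleR)
      qed
      also have "\<dots> \<longleftrightarrow> (\<forall>i. s $ i * R $ i = L $ i)"
        unfolding mat3_eq_iff diag_conj_nth transpose_nth forall_3 fund_diag_nth sq p
        using c(2,4,6) by (simp add: algebra_simps) blast
      finally show ?thesis using True by simp
    next
      case False
      have "act (t, diag s, diag s) (diag a, r *\<^sub>R ?f) = (diag a, r *\<^sub>R ?f) \<longleftrightarrow> diag s ** ?f ** diag s = ?f"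
        using False r by (simp add: transpose_diag D matmul_scaleR)
      also have "\<dots> \<longleftrightarrow> (\<forall>i. s $ i * L $ i = L $ i \<and> s $ i * R $ i = R $ i)"
        unfolding mat3_eq_iff diag_conj_nth transpose_nth forall_3 fund_diag_nth sq p
        using c(1,3,5) by (simp add: algebra_simps) blast
      finally show ?thesis using False by simp
    qed
  qed
  show ?thesis
  proof
    assume l: ?lhs
    then have rot: "rotation_matrix g" "rotation_matrix k" and ac: "act (t, g, k) (diag a, r *\<^sub>R ?f) = (diag a, r *\<^sub>R ?f)"
      unfolding mem_isotropy by auto
    obtain s where s: "g = diag s" "k = diag s" "\<And>i. s $ i = 1 \<or> s $ i = -1" "s$1 * s$2 * s$3 = 1"
    proof (cases t)
      case True
      then have "k ** diag a ** transpose g = diag a" using ac by (simp add: transpose_diag)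
      from diag_fixed[OF rot(2,1) pos dist this] that show ?thesis by metis
    next
      case False
      then have "g ** diag a ** transpose k = diag a" using ac by simp
      from diag_fixed[OF rot pos dist this] that show ?thesis by metis
    qed
    have "\<forall>i. if t then s $ i * R $ i = L $ i else s $ i * L $ i = L $ i \<and> s $ i * R $ i = R $ i"
      using key[of s] s(3,4) ac[unfolded s(1,2)] by blast
    then have "?rhs s" using s by blast
    then show "\<exists>s. ?rhs s" by (rule exI)
  next
    assume "\<exists>s. ?rhs s"
    then show ?lhs using key rotation_diag unfolding mem_isotropy by metis
  qed
qed

lemma group_sym: "group sym_group"
proof (rule groupI)
  have m: "rotation_matrix (A ** B)" if "rotation_matrix A" "rotation_matrix B" for A B :: mat3
    using that orthogonal_matrix_mul by (auto simp: rotation_matrix_def det_mul)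
  have t: "rotation_matrix (transpose A)" if "rotation_matrix A" for A :: mat3
    using that by (auto simp: rotation_matrix_def orthogonal_matrix_def)
  show "x \<otimes>\<^bsub>sym_group\<^esub> y \<in> carrier sym_group" if "x \<in> carrier sym_group" "y \<in> carrier sym_group" for x y
    using that by (cases x; cases y) (auto simp: sym_group_def m)
  show "\<one>\<^bsub>sym_group\<^esub> \<in> carrier sym_group"
    by (simp add: sym_group_def rotation_matrix_def orthogonal_matrix_def)
  show "x \<otimes>\<^bsub>sym_group\<^esub> y \<otimes>\<^bsub>sym_group\<^esub> z = x \<otimes>\<^bsub>sym_group\<^esub> (y \<otimes>\<^bsub>sym_group\<^esub> z)" for x y z
    by (cases x; cases y; cases z) (auto simp: sym_group_def matrix_mul_assoc)
  show "\<one>\<^bsub>sym_group\<^esub> \<otimes>\<^bsub>sym_group\<^esub> x = x" for x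
    by (cases x) (auto simp: sym_group_def)
  show "\<exists>y\<in>carrier sym_group. y \<otimes>\<^bsub>sym_group\<^esub> x = \<one>\<^bsub>sym_group\<^esub>" if x: "x \<in> carrier sym_group" for x
  proof -
    obtain s g k where [simp]: "x = (s, g, k)" by (cases x) auto
    have r: "rotation_matrix g" "rotation_matrix k" using x by (auto simp: sym_group_def)
    show ?thesis using t[OF r(1)] t[OF r(2)] rotationD[OF r(1)] rotationD[OF r(2)]
      by (intro bexI[of _ "(s, if s then (transpose k, transpose g) else (transpose g, transpose k))"])
        (auto simp: sym_group_def)
  qed
qed

lemma rot_pi: "rot (axis 3 1) pi = diag (vector [-1, -1, 1])" "rot (axis 1 1) pi = diag (vector [1, -1, -1])"
  unfolding rot_def matrix_def
  by (simp_all add: mat3_eq_iff forall_3 diag_nth axis_def inner_vec_def sum_3 cross3_def)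

abbreviation flip3 :: sym where "flip3 \<equiv> (False, diag (vector [-1, -1, 1]), diag (vector [-1, -1, 1]))"
abbreviation swap1 :: sym where "swap1 \<equiv> (True, diag (vector [1, -1, -1]), diag (vector [1, -1, -1]))"
abbreviation swap2 :: sym where "swap2 \<equiv> (True, diag (vector [-1, 1, -1]), diag (vector [-1, 1, -1]))"

lemma isotropy_subgroup: "subgroup (isotropy z) sym_group"
proof -
  have "x \<in> isotropy z \<longleftrightarrow> x \<in> carrier sym_group \<and> act x z = z" for x by (auto simp: stabilizer_def)
  interpret group sym_group by (rule group_sym)
  have one: "act \<one>\<^bsub>sym_group\<^esub> w = w" for w by (cases w) (simp add: sym_group_def)
  have mul: "act (x \<otimes>\<^bsub>sym_group\<^esub> y) w = act x (act y w)" for x y w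
    by (simp add: sym_group_def act_mult)
  show ?thesis
  proof (rule subgroupI)
    show "isotropy z \<subseteq> carrier sym_group" by (auto simp: stabilizer_def)
    have "\<one>\<^bsub>sym_group\<^esub> \<in> isotropy z" using one[of z] one_closed by (simp add: stabilizer_def)
    then show "isotropy z \<noteq> {}" by blast
    show "inv\<^bsub>sym_group\<^esub> x \<in> isotropy z" if "x \<in> isotropy z" for x
    proof -
      have x: "x \<in> carrier sym_group" "act x z = z" using that by (auto simp: stabilizer_def)
      have "act (inv\<^bsub>sym_group\<^esub> x) z = act (inv\<^bsub>sym_group\<^esub> x) (act x z)" by (simp add: x)
      also have "\<dots> = z" unfolding mul[symmetric] using x one by simp
      finally show ?thesis using x by (auto simp: stabilizer_def)
    qed
    show "x \<otimes>\<^bsub>sym_group\<^esub> y \<in> isotropy z" if "x \<in> isotropy z" "y \<in> isotropy z" for x y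
      using that by (auto simp: stabilizer_def mul)
  qed
qed


lemma flip3_swap1_in:
  "\<one>\<^bsub>sym_group\<^esub> \<in> K_S" "flip3 \<in> K_S" "\<one>\<^bsub>sym_group\<^esub> \<in> K_adj" "flip3 \<in> K_adj" "swap1 \<in> K_adj" "swap2 \<in> K_adj"
proof -
  show "\<one>\<^bsub>sym_group\<^esub> \<in> K_S" "flip3 \<in> K_S" "\<one>\<^bsub>sym_group\<^esub> \<in> K_adj" and f: "flip3 \<in> K_adj" and w: "swap1 \<in> K_adj"
    unfolding K_S_def K_adj_def rot_pi by (auto intro: generate.intros)
  have "flip3 \<otimes>\<^bsub>sym_group\<^esub> swap1 = swap2"
    by (simp add: sym_group_def diag_mul_diag diag_eq_iff) (simp add: vec_eq_iff forall_3)
  then show "swap2 \<in> K_adj"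
    using generate.eng[of flip3 sym_group _ swap1] f w unfolding K_adj_def by metis
qed

lemma K_subset_isotropy:
  "flip3 \<in> isotropy z \<Longrightarrow> K_S \<subseteq> isotropy z"
  "flip3 \<in> isotropy z \<Longrightarrow> swap1 \<in> isotropy z \<Longrightarrow> K_adj \<subseteq> isotropy z"
  unfolding K_S_def K_adj_def rot_pi
  using group.generate_subgroup_incl[OF group_sym _ isotropy_subgroup, of _ z] by auto

lemma diag_one: "diag (vector [1, 1, 1]) = mat 1"
  by (simp add: mat3_eq_iff forall_3 diag_nth mat1_nth)

lemma sign3_cases:
  fixes s :: "real^3"
  assumes "\<forall>i. s $ i = 1 \<or> s $ i = -1" "s$1 * s$2 * s$3 = 1"
  shows "s$3 = 1 \<longleftrightarrow> s = vector [1, 1, 1] \<or> s = vector [-1, -1, 1]"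
    "s$3 = -1 \<longleftrightarrow> s = vector [1, -1, -1] \<or> s = vector [-1, 1, -1]"
  using assms by (auto simp: vec_eq_iff forall_3)

text \<open>Different lengths exclude the elements with transposition, which would map \<open>m\<close> to \<open>\<plusminus>l\<close>.\<close>

lemma isotropy_type_S:
  assumes pos: "\<And>i. a $ i > 0" and dist: "inj (($) a)" and r: "r \<noteq> 0"
    and lm: "\<bar>l\<bar> \<noteq> \<bar>m\<bar>"
  defines "z \<equiv> (diag a, r *\<^sub>R fund (l *\<^sub>R axis 3 1, m *\<^sub>R axis 3 1) (diag a))"
  shows "isotropy z = K_S" "card (isotropy z) = 2"
proof -
  have "x \<in> isotropy z \<longleftrightarrow> x \<in> {\<one>\<^bsub>sym_group\<^esub>, flip3}" for x
  proof -
    obtain t g k where x: "x = (t, g, k)" by (cases x) auto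
    have "x \<in> isotropy z \<longleftrightarrow> (\<exists>s. g = diag s \<and> k = diag s \<and> (\<forall>i. s $ i = 1 \<or> s $ i = -1) \<and> s$1 * s$2 * s$3 = 1 \<and>
        \<not> t \<and> s $ 3 = 1)"
    proof -
      have "(\<forall>i. if t then s $ i * (m *\<^sub>R axis 3 1 :: real^3) $ i = (l *\<^sub>R axis 3 1) $ i
           else s $ i * (l *\<^sub>R axis 3 1 :: real^3) $ i = (l *\<^sub>R axis 3 1) $ i \<and> s $ i * (m *\<^sub>R axis 3 1 :: real^3) $ i = (m *\<^sub>R axis 3 1) $ i)
         \<longleftrightarrow> \<not> t \<and> s $ 3 = 1" if "\<forall>i. s $ i = 1 \<or> s $ i = -1" for s
        using that[rule_format, of 3] lm by (auto simp: forall_3 axis_def)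
      note eq = this
      show ?thesis unfolding x z_def isotropy_diag[OF pos dist r]
        by (rule iff_exI) (use eq in blast)
    qed
    also have "\<dots> \<longleftrightarrow> \<not> t \<and> g = k \<and> (g = diag (vector [1, 1, 1]) \<or> g = diag (vector [-1, -1, 1]))" (is "_ \<longleftrightarrow> ?r")
    proof
      assume "\<exists>s. g = diag s \<and> k = diag s \<and> (\<forall>i. s $ i = 1 \<or> s $ i = -1) \<and> s$1 * s$2 * s$3 = 1 \<and> \<not> t \<and> s $ 3 = 1"
      then show ?r using sign3_cases(1) by metis
    next
      assume r: ?r
      then obtain s where s: "s = vector [1, 1, 1] \<or> s = vector [-1, -1, 1]" "g = diag s" by blast
      then have "(\<forall>i. s $ i = 1 \<or> s $ i = -1) \<and> s$1 * s$2 * s$3 = 1 \<and> s $ 3 = 1" by (auto simp: forall_3)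
      then show "\<exists>s. g = diag s \<and> k = diag s \<and> (\<forall>i. s $ i = 1 \<or> s $ i = -1) \<and> s$1 * s$2 * s$3 = 1 \<and> \<not> t \<and> s $ 3 = 1"
        using r s by blast
    qed
    finally show ?thesis by (auto simp: x sym_group_def diag_one)
  qed
  then have e: "isotropy z = {\<one>\<^bsub>sym_group\<^esub>, flip3}" by blast
  have "isotropy z \<subseteq> K_S" unfolding e using flip3_swap1_in(1,2) by simp
  moreover have "K_S \<subseteq> isotropy z" by (rule K_subset_isotropy(1)) (simp add: e)
  ultimately show "isotropy z = K_S" by (rule equalityI)
  have "diag (vector [-1, -1, 1]) \<noteq> (mat 1 :: mat3)" unfolding diag_one[symmetric] diag_eq_iff by (simp add: vec_eq_iff forall_3)
  then show "card (isotropy z) = 2" unfolding e by (simp add: sym_group_def)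
qed

text \<open>Transposition combined with a half-turn about an axis orthogonal to \<open>e\<^sub>3\<close> exchanges \<open>l e\<^sub>3\<close> and \<open>- l e\<^sub>3\<close>
with the required sign.\<close>

lemma isotropy_adjoint_S:
  assumes pos: "\<And>i. a $ i > 0" and dist: "inj (($) a)" and r: "r \<noteq> 0"
    and l: "l \<noteq> 0"
  defines "z \<equiv> (diag a, r *\<^sub>R fund (l *\<^sub>R axis 3 1, - (l *\<^sub>R axis 3 1)) (diag a))"
  shows "isotropy z = K_adj" "card (isotropy z) = 4"
proof -
  have "x \<in> isotropy z \<longleftrightarrow> x \<in> {\<one>\<^bsub>sym_group\<^esub>, flip3, swap1, swap2}" for x
  proof -
    obtain t g k where x: "x = (t, g, k)" by (cases x) auto
    have "x \<in> isotropy z \<longleftrightarrow> (\<exists>s. g = diag s \<and> k = diag s \<and> (\<forall>i. s $ i = 1 \<or> s $ i = -1) \<and> s$1 * s$2 * s$3 = 1 \<and>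
        s $ 3 = (if t then -1 else 1))"
    proof -
      have "(\<forall>i. if t then s $ i * (- (l *\<^sub>R axis 3 1) :: real^3) $ i = (l *\<^sub>R axis 3 1) $ i
           else s $ i * (l *\<^sub>R axis 3 1 :: real^3) $ i = (l *\<^sub>R axis 3 1) $ i \<and> s $ i * (- (l *\<^sub>R axis 3 1) :: real^3) $ i = (- (l *\<^sub>R axis 3 1)) $ i)
         \<longleftrightarrow> s $ 3 = (if t then -1 else 1)" if "\<forall>i. s $ i = 1 \<or> s $ i = -1" for s
        using that[rule_format, of 3] l by (auto simp: forall_3 axis_def)
      note eq = this
      show ?thesis unfolding x z_def isotropy_diag[OF pos dist r]
        by (rule iff_exI) (use eq in blast)
    qed
    also have "\<dots> \<longleftrightarrow> g = k \<and> (\<not> t \<and> (g = diag (vector [1, 1, 1]) \<or> g = diag (vector [-1, -1, 1]))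
       \<or> t \<and> (g = diag (vector [1, -1, -1]) \<or> g = diag (vector [-1, 1, -1])))" (is "_ \<longleftrightarrow> ?r")
    proof
      assume "\<exists>s. g = diag s \<and> k = diag s \<and> (\<forall>i. s $ i = 1 \<or> s $ i = -1) \<and> s$1 * s$2 * s$3 = 1 \<and> s $ 3 = (if t then -1 else 1)"
      then show ?r using sign3_cases by (metis (full_types))
    next
      assume r: ?r
      then obtain s where s: "\<not> t \<and> (s = vector [1, 1, 1] \<or> s = vector [-1, -1, 1]) \<or> t \<and> (s = vector [1, -1, -1] \<or> s = vector [-1, 1, -1])" "g = diag s" by blast
      then have "(\<forall>i. s $ i = 1 \<or> s $ i = -1) \<and> s$1 * s$2 * s$3 = 1 \<and> s $ 3 = (if t then -1 else 1)" by (auto simp: forall_3)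
      then show "\<exists>s. g = diag s \<and> k = diag s \<and> (\<forall>i. s $ i = 1 \<or> s $ i = -1) \<and> s$1 * s$2 * s$3 = 1 \<and> s $ 3 = (if t then -1 else 1)"
        using r s by blast
    qed
    finally show ?thesis by (auto simp: x sym_group_def diag_one)
  qed
  then have e: "isotropy z = {\<one>\<^bsub>sym_group\<^esub>, flip3, swap1, swap2}" by blast
  have "isotropy z \<subseteq> K_adj" unfolding e using flip3_swap1_in(3-6) by simp
  moreover have "K_adj \<subseteq> isotropy z" by (rule K_subset_isotropy(2)) (simp_all add: e)
  ultimately show "isotropy z = K_adj" by (rule equalityI)
  have "diag (vector [-1, -1, 1]) \<noteq> (mat 1 :: mat3)" "diag (vector [1, -1, -1]) \<noteq> diag (vector [-1, 1, -1])"
    unfolding diag_one[symmetric] diag_eq_iff by (simp_all add: vec_eq_iff forall_3)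
  then show "card (isotropy z) = 4" unfolding e by (simp add: sym_group_def)
qed

text \<open>Two nonzero components of the velocity leave only one sign vector of determinant 1, and a
component in which the lengths differ excludes transposition.\<close>

lemma isotropy_trivial:
  assumes pos: "\<And>i. a $ i > 0" and dist: "inj (($) a)" and r: "r \<noteq> 0"
    and ij: "i \<noteq> j" "L $ i \<noteq> 0 \<or> R $ i \<noteq> 0" "L $ j \<noteq> 0 \<or> R $ j \<noteq> 0" and m: "\<bar>L $ m\<bar> \<noteq> \<bar>R $ m\<bar>"
  shows "isotropy (diag a, r *\<^sub>R fund (L, R) (diag a)) = {\<one>\<^bsub>sym_group\<^esub>}" (is "isotropy ?z = _")
proof -
  have "\<one>\<^bsub>sym_group\<^esub> \<in> isotropy ?z" using subgroup.one_closed[OF isotropy_subgroup] .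
  moreover have "x = \<one>\<^bsub>sym_group\<^esub>" if "x \<in> isotropy ?z" for x
  proof -
    obtain t g k where x: "x = (t, g, k)" by (cases x) auto
    from that have "\<exists>s. g = diag s \<and> k = diag s \<and> (\<forall>i. s $ i = 1 \<or> s $ i = -1) \<and> s$1 * s$2 * s$3 = 1 \<and>
        (\<forall>i. if t then s $ i * R $ i = L $ i else s $ i * L $ i = L $ i \<and> s $ i * R $ i = R $ i)"
      unfolding x isotropy_diag[OF pos dist r] .
    then obtain s where "g = diag s \<and> k = diag s \<and> (\<forall>i. s $ i = 1 \<or> s $ i = -1) \<and> s$1 * s$2 * s$3 = 1 \<and>
        (\<forall>i. if t then s $ i * R $ i = L $ i else s $ i * L $ i = L $ i \<and> s $ i * R $ i = R $ i)" ..
    then have s: "g = diag s" "k = diag s" "\<And>i. s $ i = 1 \<or> s $ i = -1" "s$1 * s$2 * s$3 = 1"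
      "\<And>i. if t then s $ i * R $ i = L $ i else s $ i * L $ i = L $ i \<and> s $ i * R $ i = R $ i" by simp_all
    have "\<not> t" using s(3)[of m] s(5)[of m] m by auto
    then have "s $ i = 1" "s $ j = 1" using s(3,5)[of i] s(3,5)[of j] ij by auto
    then have "s = vector [1, 1, 1]" using ij(1) s(4) exhaust_3[of i] exhaust_3[of j] s(3)
      by (auto simp: vec_eq_iff forall_3)
    then show ?thesis using \<open>\<not> t\<close> by (simp add: x s(1,2) diag_one sym_group_def)
  qed
  ultimately show ?thesis by blast
qed


section \<open>Orbits and singular values\<close>

lemma act_transform: "act (False, g, k) (F, P) = (transform g k F, transform g k P)"
  by (simp add: transform_def)

lemma transform_transform:
  "transform g k (transform g' k' F) = transform (g ** g') (k ** k') F"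
  by (simp add: transform_def matrix_transpose_mul matrix_mul_assoc)

lemma rotation_mul: "rotation_matrix (A::mat3) \<Longrightarrow> rotation_matrix B \<Longrightarrow> rotation_matrix (A ** B)"
  using orthogonal_matrix_mul by (auto simp: rotation_matrix_def det_mul)

lemma rotation_transpose: "rotation_matrix (A::mat3) \<Longrightarrow> rotation_matrix (transpose A)"
  by (auto simp: rotation_matrix_def orthogonal_matrix_def)

lemma rotation_one: "rotation_matrix (mat 1 :: mat3)"
  by (simp add: rotation_matrix_def orthogonal_matrix_def)

lemma transform_inverse:
  assumes "rotation_matrix g" "rotation_matrix k"
  shows "transform (transpose g) (transpose k) (transform g k F) = F"
  using rotationD[OF assms(1)] rotationD[OF assms(2)] by (simp add: transform_transform) (simp add: transform_def)

lemma mem_orbit: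
  assumes "rotation_matrix g" "rotation_matrix k"
  shows "(transform g k F, transform g k P) \<in> sym_orbit (F, P)"
  unfolding orbit_def act_transform[symmetric] using assms by (auto simp: sym_group_def)

lemma self_mem_orbit: "z \<in> sym_orbit z"
  using mem_orbit[OF rotation_one rotation_one, of "fst z" "snd z"] by (simp add: transform_def)

lemma isotropy_trivial_transform:
  assumes g: "rotation_matrix g" "rotation_matrix k"
    and triv: "isotropy (transform g k F, transform g k P) = {\<one>\<^bsub>sym_group\<^esub>}"
  shows "isotropy (F, P) = {\<one>\<^bsub>sym_group\<^esub>}"
proof -
  have "x = \<one>\<^bsub>sym_group\<^esub>" if x: "x \<in> isotropy (F, P)" for x
  proof -
    obtain t m n where xe: "x = (t, m, n)" by (cases x) auto
    have r: "rotation_matrix m" "rotation_matrix n" "act x (F, P) = (F, P)"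
      using x unfolding xe mem_isotropy by auto
    let ?h = "(False, g, k)" and ?hi = "(False, transpose g, transpose k)"
    let ?y = "sym_mult ?h (sym_mult x ?hi)"
    have "act ?hi (transform g k F, transform g k P) = (F, P)"
      unfolding act_transform by (simp add: transform_inverse[OF g])
    then have "act ?y (transform g k F, transform g k P) = (transform g k F, transform g k P)"
      unfolding act_mult by (simp only: r(3) act_transform)
    moreover have "?y = (t, if t then (k ** (m ** transpose k), g ** (n ** transpose g)) else (g ** (m ** transpose g), k ** (n ** transpose k)))" if "\<not> t"
      using that by (simp add: xe)
    moreover have yin: "?y \<in> carrier sym_group"
      using g r(1,2) rotation_mul rotation_transpose unfolding xe by (auto simp: sym_group_def)
    ultimately have "?y \<in> isotropy (transform g k F, transform g k P)"
      by (simp add: stabilizer_def)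
    then have y1: "?y = (False, mat 1, mat 1)" using triv by (simp add: sym_group_def)
    then have t: "\<not> t" by (simp add: xe)
    with y1 have "g ** (m ** transpose g) = mat 1" "k ** (n ** transpose k) = mat 1" by (simp_all add: xe)
    then have "transpose g ** (g ** (m ** transpose g)) ** g = mat 1" "transpose k ** (k ** (n ** transpose k)) ** k = mat 1"
      using rotationD[OF g(1)] rotationD[OF g(2)] by simp_all
    then have "(transpose g ** g) ** m ** (transpose g ** g) = mat 1" "(transpose k ** k) ** n ** (transpose k ** k) = mat 1"
      by (simp_all add: matrix_mul_assoc)
    then have "m = mat 1" "n = mat 1" using rotationD[OF g(1)] rotationD[OF g(2)] by simp_all
    then show ?thesis using t by (simp add: xe sym_group_def)
  qed
  moreover have "\<one>\<^bsub>sym_group\<^esub> \<in> isotropy (F, P)" using subgroup.one_closed[OF isotropy_subgroup] .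
  ultimately show ?thesis by blast
qed

lemma compact_rotations: "compact {g :: mat3. rotation_matrix g}"
  unfolding compact_eq_bounded_closed
proof
  have "norm g \<le> 2" if "rotation_matrix g" for g :: mat3
  proof -
    have "g \<bullet> g = trace (transpose g ** g)" by (simp add: trace_transpose_mul)
    also have "\<dots> = 3" by (simp add: rotationD[OF that] trace_def mat1_nth sum_3)
    finally have "(norm g)\<^sup>2 \<le> 2\<^sup>2" by (simp add: power2_norm_eq_inner)
    then show ?thesis by (rule power2_le_imp_le) simp
  qed
  then show "bounded {g :: mat3. rotation_matrix g}" by (auto intro: boundedI)
  have t: "continuous_on UNIV (transpose :: mat3 \<Rightarrow> mat3)" by (rule linear_continuous_on[OF bounded_linear_transpose3])
  have m: "continuous_on UNIV (\<lambda>g::mat3. g ** transpose g)" 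
    by (rule bounded_bilinear.continuous_on[OF bounded_bilinear_matmul continuous_on_id t])
  have d: "continuous_on UNIV (det :: mat3 \<Rightarrow> real)" unfolding det_3[abs_def] by (intro continuous_intros)
  have "{g :: mat3. rotation_matrix g} = {g. g ** transpose g = mat 1} \<inter> {g. det g = 1}"
    using rotationI rotationD by blast
  also have "closed \<dots>" using m d by (intro closed_Int closed_Collect_eq continuous_on_const) auto
  finally show "closed {g :: mat3. rotation_matrix g}" .
qed

lemma rotation_diag3:
  assumes "s$1 = 1 \<or> s$1 = -1" "s$2 = 1 \<or> s$2 = -1" "s$3 = 1 \<or> s$3 = -1" "s$1 * s$2 * s$3 = 1"
  shows "rotation_matrix (diag s)"
proof (rule rotation_diag)
  show "s $ i = 1 \<or> s $ i = -1" for i using assms(1-3) exhaust_3[of i] by metis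
qed (rule assms(4))

text \<open>Vanishing of the first derivative along one-parameter groups of rotations gives, for each pair of off-diagonal
entries, two independent linear equations (the weights 3, 2, 1 are distinct), so \<open>M\<close> is
diagonal. Comparison with quarter-turns orders the entries, and comparison with half-turns,
together with \<open>det M = 1\<close>, makes them positive.\<close>

lemma diagonal_of_maximal:
  fixes M :: mat3
  assumes max: "\<And>g k. rotation_matrix g \<Longrightarrow> rotation_matrix k \<Longrightarrow>
      diag (vector [3, 2, 1]) \<bullet> transform g k M \<le> diag (vector [3, 2, 1]) \<bullet> M"
    and det: "det M = 1"
  obtains a where "M = diag a" "a$1 \<ge> a$2" "a$2 \<ge> a$3" "a$3 > 0"
proof -
  let ?d = "vector [3, 2, 1] :: real^3"
  let ?D = "diag ?d"
  have crit: "?D \<bullet> (hat u ** M) = 0" "?D \<bullet> (M ** hat u) = 0" for u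
  proof -
    have v: "((\<lambda>t. ?D \<bullet> traj xi M t) has_real_derivative ?D \<bullet> fund xi M) (at 0)" for xi
      using inner_vd[OF has_vector_derivative_const[of ?D] traj_vd[of xi M 0]] by (simp add: traj_0)
    have z: "?D \<bullet> fund xi M = 0" for xi
    proof (rule DERIV_local_max[OF v[of xi], of 1])
      show "\<forall>y. \<bar>0 - y\<bar> < 1 \<longrightarrow> ?D \<bullet> traj xi M y \<le> ?D \<bullet> traj xi M 0"
        using max[OF rotation_mexp rotation_mexp] unfolding traj_0 by (simp add: traj_def)
    qed simp
    have h0: "hat 0 = (0 :: mat3)" using hat_scaleR[of 0 0] by simp
    show "?D \<bullet> (hat u ** M) = 0" using z[of "(u, 0)"] by (simp add: fund_def h0 matmul_zero)
    show "?D \<bullet> (M ** hat u) = 0" using z[of "(0, u)"] by (simp add: fund_def h0 matmul_zero)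
  qed
  have "M$2$3 = 2 * M$3$2" "M$3$2 = 2 * M$2$3" "M$3$1 * 3 = M$1$3" "M$3$1 = M$1$3 * 3" "M$1$2 * 2 = M$2$1 * 3" "M$1$2 * 3 = M$2$1 * 2"
    using crit(1)[of "axis 1 1"] crit(2)[of "axis 1 1"] crit(1)[of "axis 2 1"]
      crit(2)[of "axis 2 1"] crit(1)[of "axis 3 1"] crit(2)[of "axis 3 1"]
    by (simp_all add: inner_mat3 sum_3 diag_nth matmul_nth hat_nth axis_def)
  then have "M$2$3 = 0" "M$3$2 = 0" "M$1$3 = 0" "M$3$1 = 0" "M$1$2 = 0" "M$2$1 = 0" by linarith+
  then have e: "M $ i $ j = 0" if "i \<noteq> j" for i j
    using that exhaust_3[of i] exhaust_3[of j] by (elim disjE) simp_all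
  define a where "a = (\<chi> i. M $ i $ i)"
  have M: "M = diag a" using e by (auto simp: mat3_eq_iff diag_nth a_def)
  have Dd: "?D \<bullet> diag b = 3 * b$1 + 2 * b$2 + b$3" for b
    by (simp add: inner_mat3 sum_3 diag_nth)
  have val: "?D \<bullet> transform g (mat 1) (diag a) \<le> 3 * a$1 + 2 * a$2 + a$3" if "rotation_matrix g" for g
    using max[OF that rotation_one] unfolding M Dd .
  have tr: "transform (diag s) (mat 1) (diag a) = diag (\<chi> i. s $ i * a $ i)" for s
    by (simp add: transform_def diag_mul_diag)
  have s12: "3 * a$1 + 2 * a$2 \<ge> 0" and s13: "3 * a$1 + a$3 \<ge> 0" and s23: "2 * a$2 + a$3 \<ge> 0"
  proof -
    have r: "rotation_matrix (diag (vector [-1, -1, 1]))" "rotation_matrix (diag (vector [-1, 1, -1]))" "rotation_matrix (diag (vector [1, -1, -1]))"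
      by (rule rotation_diag3; simp)+
    show "3 * a$1 + 2 * a$2 \<ge> 0" "3 * a$1 + a$3 \<ge> 0" "2 * a$2 + a$3 \<ge> 0"
      using val[OF r(1)] val[OF r(2)] val[OF r(3)] unfolding tr Dd by simp_all
  qed
  \<comment> \<open>quarter-turns, which exchange neighbouring semiaxes\<close>
  define p q :: mat3 where "p = vector [vector [0, -1, 0], vector [1, 0, 0], vector [0, 0, 1]]"
    and "q = vector [vector [1, 0, 0], vector [0, 0, -1], vector [0, 1, 0]]"
  have rp: "rotation_matrix p" "rotation_matrix q"
    by (rule rotationI; simp add: p_def q_def mat3_eq_iff forall_3 matmul_nth transpose_nth mat1_nth det_3)+
  have "?D \<bullet> transform p p (diag a) \<le> 3 * a$1 + 2 * a$2 + a$3" "?D \<bullet> transform q q (diag a) \<le> 3 * a$1 + 2 * a$2 + a$3"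
    using max[OF rp(1) rp(1)] max[OF rp(2) rp(2)] unfolding M Dd .
  moreover have "transform p p (diag a) = diag (vector [a$2, a$1, a$3])" "transform q q (diag a) = diag (vector [a$1, a$3, a$2])"
    by (simp_all add: transform_def p_def q_def mat3_eq_iff forall_3 matmul_nth transpose_nth diag_nth)
  ultimately have o: "a$1 \<ge> a$2" "a$2 \<ge> a$3" by (simp_all add: Dd)
  have prod: "a$1 * a$2 * a$3 = 1" using det by (simp add: M det_diag3)
  have "a$2 \<ge> 0" using s23 o by linarith
  moreover have "a$2 \<noteq> 0" using prod by auto
  ultimately have "a$2 > 0" by simp
  then have "a$1 * a$2 > 0" using o by simp
  then have "a$3 > 0" using prod by (metis zero_less_mult_pos zero_less_one)
  then show ?thesis using that M o by blast
qed

text \<open>The rotations form a compact set, so the function in \<open>diagonal_of_maximal\<close> attains its maximum on the orbit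
of \<open>F\<close>.\<close>

lemma singular_values:
  assumes "det (F::mat3) = 1"
  obtains g k a where "rotation_matrix g" "rotation_matrix k" "transform g k F = diag a"
    "a$1 \<ge> a$2" "a$2 \<ge> a$3" "a$3 > 0"
proof -
  let ?D = "diag (vector [3, 2, 1])"
  let ?S = "{g :: mat3. rotation_matrix g} \<times> {g :: mat3. rotation_matrix g}"
  have "compact ?S" by (intro compact_Times compact_rotations)
  moreover have "?S \<noteq> {}" using rotation_one by blast
  moreover have "continuous_on ?S (\<lambda>x. ?D \<bullet> transform (fst x) (snd x) F)"
    unfolding transform_def
    by (intro continuous_on_inner bounded_bilinear.continuous_on[OF bounded_bilinear_matmul] continuous_intros
        bounded_linear.continuous_on[OF bounded_linear_transpose3])
  ultimately have "\<exists>x\<in>?S. \<forall>y\<in>?S. ?D \<bullet> transform (fst y) (snd y) F \<le> ?D \<bullet> transform (fst x) (snd x) F"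
    by (rule continuous_attains_sup)
  then obtain x where x: "x \<in> ?S" "\<And>y. y \<in> ?S \<Longrightarrow> ?D \<bullet> transform (fst y) (snd y) F \<le> ?D \<bullet> transform (fst x) (snd x) F"
    by (elim bexE) (rule that, assumption, blast)
  define g k where "g = fst x" and "k = snd x"
  have r: "rotation_matrix g" "rotation_matrix k" using x(1) by (auto simp: g_def k_def)
  obtain a where "transform g k F = diag a" "a$1 \<ge> a$2" "a$2 \<ge> a$3" "a$3 > 0"
  proof (rule diagonal_of_maximal[of "transform g k F"])
    fix g' k' :: mat3 assume r': "rotation_matrix g'" "rotation_matrix k'"
    show "?D \<bullet> transform g' k' (transform g k F) \<le> ?D \<bullet> transform g k F"
      unfolding transform_transform using x(2)[of "(g' ** g, k' ** k)"] r r' rotation_mul by (auto simp: g_def k_def)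
  qed (use r det_transform assms in auto)
  then show ?thesis using that r by blast
qed


lemma cubic_from_symmetric:
  fixes A B C :: real
  assumes "A + B + C = 2 * \<alpha> + \<gamma>" "A * B + B * C + C * A = \<alpha>\<^sup>2 + 2 * \<alpha> * \<gamma>" "A * B * C = \<alpha>\<^sup>2 * \<gamma>"
  shows "(x - A) * (x - B) * (x - C) = (x - \<alpha>)\<^sup>2 * (x - \<gamma>)"
proof -
  have "(x - A) * (x - B) * (x - C) = x^3 - (A + B + C) * x\<^sup>2 + (A * B + B * C + C * A) * x - A * B * C"
    by (simp add: algebra_simps power2_eq_square power3_eq_cube)
  also have "\<dots> = (x - \<alpha>)\<^sup>2 * (x - \<gamma>)"
    unfolding assms(1-3) by (simp add: algebra_simps power2_eq_square power3_eq_cube)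
  finally show ?thesis .
qed

lemma sorted_roots_unique:
  fixes A B C :: real
  assumes "A + B + C = 2 * \<alpha> + \<gamma>" "A * B + B * C + C * A = \<alpha>\<^sup>2 + 2 * \<alpha> * \<gamma>" "A * B * C = \<alpha>\<^sup>2 * \<gamma>"
    and o: "A \<ge> B" "B \<ge> C" "\<alpha> > \<gamma>"
  shows "A = \<alpha>" "B = \<alpha>" "C = \<gamma>"
proof -
  have p: "(x - A) * (x - B) * (x - C) = (x - \<alpha>)\<^sup>2 * (x - \<gamma>)" for x
    by (rule cubic_from_symmetric[OF assms(1-3)])
  have "A = \<alpha> \<or> A = \<gamma>" "B = \<alpha> \<or> B = \<gamma>" "C = \<alpha> \<or> C = \<gamma>"
    using p[of A] p[of B] p[of C] by auto
  then show "A = \<alpha>" "B = \<alpha>" "C = \<gamma>" using assms(1) o by auto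
qed

lemma tendsto_transform:
  assumes "(g \<longlongrightarrow> g0) X" "(k \<longlongrightarrow> k0) X" "(F \<longlongrightarrow> F0) X"
  shows "((\<lambda>n. transform (g n) (k n) (F n)) \<longlongrightarrow> transform g0 k0 F0) X"
  unfolding transform_def
  by (intro bounded_bilinear.tendsto[OF bounded_bilinear_matmul] bounded_linear.tendsto[OF bounded_linear_transpose3] assms)

text \<open>The squares of the ordered semiaxes are the roots of a cubic determined by the invariants \<open>I1\<close>, \<open>I2\<close> and
\<open>det\<close>. A pair of rotations fixing the spheroid maps the symmetry axis to itself, so the momentum
keeps a nonzero rotation about that axis.\<close>

lemma spheroid_transform:
  assumes g: "rotation_matrix g" and k: "rotation_matrix k"
    and ac: "\<alpha> > \<gamma>" "\<gamma> > 0" and d: "\<alpha>\<^sup>2 * \<gamma> = 1"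
    and T: "transform g k (diag (vector [\<alpha>, \<alpha>, \<gamma>])) = diag a"
    and o: "a$1 \<ge> a$2" "a$2 \<ge> a$3" "a$3 \<ge> 0"
  shows "a = vector [\<alpha>, \<alpha>, \<gamma>]" "transform g k (hat (axis 3 1)) $ 1 $ 2 \<noteq> 0"
proof -
  let ?v = "vector [\<alpha>, \<alpha>, \<gamma>] :: real^3"
  have I1: "(a$1)\<^sup>2 + (a$2)\<^sup>2 + (a$3)\<^sup>2 = 2 * \<alpha>\<^sup>2 + \<gamma>\<^sup>2"
    using I1_transform[OF g k, of "diag ?v"] unfolding T I1_diag by simp
  have I2: "(a$1)\<^sup>2 * (a$2)\<^sup>2 + (a$2)\<^sup>2 * (a$3)\<^sup>2 + (a$3)\<^sup>2 * (a$1)\<^sup>2 = (\<alpha>\<^sup>2)\<^sup>2 + 2 * \<alpha>\<^sup>2 * \<gamma>\<^sup>2"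
    using I2_transform[OF g k, of "diag ?v"] unfolding T I2_diag by (simp add: power2_eq_square)
  have "a$1 * a$2 * a$3 = \<alpha> * \<alpha> * \<gamma>"
    using det_transform[OF g k, of "diag ?v"] unfolding T det_diag3 by simp
  then have I3: "(a$1)\<^sup>2 * (a$2)\<^sup>2 * (a$3)\<^sup>2 = (\<alpha>\<^sup>2)\<^sup>2 * \<gamma>\<^sup>2"
    by (metis power2_eq_square power_mult_distrib)
  have sq: "(a$1)\<^sup>2 = \<alpha>\<^sup>2" "(a$2)\<^sup>2 = \<alpha>\<^sup>2" "(a$3)\<^sup>2 = \<gamma>\<^sup>2"
    by (rule sorted_roots_unique[OF I1 I2 I3]; use o ac in \<open>simp add: power_mono power_strict_mono\<close>)+
  then show av: "a = ?v" using o ac by (simp add: vec_eq_iff forall_3)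
  let ?D = "diag ?v"
  have fx: "transform g k ?D = ?D" using T av by simp
  have J: "hat (axis 3 1) ** ?D = \<alpha> *\<^sub>R hat (axis 3 1)"
    by (simp add: mat3_eq_iff forall_3 matmul_nth hat_nth diag_nth axis_def)
  have "\<alpha> *\<^sub>R transform g k (hat (axis 3 1)) = transform g g (hat (axis 3 1)) ** transform g k ?D"
    unfolding transform_mul[OF g] J by (simp add: transform_scaleR)
  also have "\<dots> = hat (g *v axis 3 1) ** ?D" by (simp add: fx hat_rotate_transform[OF g])
  finally have h: "\<alpha> *\<^sub>R transform g k (hat (axis 3 1)) = hat (g *v axis 3 1) ** ?D" .
  have v3: "(g *v axis 3 1) $ i = g $ i $ 3" for i
    by (simp add: matrix_vector_mult_def axis_def sum_3)
  have "\<alpha> * transform g k (hat (axis 3 1)) $ 1 $ 2 = - g$3$3 * \<alpha>"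
    using arg_cong[OF h, of "\<lambda>M. M $ 1 $ 2"] by (simp add: mul_diag_nth hat_nth v3)
  moreover have "g$3$3 \<noteq> 0"
  proof
    assume z: "g$3$3 = 0"
    have "transform g k ?D ** transpose (transform g k ?D) = transform g g (?D ** transpose ?D)"
      by (simp add: transpose_transform transform_mul[OF k])
    then have e: "transform g g (?D ** ?D) = ?D ** ?D" by (simp add: fx transpose_diag)
    have "(transform g g (?D ** ?D)) $ 3 $ 3 = \<alpha>\<^sup>2 * (g$3$1 * g$3$1 + g$3$2 * g$3$2)"
      unfolding transform_def diag_mul_diag by (simp add: matmul_nth mul_diag_nth transpose_nth diag_nth z power2_eq_square algebra_simps)
    moreover have "g$3$1 * g$3$1 + g$3$2 * g$3$2 = 1"
      using arg_cong[OF rotationD(2)[OF g], of "\<lambda>M. M $ 3 $ 3"] by (simp add: matmul_nth transpose_nth mat1_nth z)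
    ultimately have "\<alpha>\<^sup>2 = \<gamma>\<^sup>2" unfolding e by (simp add: diag_mul_diag diag_nth power2_eq_square)
    then show False using ac by simp
  qed
  ultimately show "transform g k (hat (axis 3 1)) $ 1 $ 2 \<noteq> 0" using ac by auto
qed

text \<open>A sequence of counterexamples would, after passing to a subsequence of convergent rotations,
have a limit that contradicts \<open>spheroid_transform\<close>. The conclusion about the momentum ensures
later that the velocity about the third axis does not vanish.\<close>

lemma singular_values_near_spheroid:
  assumes ac: "\<alpha> > \<gamma>" "\<gamma> > 0" and d: "\<alpha>\<^sup>2 * \<gamma> = 1" and p: "p \<noteq> 0" and eps: "\<epsilon> > 0"
  shows "\<forall>\<^sub>F z in nhds (diag (vector [\<alpha>, \<alpha>, \<gamma>]), p *\<^sub>R hat (axis 3 1)).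
     \<forall>g k a. rotation_matrix g \<longrightarrow> rotation_matrix k \<longrightarrow> transform g k (fst z) = diag a \<longrightarrow>
       a$1 \<ge> a$2 \<longrightarrow> a$2 \<ge> a$3 \<longrightarrow> a$3 > 0 \<longrightarrow>
       \<bar>a$1 - \<alpha>\<bar> < \<epsilon> \<and> \<bar>a$2 - \<alpha>\<bar> < \<epsilon> \<and> \<bar>a$3 - \<gamma>\<bar> < \<epsilon> \<and> transform g k (snd z) $ 1 $ 2 \<noteq> 0"
    (is "\<forall>\<^sub>F z in nhds ?z0. \<forall>g k a. ?good z g k a")
proof (rule ccontr)
  assume "\<not> (\<forall>\<^sub>F z in nhds ?z0. \<forall>g k a. ?good z g k a)"
  then have ex: "\<exists>z g k a. dist z ?z0 < e \<and> \<not> ?good z g k a" if "e > 0" for e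
    using that unfolding eventually_nhds_metric by blast
  have "\<forall>n. \<exists>z g k a. dist z ?z0 < inverse (real (Suc n)) \<and> \<not> ?good z g k a"
    by (rule allI, rule ex) simp
  then obtain z g k a where zz: "\<And>n. dist (z n) ?z0 < inverse (real (Suc n))" "\<And>n. \<not> ?good (z n) (g n) (k n) (a n)"
    by metis
  have zl: "z \<longlonglongrightarrow> ?z0"
  proof (rule metric_tendsto_imp_tendsto[OF LIMSEQ_inverse_real_of_nat])
    show "\<forall>\<^sub>F n in sequentially. dist (z n) ?z0 \<le> dist (inverse (real (Suc n))) 0"
      using zz(1) by (intro always_eventually allI) (simp add: less_imp_le)
  qed
  have rot: "rotation_matrix (g n)" "rotation_matrix (k n)" and Ta: "transform (g n) (k n) (fst (z n)) = diag (a n)"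
    and o: "a n $ 1 \<ge> a n $ 2" "a n $ 2 \<ge> a n $ 3" "a n $ 3 > 0"
    and bad: "\<not> (\<bar>a n$1 - \<alpha>\<bar> < \<epsilon> \<and> \<bar>a n$2 - \<alpha>\<bar> < \<epsilon> \<and> \<bar>a n$3 - \<gamma>\<bar> < \<epsilon> \<and> transform (g n) (k n) (snd (z n)) $ 1 $ 2 \<noteq> 0)" for n
    using zz(2)[of n] by blast+
  have "seq_compact ({g :: mat3. rotation_matrix g} \<times> {g :: mat3. rotation_matrix g})"
    unfolding compact_eq_seq_compact_metric[symmetric] by (intro compact_Times compact_rotations)
  moreover have "\<forall>n. (g n, k n) \<in> {g. rotation_matrix g} \<times> {g. rotation_matrix g}" using rot by auto
  ultimately obtain gk r where gk: "gk \<in> {g. rotation_matrix g} \<times> {g. rotation_matrix g}" "strict_mono r"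
      "((\<lambda>n. (g n, k n)) \<circ> r) \<longlonglongrightarrow> gk"
    by (rule seq_compactE)
  define g0 k0 where "g0 = fst gk" and "k0 = snd gk"
  have r0: "rotation_matrix g0" "rotation_matrix k0" using gk(1) by (auto simp: g0_def k0_def)
  have gl: "(\<lambda>n. g (r n)) \<longlonglongrightarrow> g0" and kl: "(\<lambda>n. k (r n)) \<longlonglongrightarrow> k0"
    using tendsto_fst[OF gk(3)] tendsto_snd[OF gk(3)] by (simp_all add: comp_def g0_def k0_def)
  have zr: "(\<lambda>n. z (r n)) \<longlonglongrightarrow> ?z0" using LIMSEQ_subseq_LIMSEQ[OF zl gk(2)] by (simp add: comp_def)
  have fl: "(\<lambda>n. fst (z (r n))) \<longlonglongrightarrow> diag (vector [\<alpha>, \<alpha>, \<gamma>])" and pl: "(\<lambda>n. snd (z (r n))) \<longlonglongrightarrow> p *\<^sub>R hat (axis 3 1)"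
    using tendsto_fst[OF zr] tendsto_snd[OF zr] by simp_all
  define M where "M = transform g0 k0 (diag (vector [\<alpha>, \<alpha>, \<gamma>]))"
  have dl: "(\<lambda>n. diag (a (r n))) \<longlonglongrightarrow> M"
    using tendsto_transform[OF gl kl fl] unfolding Ta M_def .
  have el: "(\<lambda>n. diag (a (r n)) $ i $ j) \<longlonglongrightarrow> M $ i $ j" for i j
    by (intro tendsto_vec_nth dl)
  define b where "b = (\<chi> i. M $ i $ i)"
  have al: "(\<lambda>n. a (r n) $ i) \<longlonglongrightarrow> b $ i" for i
    using el[of i i] by (simp add: diag_nth b_def)
  have "M $ i $ j = 0" if "i \<noteq> j" for i j
    using el[of i j] that by (simp add: diag_nth LIMSEQ_const_iff)
  then have Mb: "M = diag b" by (auto simp: mat3_eq_iff diag_nth b_def)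
  have ob: "b$1 \<ge> b$2" "b$2 \<ge> b$3" "b$3 \<ge> 0"
  proof -
    have "\<exists>N. \<forall>n\<ge>N. 0 \<le> a (r n) $ 3" using o(3) less_imp_le by blast
    then show "b$3 \<ge> 0" by (rule LIMSEQ_le_const[OF al[of 3]])
  qed (use LIMSEQ_le[OF al[of 2] al[of 1]] LIMSEQ_le[OF al[of 3] al[of 2]] o in auto)
  note sp = spheroid_transform[OF r0 ac d Mb[unfolded M_def] ob]
  have tl: "(\<lambda>n. transform (g (r n)) (k (r n)) (snd (z (r n))) $ 1 $ 2) \<longlonglongrightarrow> transform g0 k0 (p *\<^sub>R hat (axis 3 1)) $ 1 $ 2"
    by (intro tendsto_vec_nth tendsto_transform gl kl pl)
  have t0: "transform g0 k0 (p *\<^sub>R hat (axis 3 1)) $ 1 $ 2 \<noteq> 0" using sp(2) p by (simp add: transform_scaleR)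
  have "\<forall>\<^sub>F n in sequentially. dist (a (r n) $ 1) (b $ 1) < \<epsilon>" "\<forall>\<^sub>F n in sequentially. dist (a (r n) $ 2) (b $ 2) < \<epsilon>"
     "\<forall>\<^sub>F n in sequentially. dist (a (r n) $ 3) (b $ 3) < \<epsilon>"
    using tendstoD[OF al eps] by auto
  moreover have "\<forall>\<^sub>F n in sequentially. transform (g (r n)) (k (r n)) (snd (z (r n))) $ 1 $ 2 \<noteq> 0"
    by (rule tendsto_imp_eventually_ne[OF tl t0])
  ultimately have "\<forall>\<^sub>F n in sequentially. False"
  proof eventually_elim
    case (elim n)
    then show ?case using bad[of "r n"] by (simp add: sp(1) dist_real_def)
  qed
  then show False by simp
qed


section \<open>The balance equations at a diagonal configuration\<close>

text \<open>The diagonal entries of \<open>force ** F\<^sup>T\<close>, where \<open>i\<close> is the index of the entry and \<open>j\<close>, \<open>k\<close> are the other two.\<close>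

definition diag_residual :: "real \<Rightarrow> real \<Rightarrow> real^3 \<Rightarrow> real^3 \<Rightarrow> real^3 \<Rightarrow> 3 \<Rightarrow> 3 \<Rightarrow> 3 \<Rightarrow> real" where
  "diag_residual rho0 grav a L R i j k =
     metric_const rho0 * (2 * a$i * (a$k * L$j * R$j + a$j * L$k * R$k)
        - (a$i)\<^sup>2 * ((L$j)\<^sup>2 + (L$k)\<^sup>2 + (R$j)\<^sup>2 + (R$k)\<^sup>2))
     + R_const rho0 grav * ((a$i)\<^sup>2 * (mom 2 (I1 (diag a)) (I2 (diag a)) 1
        + mom 1 (I1 (diag a)) (I2 (diag a)) 1 * ((a$j)\<^sup>2 + (a$k)\<^sup>2)))"

text \<open>The off-diagonal entry \<open>(i, j)\<close> of \<open>fund \<xi> (fund \<xi> (diag a))\<close>, where \<open>k\<close> is the third index.\<close>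

definition off_residual :: "real^3 \<Rightarrow> real^3 \<Rightarrow> real^3 \<Rightarrow> 3 \<Rightarrow> 3 \<Rightarrow> 3 \<Rightarrow> real" where
  "off_residual a L R i j k = a$j * L$i * L$j - 2 * a$k * L$j * R$i + a$i * R$i * R$j"

lemma grad_pot_diag_nth:
  "grad_pot (diag a) $ i $ j = (if i = j then a$i * (mom 2 (I1 (diag a)) (I2 (diag a)) 1
     + mom 1 (I1 (diag a)) (I2 (diag a)) 1 * (I1 (diag a) - (a$i)\<^sup>2)) else 0)"
proof -
  have "(diag a ** transpose (diag a) ** diag a) $ i $ j = (if i = j then a$i * (a$i)\<^sup>2 else 0)"
    by (simp add: transpose_diag mul_diag_nth diag_nth power2_eq_square)
  then show ?thesis unfolding grad_pot_def by (simp add: diag_nth algebra_simps)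
qed

lemma fund_fund_diag_off:
  fixes a L R
  defines "X \<equiv> fund (L, R) (fund (L, R) (diag a))"
  shows "X$1$2 = off_residual a L R 1 2 3" "X$2$1 = off_residual a L R 2 1 3"
    "X$1$3 = off_residual a L R 1 3 2" "X$3$1 = off_residual a L R 3 1 2"
    "X$2$3 = off_residual a L R 2 3 1" "X$3$2 = off_residual a L R 3 2 1"
  unfolding X_def off_residual_def
  by (simp_all add: fund_def matmul_nth hat_nth diag_nth algebra_simps)

lemma fund_fund_diag_diag:
  fixes a L R
  defines "X \<equiv> fund (L, R) (fund (L, R) (diag a))"
  shows "X$1$1 = 2 * (a$3 * L$2 * R$2 + a$2 * L$3 * R$3) - a$1 * ((L$2)\<^sup>2 + (L$3)\<^sup>2 + (R$2)\<^sup>2 + (R$3)\<^sup>2)"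
    "X$2$2 = 2 * (a$3 * L$1 * R$1 + a$1 * L$3 * R$3) - a$2 * ((L$1)\<^sup>2 + (L$3)\<^sup>2 + (R$1)\<^sup>2 + (R$3)\<^sup>2)"
    "X$3$3 = 2 * (a$2 * L$1 * R$1 + a$1 * L$2 * R$2) - a$3 * ((L$1)\<^sup>2 + (L$2)\<^sup>2 + (R$1)\<^sup>2 + (R$2)\<^sup>2)"
  unfolding X_def
  by (simp_all add: fund_def matmul_nth hat_nth diag_nth algebra_simps power2_eq_square)

lemma force_diag_mul:
  fixes rho0 grav a L R
  defines "Y \<equiv> force rho0 grav (diag a) (L, R) ** transpose (diag a)"
  shows "Y$1$2 = metric_const rho0 * off_residual a L R 1 2 3 * a$2" "Y$2$1 = metric_const rho0 * off_residual a L R 2 1 3 * a$1"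
    "Y$1$3 = metric_const rho0 * off_residual a L R 1 3 2 * a$3" "Y$3$1 = metric_const rho0 * off_residual a L R 3 1 2 * a$1"
    "Y$2$3 = metric_const rho0 * off_residual a L R 2 3 1 * a$3" "Y$3$2 = metric_const rho0 * off_residual a L R 3 2 1 * a$2"
    "Y$1$1 = diag_residual rho0 grav a L R 1 2 3" "Y$2$2 = diag_residual rho0 grav a L R 2 1 3" "Y$3$3 = diag_residual rho0 grav a L R 3 1 2"
  unfolding Y_def force_def transpose_diag mul_diag_nth diag_residual_def
    by (simp_all add: fund_fund_diag_off fund_fund_diag_diag grad_pot_diag_nth I1_diag)
       (simp_all add: algebra_simps power2_eq_square)

lemma balanced_diag_iff:
  assumes pos: "\<And>i. a $ i > 0" and rho: "rho0 > 0"
  shows "balanced rho0 grav (diag a) (L, R) \<longleftrightarrow>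
    off_residual a L R 1 2 3 = 0 \<and> off_residual a L R 2 1 3 = 0 \<and> off_residual a L R 1 3 2 = 0 \<and>
    off_residual a L R 3 1 2 = 0 \<and> off_residual a L R 2 3 1 = 0 \<and> off_residual a L R 3 2 1 = 0 \<and>
    diag_residual rho0 grav a L R 1 2 3 = diag_residual rho0 grav a L R 3 1 2 \<and>
    diag_residual rho0 grav a L R 2 1 3 = diag_residual rho0 grav a L R 3 1 2"
proof -
  have T: "metric_const rho0 \<noteq> 0" using rho by (simp add: metric_const_def)
  have p: "a$1 \<noteq> 0" "a$2 \<noteq> 0" "a$3 \<noteq> 0" using pos[of 1] pos[of 2] pos[of 3] by auto
  have scalar: "(\<exists>l. Y = l *\<^sub>R mat 1) \<longleftrightarrow> Y$1$2 = 0 \<and> Y$2$1 = 0 \<and> Y$1$3 = 0 \<and> Y$3$1 = 0 \<and> Y$2$3 = 0 \<and> Y$3$2 = 0 \<and> Y$1$1 = Y$3$3 \<and> Y$2$2 = Y$3$3"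
    for Y :: mat3
    by (auto simp: mat3_eq_iff forall_3 mat1_nth)
  show ?thesis unfolding balanced_def scalar force_diag_mul using T p by simp
qed

text \<open>By \<open>mom_scale\<close> with \<open>t = \<tau>\<close>, the moments of an ellipsoid of determinant 1 are powers of \<open>\<tau>\<close> times
those of the similar ellipsoid with \<open>a\<^sub>1 a\<^sub>2 = 1\<close>.\<close>

lemma det_one_scaling:
  fixes a :: "real^3"
  assumes pos: "\<And>i. a $ i > 0" and det: "a$1 * a$2 * a$3 = 1"
  defines "\<tau> \<equiv> a$1 * a$2"
  defines "\<kappa> \<equiv> (a$3)\<^sup>2 / \<tau>" and "\<sigma> \<equiv> ((a$1)\<^sup>2 + (a$2)\<^sup>2) / \<tau>"
  shows "\<tau> > 0" "\<kappa> > 0" "\<sigma> \<ge> 2" "(a$3)\<^sup>2 = \<tau> * \<kappa>" "(a$1)\<^sup>2 + (a$2)\<^sup>2 = \<tau> * \<sigma>" "(a$1)\<^sup>2 * (a$2)\<^sup>2 = \<tau>\<^sup>2" "\<tau>^3 * \<kappa> = 1"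
    "j \<le> 2 \<Longrightarrow> mom j (I1 (diag a)) (I2 (diag a)) 1 = \<tau>^(j + 1) / (\<tau>^3 * sqrt (\<tau>^3)) * nmom j \<sigma> \<kappa>"
proof -
  show t: "\<tau> > 0" unfolding \<tau>_def using pos[of 1] pos[of 2] by simp
  then show k: "\<kappa> > 0" unfolding \<kappa>_def using pos[of 3] by simp
  have "(a$1 - a$2)\<^sup>2 \<ge> 0" by simp
  then have "2 * \<tau> \<le> (a$1)\<^sup>2 + (a$2)\<^sup>2" unfolding \<tau>_def by (simp add: power2_diff mult.assoc)
  then show s: "\<sigma> \<ge> 2" unfolding \<sigma>_def using t by (simp add: pos_le_divide_eq)
  show C: "(a$3)\<^sup>2 = \<tau> * \<kappa>" and AB: "(a$1)\<^sup>2 + (a$2)\<^sup>2 = \<tau> * \<sigma>" unfolding \<kappa>_def \<sigma>_def using t by simp_all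
  show P: "(a$1)\<^sup>2 * (a$2)\<^sup>2 = \<tau>\<^sup>2" unfolding \<tau>_def by (simp add: power_mult_distrib)
  have "\<tau>^3 * \<kappa> = \<tau>\<^sup>2 * (a$3)\<^sup>2" unfolding C by (simp add: power2_eq_square power3_eq_cube)
  also have "\<dots> = (\<tau> * a$3)\<^sup>2" by (simp add: power_mult_distrib)
  also have "\<dots> = 1" using det by (simp add: \<tau>_def)
  finally show tk: "\<tau>^3 * \<kappa> = 1" .
  have i1: "I1 (diag a) = \<tau> * (\<sigma> + \<kappa>)" unfolding I1_diag using C AB by (simp add: algebra_simps)
  have "I2 (diag a) = (a$1)\<^sup>2 * (a$2)\<^sup>2 + (a$3)\<^sup>2 * ((a$1)\<^sup>2 + (a$2)\<^sup>2)" unfolding I2_diag by (simp add: algebra_simps)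
  then have i2: "I2 (diag a) = \<tau>\<^sup>2 * (1 + \<sigma> * \<kappa>)" unfolding P C AB by (simp add: algebra_simps power2_eq_square)
  show "mom j (I1 (diag a)) (I2 (diag a)) 1 = \<tau>^(j + 1) / (\<tau>^3 * sqrt (\<tau>^3)) * nmom j \<sigma> \<kappa>" if "j \<le> 2"
    unfolding i1 i2 tk[symmetric] nmom_def using t s k that by (intro mom_scale) auto
qed

text \<open>The factor by which squared rotation rates differ from their dimensionless values.\<close>

definition vel_scale :: "real \<Rightarrow> real \<Rightarrow> real \<Rightarrow> real" where
  "vel_scale rho0 grav \<tau> = R_const rho0 grav / (metric_const rho0 * sqrt (\<tau>^3))"

text \<open>For \<open>a\<^sub>1 \<noteq> a\<^sub>2\<close> the two diagonal equations determine \<open>l\<^sup>2 + m\<^sup>2\<close> and \<open>l m\<close> separately, and sum and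
difference of the two give \<open>(l + m)\<^sup>2\<close> and \<open>(l - m)\<^sup>2\<close>. For \<open>a\<^sub>1 = a\<^sub>2\<close> the two equations coincide
and only \<open>l - m\<close> is determined, since rotation about the symmetry axis of a spheroid on both
sides does nothing.\<close>

lemma type_S_balanced_iff:
  fixes rho0 grav :: real and a :: "real^3"
  assumes pos: "\<And>i. a $ i > 0" and det: "a$1 * a$2 * a$3 = 1" and rho: "rho0 > 0"
  defines "\<tau> \<equiv> a$1 * a$2"
  defines "\<kappa> \<equiv> (a$3)\<^sup>2 / \<tau>" and "\<sigma> \<equiv> ((a$1)\<^sup>2 + (a$2)\<^sup>2) / \<tau>"
  defines "c \<equiv> vel_scale rho0 grav \<tau>"
  shows "a$1 \<noteq> a$2 \<Longrightarrow> balanced rho0 grav (diag a) (l *\<^sub>R axis 3 1, m *\<^sub>R axis 3 1) \<longleftrightarrow>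
      (l + m)\<^sup>2 = c * crit 1 \<sigma> \<kappa> \<and> (l - m)\<^sup>2 = c * (crit 1 \<sigma> \<kappa> - 2 * crit 0 \<sigma> \<kappa>)"
    and "a$1 = a$2 \<Longrightarrow> balanced rho0 grav (diag a) (l *\<^sub>R axis 3 1, m *\<^sub>R axis 3 1) \<longleftrightarrow>
      (l - m)\<^sup>2 = c * (1 - \<kappa>) * (nmom 1 2 \<kappa> + nmom 2 2 \<kappa>)"
proof -
  note sc = det_one_scaling[OF pos det, folded \<tau>_def, folded \<kappa>_def \<sigma>_def]
  define T G where "T = metric_const rho0" and "G = R_const rho0 grav"
  define m1 m2 where "m1 = mom 1 (I1 (diag a)) (I2 (diag a)) 1" and "m2 = mom 2 (I1 (diag a)) (I2 (diag a)) 1"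
  define n1 n2 where "n1 = nmom 1 \<sigma> \<kappa>" and "n2 = nmom 2 \<sigma> \<kappa>"
  define q where "q = sqrt (\<tau>^3)"
  have T: "T > 0" using rho by (simp add: T_def metric_const_def)
  have q: "q > 0" using sc(1) by (simp add: q_def)
  have m1: "m1 = n1 / (\<tau> * q)" using sc(8)[of 1] sc(1) q unfolding m1_def n1_def q_def[symmetric]
    by (simp add: field_simps eval_nat_numeral)
  have m2: "m2 = n2 / q" using sc(8)[of 2] sc(1) q unfolding m2_def n2_def q_def[symmetric]
    by (simp add: field_simps eval_nat_numeral)
  have cT: "c = G / (T * q)" by (simp add: c_def vel_scale_def G_def T_def q_def)
  define A B C where "A = (a$1)\<^sup>2" and "B = (a$2)\<^sup>2" and "C = (a$3)\<^sup>2"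
  have ABC: "C = \<tau> * \<kappa>" "A + B = \<tau> * \<sigma>" "A * B = \<tau>\<^sup>2" using sc(4,5,6) by (simp_all add: A_def B_def C_def)
  define d1 d2 d3 where "d1 = T * (2 * \<tau> * l * m - A * (l\<^sup>2 + m\<^sup>2)) + G * (A * (m2 + m1 * (B + C)))"
    and "d2 = T * (2 * \<tau> * l * m - B * (l\<^sup>2 + m\<^sup>2)) + G * (B * (m2 + m1 * (A + C)))"
    and "d3 = G * (C * (m2 + m1 * (A + B)))"
  have bal: "balanced rho0 grav (diag a) (l *\<^sub>R axis 3 1, m *\<^sub>R axis 3 1) \<longleftrightarrow> d1 = d3 \<and> d2 = d3"
    unfolding balanced_diag_iff[OF pos rho] off_residual_def diag_residual_def d1_def d2_def d3_def
      T_def[symmetric] G_def[symmetric] m1_def[symmetric] m2_def[symmetric] A_def B_def C_def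
    by (simp add: axis_def \<tau>_def mult_ac)
  have c1: "T * \<tau> * (c * crit 1 \<sigma> \<kappa>) = G * ((\<tau> * C + C * (A + B) - A * B) * m1 + (\<tau> + C) * m2)"
    unfolding crit_def n1_def[symmetric] n2_def[symmetric] cT ABC m1 m2 using T q sc(1)
    by (simp add: field_simps power2_eq_square)
  have c0: "T * \<tau> * (c * crit 0 \<sigma> \<kappa>) = G * ((C * (A + B) - A * B) * m1 + C * m2)"
    unfolding crit_def n1_def[symmetric] n2_def[symmetric] cT ABC m1 m2 using T q sc(1)
    by (simp add: field_simps power2_eq_square)
  have Tt: "T * \<tau> > 0" using T sc(1) by simp
  show "balanced rho0 grav (diag a) (l *\<^sub>R axis 3 1, m *\<^sub>R axis 3 1) \<longleftrightarrow>
      (l + m)\<^sup>2 = c * crit 1 \<sigma> \<kappa> \<and> (l - m)\<^sup>2 = c * (crit 1 \<sigma> \<kappa> - 2 * crit 0 \<sigma> \<kappa>)" if ne: "a$1 \<noteq> a$2"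
  proof -
    have AB: "A - B \<noteq> 0" using ne pos[of 1] pos[of 2] by (simp add: A_def B_def)
    have e1: "d1 - d2 = (A - B) * (G * (m2 + C * m1) - T * (l\<^sup>2 + m\<^sup>2))"
      unfolding d1_def d2_def by (simp add: algebra_simps)
    have e2: "d1 - d3 = A * (G * (m2 + C * m1) - T * (l\<^sup>2 + m\<^sup>2)) + (2 * T * \<tau> * l * m - G * ((C * (A + B) - A * B) * m1 + C * m2))"
      unfolding d1_def d3_def by (simp add: algebra_simps)
    have "d1 = d3 \<and> d2 = d3 \<longleftrightarrow> d1 - d2 = 0 \<and> d1 - d3 = 0" by auto
    also have "\<dots> \<longleftrightarrow> G * (m2 + C * m1) = T * (l\<^sup>2 + m\<^sup>2) \<and> 2 * T * \<tau> * l * m = G * ((C * (A + B) - A * B) * m1 + C * m2)"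
      unfolding e1 e2 using AB by auto
    also have "\<dots> \<longleftrightarrow> T * \<tau> * (l + m)\<^sup>2 = T * \<tau> * (c * crit 1 \<sigma> \<kappa>) \<and> T * \<tau> * (l - m)\<^sup>2 = T * \<tau> * (c * (crit 1 \<sigma> \<kappa> - 2 * crit 0 \<sigma> \<kappa>))"
    proof -
      define u v where "u = T * (l\<^sup>2 + m\<^sup>2)" and "v = 2 * T * \<tau> * l * m"
      define X Y where "X = G * (m2 + C * m1)" and "Y = G * ((C * (A + B) - A * B) * m1 + C * m2)"
      have p: "T * \<tau> * (l + m)\<^sup>2 = \<tau> * u + v" "T * \<tau> * (l - m)\<^sup>2 = \<tau> * u - v"
        by (simp_all add: u_def v_def power2_eq_square algebra_simps)
      have c1': "T * \<tau> * (c * crit 1 \<sigma> \<kappa>) = \<tau> * X + Y"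
        unfolding c1 X_def Y_def by (simp add: algebra_simps)
      have c2': "T * \<tau> * (c * (crit 1 \<sigma> \<kappa> - 2 * crit 0 \<sigma> \<kappa>)) = \<tau> * X - Y"
        using c1' c0 unfolding Y_def[symmetric] by (simp add: algebra_simps)
      have "X = u \<and> v = Y \<longleftrightarrow> \<tau> * u + v = \<tau> * X + Y \<and> \<tau> * u - v = \<tau> * X - Y"
      proof
        assume h: "\<tau> * u + v = \<tau> * X + Y \<and> \<tau> * u - v = \<tau> * X - Y"
        then have "\<tau> * u = \<tau> * X" "v = Y" by linarith+
        then show "X = u \<and> v = Y" using sc(1) by simp
      qed simp
      then show ?thesis unfolding p c1' c2' u_def v_def X_def Y_def .
    qed
    also have "\<dots> \<longleftrightarrow> (l + m)\<^sup>2 = c * crit 1 \<sigma> \<kappa> \<and> (l - m)\<^sup>2 = c * (crit 1 \<sigma> \<kappa> - 2 * crit 0 \<sigma> \<kappa>)"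
      using Tt by (simp only: mult_cancel_left) auto
    finally show ?thesis unfolding bal .
  qed
  show "balanced rho0 grav (diag a) (l *\<^sub>R axis 3 1, m *\<^sub>R axis 3 1) \<longleftrightarrow>
      (l - m)\<^sup>2 = c * (1 - \<kappa>) * (nmom 1 2 \<kappa> + nmom 2 2 \<kappa>)" if eq: "a$1 = a$2"
  proof -
    have s2: "\<sigma> = 2" unfolding \<sigma>_def \<tau>_def eq using pos[of 2] by (simp add: power2_eq_square)
    have At: "A = \<tau>" "B = \<tau>" unfolding A_def B_def \<tau>_def eq by (simp_all add: power2_eq_square)
    have "d1 = d3 \<and> d2 = d3 \<longleftrightarrow> d1 - d3 = 0" unfolding d1_def d2_def At by auto
    also have "d1 - d3 = T * \<tau> * (c * (1 - \<kappa>) * (n1 + n2) - (l - m)\<^sup>2)"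
      unfolding d1_def d3_def At ABC(1) cT m1 m2 using T q sc(1)
      by (simp add: field_simps power2_eq_square)
    also have "\<dots> = 0 \<longleftrightarrow> (l - m)\<^sup>2 = c * (1 - \<kappa>) * (n1 + n2)" using Tt by auto
    finally show ?thesis unfolding bal n1_def n2_def s2 .
  qed
qed


section \<open>MacLaurin spheroids and bifurcating paths\<close>

abbreviation ax1 :: "real^3" where "ax1 \<equiv> axis 1 1"
abbreviation ax2 :: "real^3" where "ax2 \<equiv> axis 2 1"
abbreviation ax3 :: "real^3" where "ax3 \<equiv> axis 3 1"

definition semi :: "real \<Rightarrow> real \<Rightarrow> real \<Rightarrow> real^3" where
  "semi p q r = p *\<^sub>R ax1 + q *\<^sub>R ax2 + r *\<^sub>R ax3"

lemma semi_nth [simp]: "semi p q r $ 1 = p" "semi p q r $ 2 = q" "semi p q r $ 3 = r"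
  by (simp_all add: semi_def axis_def)

lemma semi_vector: "vector [p, q, r] = semi p q r"
  by (simp add: vec_eq_iff forall_3)

lemma semi_pos: "p > 0 \<Longrightarrow> q > 0 \<Longrightarrow> r > 0 \<Longrightarrow> semi p q r $ i > 0"
  using exhaust_3[of i] by auto

lemma pos_all3: "(a::real^3)$1 > 0 \<Longrightarrow> a$2 > 0 \<Longrightarrow> a$3 > 0 \<Longrightarrow> a $ i > 0"
  using exhaust_3[of i] by auto

lemma inj_nth3: "(a::real^3)$1 \<noteq> a$2 \<Longrightarrow> a$2 \<noteq> a$3 \<Longrightarrow> a$1 \<noteq> a$3 \<Longrightarrow> inj (($) a)"
  unfolding inj_def using exhaust_3 by metis

text \<open>The state that moves with velocity \<open>xi\<close>, as determined by \<open>rel_equilibrium_vel_iff\<close>.\<close>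

definition eq_state :: "real \<Rightarrow> real^3 \<Rightarrow> velocity \<Rightarrow> phase" where
  "eq_state rho0 a xi = (diag a, metric_const rho0 *\<^sub>R fund xi (diag a))"

lemma rel_equilibrium_eq_state:
  assumes "rho0 > 0" "a$1 * a$2 * a$3 = 1"
  shows "rel_equilibrium_vel rho0 grav (eq_state rho0 a xi) xi \<longleftrightarrow> balanced rho0 grav (diag a) xi"
  unfolding eq_state_def rel_equilibrium_vel_iff[OF assms(1)] using assms(2) by (simp add: det_diag3)

lemma ellipsoid_withI:
  assumes "rho0 > 0" "a$1 * a$2 * a$3 = 1" "balanced rho0 grav (diag a) xi"
    and "\<And>i. a $ i > 0" "inj (($) a)" "Q a xi"
  shows "ellipsoid_with rho0 grav Q (eq_state rho0 a xi)"
proof -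
  have "card (range (\<lambda>i. a $ i)) = 3" using card_image[OF assms(5)] by simp
  moreover have "rel_equilibrium_vel rho0 grav (eq_state rho0 a xi) xi"
    using rel_equilibrium_eq_state[OF assms(1,2)] assms(3) by simp
  ultimately show ?thesis unfolding ellipsoid_with_def eq_state_def using self_mem_orbit assms(4,6) by blast
qed

text \<open>The coordinates in which the MacLaurin spheroid of eccentricity \<open>e\<close> is used below. Its angular velocity is written with the
moments, as in \<open>type_S_balanced_iff\<close>, instead of \<open>arcsin e\<close>.\<close>

definition maclaurin_axes :: "real \<Rightarrow> real \<Rightarrow> real \<Rightarrow> real \<Rightarrow> real \<Rightarrow> bool" where
  "maclaurin_axes rho0 grav e \<alpha> \<gamma> \<longleftrightarrow>
     \<alpha> > \<gamma> \<and> \<gamma> > 0 \<and> \<alpha>\<^sup>2 * \<gamma> = 1 \<and> \<gamma>\<^sup>2 / \<alpha>\<^sup>2 = 1 - e\<^sup>2 \<and>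
     maclaurin rho0 grav e =
       (diag (semi \<alpha> \<alpha> \<gamma>), (metric_const rho0 * maclaurin_Omega rho0 grav e * \<alpha>) *\<^sub>R hat ax3) \<and>
     (maclaurin_Omega rho0 grav e)\<^sup>2 =
       vel_scale rho0 grav (\<alpha> * \<alpha>) * e\<^sup>2 * (nmom 1 2 (1 - e\<^sup>2) + nmom 2 2 (1 - e\<^sup>2))"

lemma maclaurin_axesD:
  assumes "maclaurin_axes rho0 grav e \<alpha> \<gamma>"
  shows "\<alpha> > \<gamma>" "\<gamma> > 0" "\<alpha>\<^sup>2 * \<gamma> = 1" "\<gamma>\<^sup>2 / \<alpha>\<^sup>2 = 1 - e\<^sup>2"
    "maclaurin rho0 grav e =
       (diag (semi \<alpha> \<alpha> \<gamma>), (metric_const rho0 * maclaurin_Omega rho0 grav e * \<alpha>) *\<^sub>R hat ax3)"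
    "(maclaurin_Omega rho0 grav e)\<^sup>2 =
       vel_scale rho0 grav (\<alpha> * \<alpha>) * e\<^sup>2 * (nmom 1 2 (1 - e\<^sup>2) + nmom 2 2 (1 - e\<^sup>2))"
  using assms unfolding maclaurin_axes_def by blast+

lemma maclaurin_axes_exist:
  assumes e: "0 < e" "e < 1" and pos: "rho0 > 0" "grav > 0"
  obtains \<alpha> \<gamma> where "maclaurin_axes rho0 grav e \<alpha> \<gamma>"
proof -
  define \<kappa> where "\<kappa> = 1 - e\<^sup>2"
  have k: "0 < \<kappa>" "\<kappa> < 1" using e by (auto simp: \<kappa>_def power_less_one_iff)
  define \<alpha> where "\<alpha> = \<kappa> powr (-1/6)"
  define \<gamma> where "\<gamma> = \<kappa> powr (1/3)"
  have g0: "\<gamma> > 0" and a0: "\<alpha> > 0" using k by (auto simp: \<alpha>_def \<gamma>_def)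
  have a2: "\<alpha>\<^sup>2 = \<kappa> powr (-1/3)" unfolding \<alpha>_def using k by (simp add: powr_power)
  have c2: "\<gamma>\<^sup>2 = \<kappa> powr (2/3)" unfolding \<gamma>_def using k by (simp add: powr_power)
  have d: "\<alpha>\<^sup>2 * \<gamma> = 1" unfolding a2 \<gamma>_def using k by (simp add: powr_add[symmetric])
  have kap: "\<gamma>\<^sup>2 / \<alpha>\<^sup>2 = \<kappa>" unfolding a2 c2 using k by (simp add: powr_diff[symmetric])
  have "\<gamma>\<^sup>2 = \<kappa> * \<alpha>\<^sup>2" using kap a0 by (simp add: field_simps)
  then have "\<gamma>\<^sup>2 < \<alpha>\<^sup>2" using k a0 by simp
  then have ac: "\<alpha> > \<gamma>" using a0 by (simp add: power2_less_imp_less)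
  have cfg: "maclaurin_config e = diag (semi \<alpha> \<alpha> \<gamma>)"
    unfolding maclaurin_config_def semi_vector \<kappa>_def[symmetric] \<alpha>_def \<gamma>_def by simp
  have f: "fund (maclaurin_vel rho0 grav e) (diag (semi \<alpha> \<alpha> \<gamma>)) = (maclaurin_Omega rho0 grav e * \<alpha>) *\<^sub>R hat ax3"
    unfolding maclaurin_vel_def by (simp add: mat3_eq_iff forall_3 fund_diag_nth hat_nth axis_def)
  have m: "maclaurin rho0 grav e = (diag (semi \<alpha> \<alpha> \<gamma>), (metric_const rho0 * maclaurin_Omega rho0 grav e * \<alpha>) *\<^sub>R hat ax3)"
    unfolding maclaurin_def cfg f by (simp add: mult.assoc)
  have "(\<alpha>\<^sup>2)^3 = inverse \<kappa>" unfolding a2 using powr_power[of \<kappa> "-1/3" 3] k by (simp add: powr_minus)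
  then have sq: "sqrt ((\<alpha> * \<alpha>)^3) = inverse (sqrt \<kappa>)" by (simp add: power2_eq_square real_sqrt_inverse)
  have "metric_const rho0 \<noteq> 0" using pos by (simp add: metric_const_def)
  have vs: "vel_scale rho0 grav (\<alpha> * \<alpha>) = 2 * pi * rho0 * grav * sqrt \<kappa>"
    unfolding vel_scale_def sq R_const_def metric_const_def using pos
    by (simp add: field_simps power2_eq_square)
  have "(maclaurin_Omega rho0 grav e)\<^sup>2 = vel_scale rho0 grav (\<alpha> * \<alpha>) * e\<^sup>2 * (nmom 1 2 (1 - e\<^sup>2) + nmom 2 2 (1 - e\<^sup>2))"
    unfolding vs maclaurin_Omega_eq(1)[OF e pos] \<kappa>_def by simp
  with ac g0 d kap[unfolded \<kappa>_def] m have "maclaurin_axes rho0 grav e \<alpha> \<gamma>"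
    unfolding maclaurin_axes_def by blast
  then show ?thesis by (rule that)
qed

text \<open>The invariants \<open>I1\<close>, \<open>I2\<close>, \<open>det\<close> determine the squared semiaxes as roots of a cubic, and for a
spheroid this cubic has a double root.\<close>

lemma distinct_not_maclaurin:
  assumes pos: "\<And>i. a $ i > 0" and dist: "inj (($) a)" and rg: "rho0 > 0" "grav > 0"
  shows "(diag a, P) \<notin> maclaurin_family rho0 grav"
proof
  assume "(diag a, P) \<in> maclaurin_family rho0 grav"
  then obtain e where e: "0 < e" "e < 1" and o: "(diag a, P) \<in> sym_orbit (maclaurin rho0 grav e)"
    by (auto simp: maclaurin_family_def)
  obtain \<alpha> \<gamma> where ax: "maclaurin_axes rho0 grav e \<alpha> \<gamma>"
    by (rule maclaurin_axes_exist[OF e rg])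
  note m = maclaurin_axesD(5)[OF ax]
  obtain y where y: "y \<in> carrier sym_group" "(diag a, P) = act y (maclaurin rho0 grav e)"
    using o unfolding orbit_def by blast
  obtain t g k where tgk: "y = (t, g, k)" by (cases y) auto
  have x: "rotation_matrix g" "rotation_matrix k" using y(1) by (simp_all add: sym_group_def tgk)
  have A: "act (t, g, k) (diag (semi \<alpha> \<alpha> \<gamma>), (metric_const rho0 * maclaurin_Omega rho0 grav e * \<alpha>) *\<^sub>R hat ax3) = (diag a, P)"
    using y(2) unfolding m tgk by simp
  obtain g' k' where r: "rotation_matrix g'" "rotation_matrix k'" and T: "transform g' k' (diag (semi \<alpha> \<alpha> \<gamma>)) = diag a"
  proof (cases t)
    case True
    then have "transform k g (diag (semi \<alpha> \<alpha> \<gamma>)) = diag a" using A by (simp add: transform_def transpose_diag)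
    then show ?thesis using that x by blast
  next
    case False
    then have "transform g k (diag (semi \<alpha> \<alpha> \<gamma>)) = diag a" using A by (simp add: transform_def)
    then show ?thesis using that x by blast
  qed
  define A B C where "A = (a$1)\<^sup>2" and "B = (a$2)\<^sup>2" and "C = (a$3)\<^sup>2"
  have I1: "A + B + C = 2 * \<alpha>\<^sup>2 + \<gamma>\<^sup>2"
    using I1_transform[OF r, of "diag (semi \<alpha> \<alpha> \<gamma>)"] unfolding T I1_diag A_def B_def C_def by simp
  have I2: "A * B + B * C + C * A = (\<alpha>\<^sup>2)\<^sup>2 + 2 * \<alpha>\<^sup>2 * \<gamma>\<^sup>2"
    using I2_transform[OF r, of "diag (semi \<alpha> \<alpha> \<gamma>)"] unfolding T I2_diag A_def B_def C_def by (simp add: power2_eq_square)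
  have "a$1 * a$2 * a$3 = \<alpha> * \<alpha> * \<gamma>"
    using det_transform[OF r, of "diag (semi \<alpha> \<alpha> \<gamma>)"] unfolding T det_diag3 by simp
  then have "(a$1 * a$2 * a$3)\<^sup>2 = (\<alpha> * \<alpha> * \<gamma>)\<^sup>2" by simp
  then have I3: "A * B * C = (\<alpha>\<^sup>2)\<^sup>2 * \<gamma>\<^sup>2"
    unfolding A_def B_def C_def power_mult_distrib by (simp add: power2_eq_square)
  have p: "(x - A) * (x - B) * (x - C) = (x - \<alpha>\<^sup>2)\<^sup>2 * (x - \<gamma>\<^sup>2)" for x
    by (rule cubic_from_symmetric[OF I1 I2 I3])
  have "A = \<alpha>\<^sup>2 \<or> A = \<gamma>\<^sup>2" "B = \<alpha>\<^sup>2 \<or> B = \<gamma>\<^sup>2" "C = \<alpha>\<^sup>2 \<or> C = \<gamma>\<^sup>2"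
    using p[of A] p[of B] p[of C] by auto
  then have "A = B \<or> B = C \<or> A = C" by auto
  then have "a$1 = a$2 \<or> a$2 = a$3 \<or> a$1 = a$3"
    unfolding A_def B_def C_def using pos[of 1] pos[of 2] pos[of 3] by (simp add: power2_eq_iff_nonneg)
  then show False using injD[OF dist, of 1 2] injD[OF dist, of 2 3] injD[OF dist, of 1 3] by auto
qed

lemma continuous_on_diag:
  assumes "continuous_on S a"
  shows "continuous_on S (\<lambda>t. diag (a t))"
proof -
  have "bounded_linear diag"
    unfolding linear_conv_bounded_linear[symmetric]
    by (auto intro!: linearI simp: mat3_eq_iff diag_nth)
  then show ?thesis using assms by (rule bounded_linear.continuous_on)
qed

lemma continuous_on_fund:
  assumes "continuous_on S L" "continuous_on S R" "continuous_on S F"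
  shows "continuous_on S (\<lambda>t. fund (L t, R t) (F t))"
proof -
  have "bounded_linear hat"
    unfolding linear_conv_bounded_linear[symmetric]
    by (auto intro!: linearI simp: mat3_eq_iff forall_3 hat_nth)
  then have h: "continuous_on S (\<lambda>t. hat (L t))" "continuous_on S (\<lambda>t. hat (R t))"
    by (rule bounded_linear.continuous_on[OF _ assms(1)], rule bounded_linear.continuous_on[OF _ assms(2)])
  show ?thesis unfolding fund_def fst_conv snd_conv
    by (intro continuous_on_diff bounded_bilinear.continuous_on[OF bounded_bilinear_matmul] h assms)
qed

text \<open>The family depends on \<open>norm v\<close> only, so its limit at 0 is the starting point of the path. Points of
the path stay outside the MacLaurin family because their semiaxes are distinct.\<close>

lemma bifurcating_family_from_path:
  fixes a L R :: "real \<Rightarrow> real^3"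
  assumes rg: "rho0 > 0" "grav > 0" and eps: "\<epsilon> > 0"
    and cont: "continuous_on {0..<\<epsilon>} a" "continuous_on {0..<\<epsilon>} L" "continuous_on {0..<\<epsilon>} R"
    and start: "eq_state rho0 (a 0) (L 0, R 0) = maclaurin rho0 grav e"
    and path: "\<And>t. 0 < t \<Longrightarrow> t < \<epsilon> \<Longrightarrow> (\<forall>i. a t $ i > 0) \<and> inj (($) (a t)) \<and> a t $ 1 * a t $ 2 * a t $ 3 = 1 \<and>
        balanced rho0 grav (diag (a t)) (L t, R t) \<and> Q (eq_state rho0 (a t) (L t, R t))"
  shows "bifurcating_family rho0 grav e Q (\<lambda>v::'v::real_normed_vector. eq_state rho0 (a (norm v)) (L (norm v), R (norm v)))"
    (is "bifurcating_family _ _ _ _ ?f")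
  unfolding bifurcating_family_def
proof (intro conjI exI[of _ \<epsilon>] ballI)
  let ?z = "\<lambda>t. eq_state rho0 (a t) (L t, R t)"
  have zc: "continuous_on {0..<\<epsilon>} ?z"
    unfolding eq_state_def
    by (intro continuous_on_Pair continuous_on_scaleR continuous_on_const continuous_on_fund continuous_on_diag cont)
  have fc: "continuous_on (ball (0::'v) \<epsilon>) ?f"
    by (rule continuous_on_compose2[OF zc continuous_on_norm[OF continuous_on_id]]) auto
  show "continuous_on (ball 0 \<epsilon> - {0}) ?f" by (rule continuous_on_subset[OF fc]) auto
  have "isCont ?f 0" using fc eps by (simp add: continuous_on_eq_continuous_at)
  then show "(?f \<longlongrightarrow> maclaurin rho0 grav e) (at 0)" using start by (simp add: isCont_def)
  fix v :: 'v assume "v \<in> ball 0 \<epsilon> - {0}"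
  then have v: "0 < norm v" "norm v < \<epsilon>" by auto
  note p = path[OF v]
  show "rel_equilibrium rho0 grav (?f v)"
    unfolding rel_equilibrium_def using rel_equilibrium_eq_state[OF rg(1), of "a (norm v)"] p by blast
  show "?f v \<notin> maclaurin_family rho0 grav"
    unfolding eq_state_def using p rg by (intro distinct_not_maclaurin) auto
  show "Q (?f v)" using p by blast
qed (rule eps)


section \<open>Type I ellipsoids\<close>

lemma positive_near_zero:
  fixes f :: "real \<Rightarrow> real"
  assumes "continuous_on {0..<e} f" "e > 0" "f 0 > 0"
  obtains d where "0 < d" "d \<le> e" "\<And>t. t \<in> {0..<d} \<Longrightarrow> f t > 0"
proof -
  have "(f \<longlongrightarrow> f 0) (at 0 within {0..<e})" using assms unfolding continuous_on_def by auto
  then have "\<forall>\<^sub>F t in at 0 within {0..<e}. f t > 0" using assms(3) order_tendstoD(1) by blast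
  then obtain d where d: "d > 0" "\<And>t. t \<in> {0..<e} \<Longrightarrow> t \<noteq> 0 \<Longrightarrow> dist t 0 < d \<Longrightarrow> f t > 0"
    unfolding eventually_at by blast
  have "f t > 0" if "t \<in> {0..<min d e}" for t
    using d(2)[of t] that assms(3) by (cases "t = 0") auto
  then show ?thesis using that[of "min d e"] d(1) assms(2) by auto
qed

lemma continuous_on_semi [continuous_intros]:
  "continuous_on S p \<Longrightarrow> continuous_on S q \<Longrightarrow> continuous_on S r \<Longrightarrow> continuous_on S (\<lambda>t. semi (p t) (q t) (r t))"
  unfolding semi_def by (intro continuous_intros)

text \<open>Here \<open>u\<close> and \<open>v\<close> are the ratios of the left to the right component along the first and the third axis.
The off-diagonal equations depend only on these ratios and lead to a quadratic equation for each. The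
products of left and right components are scaled to \<open>\<xi>\<close> (first axis) and \<open>\<eta>\<close> (third axis). By
the quadratic equations the sums of squares of left and right components are then also linear in
\<open>\<xi>\<close> and \<open>\<eta>\<close>, so the two diagonal equations become the linear equations \<open>I\<close> and \<open>II\<close>.\<close>

lemma type_I_balanced:
  fixes a b c u v r1 r3 \<eta> \<xi> :: real
  assumes pos: "a > 0" "b > 0" "c > 0" "u > 0" "v > 0" and rho: "rho0 > 0"
  defines "m1 \<equiv> mom 1 (I1 (diag (semi a b c))) (I2 (diag (semi a b c))) 1"
    and "m2 \<equiv> mom 2 (I1 (diag (semi a b c))) (I2 (diag (semi a b c))) 1"
  assumes v: "2 * a * b * (v\<^sup>2 + 1) = (a\<^sup>2 + 4 * b\<^sup>2 - c\<^sup>2) * v" and u: "c * u * v = 2 * b * v - a"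
    and I: "a\<^sup>2 * \<eta> + c\<^sup>2 * \<xi> = R_const rho0 grav * (m2 + b\<^sup>2 * m1)"
    and II: "\<xi> * b\<^sup>2 * (4 * b\<^sup>2 - 3 * c\<^sup>2 - a\<^sup>2) =
      (a\<^sup>2 - b\<^sup>2) * (\<eta> * (a\<^sup>2 + 4 * b\<^sup>2 - c\<^sup>2) - R_const rho0 grav * (m2 + c\<^sup>2 * m1))"
    and r3: "metric_const rho0 * r3\<^sup>2 * v = 2 * a * b * \<eta>" and r1: "metric_const rho0 * r1\<^sup>2 * u = 2 * b * c * \<xi>"
  shows "balanced rho0 grav (diag (semi a b c)) (semi (u * r1) 0 (v * r3), semi r1 0 r3)"
proof -
  define T G where "T = metric_const rho0" and "G = R_const rho0 grav"
  have p: "semi a b c $ i > 0" for i using pos by (intro semi_pos)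
  have ii: "a * u * v + c = 2 * b * u"
  proof -
    have "c * v * (a * u * v + c - 2 * b * u) = (c * u * v) * (a * v - 2 * b) + c\<^sup>2 * v"
      by (simp add: algebra_simps power2_eq_square)
    also have "\<dots> = (2 * a * b * (v\<^sup>2 + 1) - (a\<^sup>2 + 4 * b\<^sup>2 - c\<^sup>2) * v)"
      unfolding u by (simp add: algebra_simps power2_eq_square)
    also have "\<dots> = 0" using v by simp
    finally show ?thesis using pos by simp
  qed
  have hu: "2 * b * c * (u\<^sup>2 + 1) = (4 * b\<^sup>2 + c\<^sup>2 - a\<^sup>2) * u"
  proof -
    have "a * (2 * b * c * (u\<^sup>2 + 1) - (4 * b\<^sup>2 + c\<^sup>2 - a\<^sup>2) * u) = 0"
    proof -
      have "c * u * (a * u * v) = a * u * (c * u * v)" by (simp add: mult_ac)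
      also have "\<dots> = a * u * (2 * b * v - a)" unfolding u ..
      also have "\<dots> = 2 * b * (a * u * v) - a\<^sup>2 * u" by (simp add: algebra_simps power2_eq_square)
      finally have "c * u * (a * u * v) = 2 * b * (a * u * v) - a\<^sup>2 * u" .
      moreover have "a * u * v = 2 * b * u - c" using ii by simp
      ultimately have "c * u * (2 * b * u - c) + a\<^sup>2 * u = 2 * b * (2 * b * u - c)" by simp
      then show ?thesis by (simp add: algebra_simps power2_eq_square)
    qed
    then show ?thesis using pos by simp
  qed
  have Y: "T * (v * r3) * r3 = 2 * a * b * \<eta>" using r3 by (simp add: T_def power2_eq_square mult_ac)
  have X: "T * (u * r1) * r1 = 2 * b * c * \<xi>" using r1 by (simp add: T_def power2_eq_square mult_ac)
  have Ys: "T * ((v * r3)\<^sup>2 + r3\<^sup>2) = \<eta> * (a\<^sup>2 + 4 * b\<^sup>2 - c\<^sup>2)"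
  proof -
    have "v * (2 * a * b) * (T * ((v * r3)\<^sup>2 + r3\<^sup>2)) = (T * r3\<^sup>2 * v) * (2 * a * b * (v\<^sup>2 + 1))"
      by (simp add: algebra_simps power2_eq_square)
    also have "\<dots> = v * (2 * a * b) * (\<eta> * (a\<^sup>2 + 4 * b\<^sup>2 - c\<^sup>2))"
      unfolding v using r3 by (simp add: T_def)
    finally show ?thesis using pos by simp
  qed
  have Xs: "T * ((u * r1)\<^sup>2 + r1\<^sup>2) = \<xi> * (4 * b\<^sup>2 + c\<^sup>2 - a\<^sup>2)"
  proof -
    have "u * (2 * b * c) * (T * ((u * r1)\<^sup>2 + r1\<^sup>2)) = (T * r1\<^sup>2 * u) * (2 * b * c * (u\<^sup>2 + 1))"
      by (simp add: algebra_simps power2_eq_square)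
    also have "\<dots> = u * (2 * b * c) * (\<xi> * (4 * b\<^sup>2 + c\<^sup>2 - a\<^sup>2))"
      unfolding hu using r1 by (simp add: T_def)
    finally show ?thesis using pos by simp
  qed
  define A B C where "A = a\<^sup>2" and "B = b\<^sup>2" and "C = c\<^sup>2"
  let ?a = "semi a b c" and ?L = "semi (u * r1) 0 (v * r3)" and ?R = "semi r1 0 r3"
  have d1: "diag_residual rho0 grav ?a ?L ?R 1 2 3 = - A * \<eta> * (A - C) + G * (A * (m2 + m1 * (B + C)))"
  proof -
    have "diag_residual rho0 grav ?a ?L ?R 1 2 3 = 2 * a * b * (T * (v * r3) * r3) - A * (T * ((v * r3)\<^sup>2 + r3\<^sup>2)) + G * (A * (m2 + m1 * (B + C)))"
      unfolding diag_residual_def T_def[symmetric] G_def[symmetric] m1_def[symmetric] m2_def[symmetric] A_def B_def C_def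
      by (simp add: algebra_simps)
    then show ?thesis unfolding Y Ys A_def B_def C_def by (simp add: algebra_simps power2_eq_square)
  qed
  have d3: "diag_residual rho0 grav ?a ?L ?R 3 1 2 = C * \<xi> * (A - C) + G * (C * (m2 + m1 * (A + B)))"
  proof -
    have "diag_residual rho0 grav ?a ?L ?R 3 1 2 = 2 * c * b * (T * (u * r1) * r1) - C * (T * ((u * r1)\<^sup>2 + r1\<^sup>2)) + G * (C * (m2 + m1 * (A + B)))"
      unfolding diag_residual_def T_def[symmetric] G_def[symmetric] m1_def[symmetric] m2_def[symmetric] A_def B_def C_def
      by (simp add: algebra_simps)
    then show ?thesis unfolding X Xs A_def B_def C_def by (simp add: algebra_simps power2_eq_square)
  qed
  have d2: "diag_residual rho0 grav ?a ?L ?R 2 1 3 = 4 * B * (C * \<xi> + A * \<eta>) - B * (\<xi> * (4 * B + C - A) + \<eta> * (A + 4 * B - C)) + G * (B * (m2 + m1 * (A + C)))"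
  proof -
    have "diag_residual rho0 grav ?a ?L ?R 2 1 3 = 2 * b * (c * (T * (u * r1) * r1) + a * (T * (v * r3) * r3)) - B * (T * ((u * r1)\<^sup>2 + r1\<^sup>2) + T * ((v * r3)\<^sup>2 + r3\<^sup>2)) + G * (B * (m2 + m1 * (A + C)))"
      unfolding diag_residual_def T_def[symmetric] G_def[symmetric] m1_def[symmetric] m2_def[symmetric] A_def B_def C_def
      by (simp add: algebra_simps)
    then show ?thesis unfolding X Y Xs Ys A_def B_def C_def by (simp add: algebra_simps power2_eq_square)
  qed
  have I': "A * \<eta> + C * \<xi> = G * (m2 + B * m1)" using I by (simp add: A_def B_def C_def G_def)
  have II': "\<xi> * B * (4 * B - 3 * C - A) = (A - B) * (\<eta> * (A + 4 * B - C) - G * (m2 + C * m1))"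
    using II by (simp add: A_def B_def C_def G_def)
  have e13: "diag_residual rho0 grav ?a ?L ?R 1 2 3 - diag_residual rho0 grav ?a ?L ?R 3 1 2 = (A - C) * (G * (m2 + B * m1) - (A * \<eta> + C * \<xi>))"
    unfolding d1 d3 by (simp add: algebra_simps)
  have e12: "diag_residual rho0 grav ?a ?L ?R 1 2 3 - diag_residual rho0 grav ?a ?L ?R 2 1 3 = \<xi> * B * (4 * B - 3 * C - A) - (A - B) * (\<eta> * (A + 4 * B - C) - G * (m2 + C * m1))"
    unfolding d1 d2 by (simp add: algebra_simps)
  have "off_residual ?a ?L ?R 1 3 2 = r1 * r3 * (c * u * v - (2 * b * v - a))" "off_residual ?a ?L ?R 3 1 2 = r1 * r3 * (a * u * v + c - 2 * b * u)"
    by (simp_all add: off_residual_def algebra_simps)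
  then have off: "off_residual ?a ?L ?R 1 3 2 = 0" "off_residual ?a ?L ?R 3 1 2 = 0" using u ii by simp_all
  have off': "off_residual ?a ?L ?R 1 2 3 = 0" "off_residual ?a ?L ?R 2 1 3 = 0" "off_residual ?a ?L ?R 2 3 1 = 0" "off_residual ?a ?L ?R 3 2 1 = 0"
    by (simp_all add: off_residual_def)
  show ?thesis unfolding balanced_diag_iff[OF p rho] using off off' e13 e12 I' II' by simp
qed

lemma continuous_on_mom_diag:
  assumes "continuous_on S a" "j \<le> 2"
  shows "continuous_on S (\<lambda>t. mom j (I1 (diag (a t))) (I2 (diag (a t))) 1)"
proof -
  have "continuous_on S (\<lambda>t. (I1 (diag (a t)), I2 (diag (a t)), 1::real))"
    unfolding I1_diag I2_diag by (intro continuous_intros assms)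
  moreover have "(\<lambda>t. (I1 (diag (a t)), I2 (diag (a t)), 1::real)) ` S \<subseteq> {0..} \<times> {0..} \<times> {0<..}"
    by (auto simp: I1_inner I2_cof)
  ultimately have "continuous_on S (\<lambda>t. (\<lambda>z. mom j (fst z) (fst (snd z)) (snd (snd z))) (I1 (diag (a t)), I2 (diag (a t)), 1))"
    by (rule continuous_on_compose2[OF continuous_on_mom[OF assms(2)]])
  then show ?thesis by simp
qed

text \<open>A common axial rotation of both factors does not move a spheroid, so the branch may arrive with
any \<open>l\<close> and \<open>k\<close> whose difference is the MacLaurin angular velocity.\<close>

lemma spheroid_start:
  assumes e: "0 < e" "e < 1" and rg: "rho0 > 0" "grav > 0"
    and ax: "maclaurin_axes rho0 grav e \<alpha> \<gamma>"
    and bal: "balanced rho0 grav (diag (semi \<alpha> \<alpha> \<gamma>)) (l *\<^sub>R ax3, k *\<^sub>R ax3)" and lk: "l > k"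
  shows "eq_state rho0 (semi \<alpha> \<alpha> \<gamma>) (l *\<^sub>R ax3, k *\<^sub>R ax3) = maclaurin rho0 grav e"
proof -
  note al = maclaurin_axesD(1-4)[OF ax] and m = maclaurin_axesD(5)[OF ax] and Om = maclaurin_axesD(6)[OF ax]
  have p: "semi \<alpha> \<alpha> \<gamma> $ i > 0" for i using al by (intro semi_pos) auto
  have d: "semi \<alpha> \<alpha> \<gamma> $ 1 * semi \<alpha> \<alpha> \<gamma> $ 2 * semi \<alpha> \<alpha> \<gamma> $ 3 = 1" using al(3) by (simp add: power2_eq_square)
  have k: "\<gamma>\<^sup>2 / (\<alpha> * \<alpha>) = 1 - e\<^sup>2" using al(4) by (simp add: power2_eq_square)
  have "(l - k)\<^sup>2 = (maclaurin_Omega rho0 grav e)\<^sup>2"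
    using type_S_balanced_iff(2)[OF p d rg(1), of grav l k] bal unfolding Om by (simp add: k)
  then have "l - k = maclaurin_Omega rho0 grav e"
    using lk maclaurin_Omega_eq(2)[OF e rg] by (simp add: power2_eq_iff_nonneg less_imp_le)
  then have "fund (l *\<^sub>R ax3, k *\<^sub>R ax3) (diag (semi \<alpha> \<alpha> \<gamma>)) = (maclaurin_Omega rho0 grav e * \<alpha>) *\<^sub>R hat ax3"
    by (simp add: mat3_eq_iff forall_3 fund_diag_nth hat_nth axis_def algebra_simps)
  then show ?thesis unfolding eq_state_def m by (simp add: mult.assoc)
qed

lemma span_axis_two: "x \<in> span {axis i (1::real), axis j 1 :: real^3} \<longleftrightarrow> (\<exists>p q. x = p *\<^sub>R axis i 1 + q *\<^sub>R axis j 1)"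
  by (auto simp: span_insert span_singleton algebra_simps eq_diff_eq)

lemma span_axis_one: "x \<in> span {axis i (1::real) :: real^3} \<longleftrightarrow> (\<exists>p. x = p *\<^sub>R axis i 1)"
  by (auto simp: span_singleton)

lemma type_I_in_plane:
  fixes L R a :: "real^3"
  assumes ijk: "{i, j, k} = UNIV" "i \<noteq> j" "i \<noteq> k" "j \<noteq> k" and z: "L$k = 0" "R$k = 0"
    and nz: "L$i \<noteq> 0 \<or> R$i \<noteq> 0" "L$j \<noteq> 0 \<or> R$j \<noteq> 0" and ge: "a$k \<ge> (a$i + a$j) / 2"
  shows "type_I a (L, R)"
  unfolding type_I_def
proof
  show "\<not> type_S a (L, R)"
  proof
    assume "type_S a (L, R)"
    then obtain n p q where "L = p *\<^sub>R axis n 1" "R = q *\<^sub>R axis n 1" unfolding type_S_def span_axis_one by auto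
    then show False using nz ijk(2) by (auto simp: axis_def split: if_splits)
  qed
  have in_plane: "V \<in> span {axis i 1, axis j 1}" if "V$k = 0" for V :: "real^3"
  proof -
    have "V = V$i *\<^sub>R axis i 1 + V$j *\<^sub>R axis j 1"
    proof (rule vec_eq_iff[THEN iffD2], rule allI)
      fix n
      have "n = i \<or> n = j \<or> n = k" using ijk(1) by blast
      then show "V $ n = (V$i *\<^sub>R axis i 1 + V$j *\<^sub>R axis j 1) $ n"
        using that ijk(2-4) by (elim disjE) (simp_all add: axis_def)
    qed
    then show ?thesis unfolding span_axis_two by blast
  qed
  show "\<exists>i j k. {i, j, k} = UNIV \<and> fst (L, R) \<in> span {axis i 1, axis j 1} \<and>
      snd (L, R) \<in> span {axis i 1, axis j 1} \<and> (a $ i + a $ j) / 2 \<le> a $ k"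
    using ijk(1) in_plane z ge by (intro exI[of _ i] exI[of _ j] exI[of _ k]) simp
qed

text \<open>Along the configurations with semiaxes \<open>\<alpha> sqrt (1 + t)\<close>, \<open>\<alpha> / sqrt (1 + t)\<close>, \<open>\<gamma>\<close> the
equations of \<open>type_I_balanced\<close> are solved explicitly. At \<open>t = 0\<close> the solution has \<open>\<xi> = 0\<close>, a
velocity along the third axis, and for \<open>t > 0\<close> it has \<open>\<xi> > 0\<close>, so that the
velocity tilts into the plane of the first and third axes. The conditions used are open and hold at the spheroid.\<close>

lemma type_I_bifurcation:
  assumes e: "0 < e" "e < 1" and rg: "rho0 > 0" "grav > 0"
  shows "\<exists>f :: 'v::real_normed_vector \<Rightarrow> phase. bifurcating_family rho0 grav e
          (\<lambda>z. isotropy z = {\<one>\<^bsub>sym_group\<^esub>} \<and> ellipsoid_with rho0 grav type_I z) f"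
proof -
  obtain \<alpha> \<gamma> where ax: "maclaurin_axes rho0 grav e \<alpha> \<gamma>"
    by (rule maclaurin_axes_exist[OF e rg])
  note al = maclaurin_axesD(1-4)[OF ax]
  define T G where "T = metric_const rho0" and "G = R_const rho0 grav"
  have TG: "T > 0" "G > 0" using rg by (auto simp: T_def G_def metric_const_def R_const_def)
  have a0: "\<alpha> > 0" using al by simp
  define p where "p t = \<alpha> * sqrt (1 + t)" for t
  define q where "q t = \<alpha> / sqrt (1 + t)" for t
  define a where "a t = semi (p t) (q t) \<gamma>" for t
  have pq: "p t > 0" "q t > 0" "p t * q t = \<alpha>\<^sup>2" if "t \<ge> 0" for t
    using a0 that by (auto simp: p_def q_def power2_eq_square)
  have pq0: "p 0 = \<alpha>" "q 0 = \<alpha>" by (simp_all add: p_def q_def)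
  have lt: "q t < p t" if "t > 0" for t
  proof -
    have "q t < \<alpha>" "\<alpha> < p t" using that a0 by (simp_all add: p_def q_def divide_less_eq)
    then show ?thesis by simp
  qed
  have le: "q t \<le> p t" if "t \<ge> 0" for t using lt[of t] that pq0 by (cases "t = 0") auto
  have ca: "continuous_on {0..<1} p" "continuous_on {0..<1} q"
    unfolding p_def q_def by (intro continuous_intros; auto)+
  have caa: "continuous_on {0..<1} a" unfolding a_def by (intro continuous_intros ca)
  define m1 where "m1 t = mom 1 (I1 (diag (a t))) (I2 (diag (a t))) 1" for t
  define m2 where "m2 t = mom 2 (I1 (diag (a t))) (I2 (diag (a t))) 1" for t
  have cm: "continuous_on {0..<1} m1" "continuous_on {0..<1} m2"
    unfolding m1_def m2_def by (intro continuous_on_mom_diag caa; simp)+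
  have mp: "m1 t > 0" "m2 t > 0" for t
    unfolding m1_def m2_def by (rule mom_pos; simp add: I1_inner I2_cof)+
  have c1: "continuous_on {0..<1} (\<lambda>t. 2 * q t - p t - \<gamma>)" by (intro continuous_intros ca)
  obtain e1 where e1: "0 < e1" "e1 \<le> 1" "\<And>t. t \<in> {0..<e1} \<Longrightarrow> 2 * q t - p t - \<gamma> > 0"
    by (rule positive_near_zero[OF c1]) (use al in \<open>auto simp: pq0\<close>)
  have c2: "continuous_on {0..<1} (\<lambda>t. 4 * (q t)\<^sup>2 - 3 * \<gamma>\<^sup>2 - (p t)\<^sup>2)" by (intro continuous_intros ca)
  have "\<gamma>\<^sup>2 < \<alpha>\<^sup>2" using al by (simp add: power_strict_mono)
  then obtain e2 where e2: "0 < e2" "e2 \<le> 1" "\<And>t. t \<in> {0..<e2} \<Longrightarrow> 4 * (q t)\<^sup>2 - 3 * \<gamma>\<^sup>2 - (p t)\<^sup>2 > 0"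
    by (rule_tac positive_near_zero[OF c2]) (auto simp: pq0)
  define e3 where "e3 = min e1 e2"
  have e3: "0 < e3" "e3 \<le> 1" using e1 e2 by (auto simp: e3_def)
  have h1: "2 * q t > p t + \<gamma>" and h2: "4 * (q t)\<^sup>2 > 3 * \<gamma>\<^sup>2 + (p t)\<^sup>2" if "t \<in> {0..<e3}" for t
    using e1(3)[of t] e2(3)[of t] that by (auto simp: e3_def)
  define E where "E t = (p t)\<^sup>2 + 4 * (q t)\<^sup>2 - \<gamma>\<^sup>2" for t
  \<comment> \<open>\<open>\<xi>\<close> and \<open>\<eta>\<close> solve the linear system of \<open>type_I_balanced\<close> by elimination of \<open>\<eta>\<close>; \<open>D\<close> is its determinant\<close>
  define N where "N t = (m2 t + (q t)\<^sup>2 * m1 t) * E t - (p t)\<^sup>2 * (m2 t + \<gamma>\<^sup>2 * m1 t)" for t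
  define D where "D t = (q t)\<^sup>2 * (p t)\<^sup>2 * (4 * (q t)\<^sup>2 - 3 * \<gamma>\<^sup>2 - (p t)\<^sup>2) + \<gamma>\<^sup>2 * (((p t)\<^sup>2 - (q t)\<^sup>2) * E t)" for t
  define \<xi> where "\<xi> t = ((p t)\<^sup>2 - (q t)\<^sup>2) * G * N t / D t" for t
  define \<eta> where "\<eta> t = (G * (m2 t + (q t)\<^sup>2 * m1 t) - \<gamma>\<^sup>2 * \<xi> t) / (p t)\<^sup>2" for t
  \<comment> \<open>\<open>v\<close> is the root larger than 1 of \<open>v\<^sup>2 - 2 s v + 1 = 0\<close>; at \<open>t = 0\<close> this choice gives the positive sense of rotation\<close>
  define s where "s t = E t / (4 * p t * q t)" for t
  define v where "v t = s t + sqrt ((s t)\<^sup>2 - 1)" for t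
  define u where "u t = (2 * q t * v t - p t) / (\<gamma> * v t)" for t
  have sg: "(q t)\<^sup>2 > \<gamma>\<^sup>2" "(q t)\<^sup>2 \<le> (p t)\<^sup>2" "E t > (p t)\<^sup>2" if t: "t \<in> {0..<e3}" for t
  proof -
    have l: "q t \<le> p t" "p t > 0" "q t > 0" using le[of t] pq[of t] t by auto
    then have "q t > \<gamma>" using h1[OF t] by linarith
    then show g: "(q t)\<^sup>2 > \<gamma>\<^sup>2" using al(2) by (simp add: power_strict_mono)
    show "(q t)\<^sup>2 \<le> (p t)\<^sup>2" using l by (simp add: power_mono)
    show "E t > (p t)\<^sup>2" using g zero_le_power2[of "q t"] unfolding E_def by linarith
  qed
  have Np: "N t > 0" if t: "t \<in> {0..<e3}" for t
  proof -
    have "(p t)\<^sup>2 * (m2 t + \<gamma>\<^sup>2 * m1 t) < (m2 t + (q t)\<^sup>2 * m1 t) * E t"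
    proof -
      have x: "m2 t + \<gamma>\<^sup>2 * m1 t < m2 t + (q t)\<^sup>2 * m1 t" using sg[OF t] mp by simp
      have y: "m2 t + \<gamma>\<^sup>2 * m1 t > 0" using mp[of t] al by (simp add: add_pos_pos)
      have z: "E t > (p t)\<^sup>2" "(p t)\<^sup>2 > 0" using sg[OF t] pq[of t] t by auto
      have "(m2 t + \<gamma>\<^sup>2 * m1 t) * (p t)\<^sup>2 < (m2 t + (q t)\<^sup>2 * m1 t) * E t"
        using x y z by (intro mult_strict_mono) auto
      then show ?thesis by (simp add: mult.commute)
    qed
    then show ?thesis unfolding N_def by simp
  qed
  have Dp: "D t > 0" if t: "t \<in> {0..<e3}" for t
  proof -
    have "(q t)\<^sup>2 * (p t)\<^sup>2 * (4 * (q t)\<^sup>2 - 3 * \<gamma>\<^sup>2 - (p t)\<^sup>2) > 0" using h2[OF t] pq[of t] t by simp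
    moreover have "E t \<ge> 0" using sg(3)[OF t] zero_le_power2[of "p t"] by linarith
    then have "\<gamma>\<^sup>2 * (((p t)\<^sup>2 - (q t)\<^sup>2) * E t) \<ge> 0" using sg(2)[OF t] by simp
    ultimately show ?thesis unfolding D_def by simp
  qed
  have ca3: "continuous_on {0..<e3} p" "continuous_on {0..<e3} q" "continuous_on {0..<e3} m1" "continuous_on {0..<e3} m2" "continuous_on {0..<e3} a"
    using e3 by (auto intro: continuous_on_subset[OF ca(1)] continuous_on_subset[OF ca(2)] continuous_on_subset[OF cm(1)] continuous_on_subset[OF cm(2)] continuous_on_subset[OF caa])
  have nz: "p t \<noteq> 0" "q t \<noteq> 0" "D t \<noteq> 0" if "t \<in> {0..<e3}" for t using pq[of t] Dp[OF that] that by auto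
  have cE: "continuous_on {0..<e3} E" unfolding E_def by (intro continuous_intros ca3)
  have cN: "continuous_on {0..<e3} N" unfolding N_def by (intro continuous_intros ca3 cE)
  have cD: "continuous_on {0..<e3} D" unfolding D_def by (intro continuous_intros ca3 cE)
  have cx: "continuous_on {0..<e3} \<xi>" unfolding \<xi>_def using nz by (intro continuous_intros ca3 cN cD) auto
  have cy: "continuous_on {0..<e3} \<eta>" unfolding \<eta>_def using nz by (intro continuous_intros ca3 cx) auto
  have cs: "continuous_on {0..<e3} s" unfolding s_def using nz by (intro continuous_intros ca3 cE) auto
  have cv: "continuous_on {0..<e3} v" unfolding v_def by (intro continuous_intros cs)
  have s1: "s t > 1" if t: "t \<in> {0..<e3}" for t
  proof -
    have "(2 * q t - p t)\<^sup>2 > \<gamma>\<^sup>2" using h1[OF t] al(2) by (intro power_strict_mono) auto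
    then have "E t > 4 * p t * q t" unfolding E_def by (simp add: power2_eq_square algebra_simps)
    then show ?thesis unfolding s_def using pq[of t] t by (simp add: less_divide_eq)
  qed
  have v1: "v t > 1" and vq: "(v t)\<^sup>2 + 1 = 2 * s t * v t" if t: "t \<in> {0..<e3}" for t
  proof -
    have "(s t)\<^sup>2 \<ge> 1" using s1[OF t] by (simp add: one_le_power)
    then have r: "sqrt ((s t)\<^sup>2 - 1) \<ge> 0" "(sqrt ((s t)\<^sup>2 - 1))\<^sup>2 = (s t)\<^sup>2 - 1" by simp_all
    then show "v t > 1" using s1[OF t] unfolding v_def by linarith
    have "(v t)\<^sup>2 = (s t)\<^sup>2 + 2 * s t * sqrt ((s t)\<^sup>2 - 1) + ((s t)\<^sup>2 - 1)"
      unfolding v_def power2_sum r(2) by simp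
    then show "(v t)\<^sup>2 + 1 = 2 * s t * v t" unfolding v_def by (simp add: algebra_simps power2_eq_square)
  qed
  have u0: "u t > 0" if t: "t \<in> {0..<e3}" for t
  proof -
    have "2 * q t * 1 < 2 * q t * v t" using v1[OF t] pq[of t] t by (intro mult_strict_left_mono) auto
    then have "2 * q t * v t - p t > 0" using h1[OF t] al(2) by linarith
    then show ?thesis unfolding u_def using v1[OF t] al(2) by simp
  qed
  have cu: "continuous_on {0..<e3} u" unfolding u_def using v1 al(2)
    by (intro continuous_intros ca3 cv) force
  have y0: "\<eta> 0 > 0"
  proof -
    have "\<xi> 0 = 0" by (simp add: \<xi>_def pq0)
    then show ?thesis unfolding \<eta>_def using TG mp[of 0] a0 by (simp add: pq0 add_pos_pos)
  qed
  obtain e4 where e4: "0 < e4" "e4 \<le> e3" "\<And>t. t \<in> {0..<e4} \<Longrightarrow> \<eta> t > 0"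
    by (rule positive_near_zero[OF cy e3(1) y0]) blast
  define r3 where "r3 t = sqrt (2 * p t * q t * \<eta> t / (T * v t))" for t
  define r1 where "r1 t = sqrt (2 * q t * \<gamma> * \<xi> t / (T * u t))" for t
  define L where "L t = semi (u t * r1 t) 0 (v t * r3 t)" for t
  define R where "R t = semi (r1 t) 0 (r3 t)" for t
  have sub: "{0..<e4} \<subseteq> {0..<e3}" using e4 by auto
  have c4: "continuous_on {0..<e4} p" "continuous_on {0..<e4} q" "continuous_on {0..<e4} u" "continuous_on {0..<e4} v" "continuous_on {0..<e4} \<eta>" "continuous_on {0..<e4} \<xi>" "continuous_on {0..<e4} a"
    using ca3 cu cv cy cx continuous_on_subset sub by blast+
  have cr: "continuous_on {0..<e4} r3" "continuous_on {0..<e4} r1"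
  proof -
    have "T * v t \<noteq> 0" "T * u t \<noteq> 0" if "t \<in> {0..<e4}" for t
      using v1[of t] u0[of t] TG that sub by auto
    then show "continuous_on {0..<e4} r3" "continuous_on {0..<e4} r1"
      unfolding r3_def r1_def by (intro continuous_intros c4; auto)+
  qed
  have cL: "continuous_on {0..<e4} L" "continuous_on {0..<e4} R"
    unfolding L_def R_def by (intro continuous_intros c4 cr)+
  have bal: "balanced rho0 grav (diag (a t)) (L t, R t)" if t: "t \<in> {0..<e4}" for t
  proof -
    have t3: "t \<in> {0..<e3}" using t sub by auto
    have pp: "p t > 0" "q t > 0" using pq[of t] t by auto
    have xp: "\<xi> t \<ge> 0" unfolding \<xi>_def using sg(2)[OF t3] TG Np[OF t3] Dp[OF t3] by simp
    have I: "(p t)\<^sup>2 * \<eta> t + \<gamma>\<^sup>2 * \<xi> t = G * (m2 t + (q t)\<^sup>2 * m1 t)"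
      unfolding \<eta>_def using pp by simp
    have "(p t)\<^sup>2 * (\<xi> t * (q t)\<^sup>2 * (4 * (q t)\<^sup>2 - 3 * \<gamma>\<^sup>2 - (p t)\<^sup>2)) = (p t)\<^sup>2 * (((p t)\<^sup>2 - (q t)\<^sup>2) * (\<eta> t * E t - G * (m2 t + \<gamma>\<^sup>2 * m1 t)))"
    proof -
      have "(p t)\<^sup>2 * (\<xi> t * (q t)\<^sup>2 * (4 * (q t)\<^sup>2 - 3 * \<gamma>\<^sup>2 - (p t)\<^sup>2)) = \<xi> t * D t - \<gamma>\<^sup>2 * \<xi> t * (((p t)\<^sup>2 - (q t)\<^sup>2) * E t)"
        unfolding D_def by (simp add: algebra_simps)
      also have "\<xi> t * D t = ((p t)\<^sup>2 - (q t)\<^sup>2) * G * N t" unfolding \<xi>_def using Dp[OF t3] by simp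
      also have "\<gamma>\<^sup>2 * \<xi> t = G * (m2 t + (q t)\<^sup>2 * m1 t) - (p t)\<^sup>2 * \<eta> t" using I by simp
      also have "((p t)\<^sup>2 - (q t)\<^sup>2) * G * N t - (G * (m2 t + (q t)\<^sup>2 * m1 t) - (p t)\<^sup>2 * \<eta> t) * (((p t)\<^sup>2 - (q t)\<^sup>2) * E t)
          = (p t)\<^sup>2 * (((p t)\<^sup>2 - (q t)\<^sup>2) * (\<eta> t * E t - G * (m2 t + \<gamma>\<^sup>2 * m1 t)))"
        unfolding N_def by (simp add: algebra_simps)
      finally show ?thesis .
    qed
    then have II: "\<xi> t * (q t)\<^sup>2 * (4 * (q t)\<^sup>2 - 3 * \<gamma>\<^sup>2 - (p t)\<^sup>2) = ((p t)\<^sup>2 - (q t)\<^sup>2) * (\<eta> t * E t - G * (m2 t + \<gamma>\<^sup>2 * m1 t))"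
      using pp by simp
    have V: "2 * p t * q t * ((v t)\<^sup>2 + 1) = E t * v t"
      unfolding vq[OF t3] s_def using pp by simp
    have U: "\<gamma> * u t * v t = 2 * q t * v t - p t"
      unfolding u_def using v1[OF t3] al(2) by simp
    have R3: "T * (r3 t)\<^sup>2 * v t = 2 * p t * q t * \<eta> t"
    proof -
      have "2 * p t * q t * \<eta> t / (T * v t) \<ge> 0" using pp e4(3)[OF t] TG v1[OF t3] by simp
      then show ?thesis unfolding r3_def using TG v1[OF t3] by simp
    qed
    have R1: "T * (r1 t)\<^sup>2 * u t = 2 * q t * \<gamma> * \<xi> t"
    proof -
      have "2 * q t * \<gamma> * \<xi> t / (T * u t) \<ge> 0" using pp xp al(2) TG u0[OF t3] by simp
      then show ?thesis unfolding r1_def using TG u0[OF t3] by simp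
    qed
    show ?thesis unfolding a_def L_def R_def
      by (rule type_I_balanced[of "p t" "q t" \<gamma> "u t" "v t" rho0 "\<eta> t" "\<xi> t" grav "r3 t" "r1 t"])
        (use pp al(2) u0[OF t3] v1[OF t3] rg(1) V U I II R3 R1 in \<open>simp_all add: T_def G_def E_def m1_def m2_def a_def\<close>)
  qed
  have z0: "(0::real) \<in> {0..<e4}" using e4 by simp
  have "r1 0 = 0" by (simp add: r1_def \<xi>_def pq0)
  then have LR0: "L 0 = (v 0 * r3 0) *\<^sub>R ax3" "R 0 = r3 0 *\<^sub>R ax3" by (simp_all add: L_def R_def semi_def)
  have z3: "(0::real) \<in> {0..<e3}" using e3 by simp
  have r30: "r3 t > 0" if "t \<in> {0..<e4}" for t
  proof -
    have "t \<in> {0..<e3}" using that sub by auto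
    then show ?thesis unfolding r3_def using pq[of t] e4(3)[OF that] TG v1[of t] that by simp
  qed
  have a0s: "a 0 = semi \<alpha> \<alpha> \<gamma>" by (simp add: a_def pq0)
  have start: "eq_state rho0 (a 0) (L 0, R 0) = maclaurin rho0 grav e"
    unfolding a0s LR0
  proof (rule spheroid_start[OF e rg ax])
    show "balanced rho0 grav (diag (semi \<alpha> \<alpha> \<gamma>)) ((v 0 * r3 0) *\<^sub>R ax3, r3 0 *\<^sub>R ax3)"
      using bal[OF z0] unfolding a0s LR0 .
    show "r3 0 < v 0 * r3 0" using v1[OF z3] r30[OF z0] by simp
  qed
  have "bifurcating_family rho0 grav e (\<lambda>z. isotropy z = {\<one>\<^bsub>sym_group\<^esub>} \<and> ellipsoid_with rho0 grav type_I z)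
      (\<lambda>v::'v. eq_state rho0 (a (norm v)) (L (norm v), R (norm v)))"
  proof (rule bifurcating_family_from_path[OF rg e4(1) c4(7) cL start])
    fix t assume t: "0 < t" "t < e4"
    then have t4: "t \<in> {0..<e4}" and t3: "t \<in> {0..<e3}" using e4 by auto
    have pp: "p t > 0" "q t > 0" "p t * q t = \<alpha>\<^sup>2" using pq[of t] t by auto
    have gq: "\<gamma> < q t" "q t < p t" using h1[OF t3] lt[OF t(1)] by auto
    have pos: "a t $ i > 0" for i unfolding a_def using pp al(2) by (intro semi_pos)
    have inj: "inj (($) (a t))" by (rule inj_nth3) (use gq in \<open>auto simp: a_def\<close>)
    have det: "a t $ 1 * a t $ 2 * a t $ 3 = 1" using pp(3) al(3) by (simp add: a_def)
    have x0: "\<xi> t > 0"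
    proof -
      have "(q t)\<^sup>2 < (p t)\<^sup>2" using gq pp by (simp add: power_strict_mono)
      then show ?thesis unfolding \<xi>_def using TG Np[OF t3] Dp[OF t3] by simp
    qed
    have r10: "r1 t > 0" unfolding r1_def using x0 pp al(2) TG u0[OF t3] by simp
    note r3p = r30[OF t4]
    have "isotropy (eq_state rho0 (a t) (L t, R t)) = {\<one>\<^bsub>sym_group\<^esub>}"
      unfolding eq_state_def
    proof (rule isotropy_trivial[OF pos inj, of _ 1 3 _ _ 3])
      show "metric_const rho0 \<noteq> 0" using TG by (simp add: T_def)
      have "r3 t < v t * r3 t" using v1[OF t3] r3p by simp
      then show "\<bar>L t $ 3\<bar> \<noteq> \<bar>R t $ 3\<bar>" using r3p v1[OF t3] by (simp add: L_def R_def)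
    qed (use r10 r3p in \<open>auto simp: R_def\<close>)
    moreover have "ellipsoid_with rho0 grav type_I (eq_state rho0 (a t) (L t, R t))"
    proof (rule ellipsoid_withI[OF rg(1) det bal[OF t4] pos inj])
      show "type_I (a t) (L t, R t)" unfolding L_def R_def
        by (rule type_I_in_plane[of 1 3 2]) (use r10 r3p h1[OF t3] exhaust_3 in \<open>auto simp: a_def\<close>)
    qed
    ultimately show "(\<forall>i. a t $ i > 0) \<and> inj (($) (a t)) \<and> a t $ 1 * a t $ 2 * a t $ 3 = 1 \<and>
        balanced rho0 grav (diag (a t)) (L t, R t) \<and> isotropy (eq_state rho0 (a t) (L t, R t)) = {\<one>\<^bsub>sym_group\<^esub>} \<and>
        ellipsoid_with rho0 grav type_I (eq_state rho0 (a t) (L t, R t))"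
      using pos inj det bal[OF t4] by blast
  qed
  then show ?thesis by blast
qed


section \<open>Type S and adjoint S ellipsoids\<close>

lemma continuous_on_crit:
  assumes "continuous_on S s" "continuous_on S k" "\<And>t. t \<in> S \<Longrightarrow> s t > 0 \<and> k t > 0"
  shows "continuous_on S (\<lambda>t. crit \<theta> (s t) (k t))"
  using assms unfolding continuous_on_def by (auto intro: tendsto_crit)

text \<open>The shape variable \<open>\<sigma>\<close> of an ellipsoid with \<open>a\<^sub>1 / a\<^sub>2 = 1 + t\<close>.\<close>

definition sig :: "real \<Rightarrow> real" where "sig t = (1 + t) + 1 / (1 + t)"

lemma sig_0: "sig 0 = 2" by (simp add: sig_def)

lemma sig_gt: assumes "t > 0" shows "sig t > 2"
proof -
  have "(1 + t) * (sig t - 2) = t\<^sup>2" using assms by (simp add: sig_def field_simps power2_eq_square)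
  then have "(1 + t) * (sig t - 2) > 0" using assms by simp
  then show ?thesis using assms by (simp add: zero_less_mult_iff)
qed

lemma sig_ge: "t \<ge> 0 \<Longrightarrow> sig t \<ge> 2"
  using sig_gt[of t] sig_0 by (cases "t = 0") auto

lemma continuous_on_sig: "continuous_on {0..<e} sig"
  unfolding sig_def by (intro continuous_intros) auto

text \<open>What a caller needs to know about the point at parameter \<open>t\<close> of a type S path with shape variables
\<open>sig t\<close> and \<open>k t\<close>.\<close>

definition axial_spec :: "real \<Rightarrow> real \<Rightarrow> (real \<Rightarrow> real) \<Rightarrow> real \<Rightarrow> real^3 \<Rightarrow> real \<Rightarrow> real \<Rightarrow> bool" where
  "axial_spec rho0 grav k t a l m \<longleftrightarrow>
     (\<forall>i. a $ i > 0) \<and> inj (($) a) \<and> a$1 * a$2 * a$3 = 1 \<and> balanced rho0 grav (diag a) (l *\<^sub>R ax3, m *\<^sub>R ax3) \<and>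
     l > m \<and> (\<exists>c>0. (l + m)\<^sup>2 = c * crit 1 (sig t) (k t) \<and> 2 * (l * m) = c * crit 0 (sig t) (k t))"

text \<open>The shape may be prescribed freely as long as \<open>crit 1 \<ge> 0\<close> along it; then the rates are
\<open>(sqrt U \<plusminus> sqrt W) / 2\<close> for the prescribed values \<open>U\<close> of \<open>(l + m)\<^sup>2\<close> and \<open>W\<close> of
\<open>(l - m)\<^sup>2\<close>. They stay continuous where \<open>U\<close> vanishes.\<close>

lemma type_S_family:
  fixes k :: "real \<Rightarrow> real"
  assumes e: "0 < e" "e < 1" and rg: "rho0 > 0" "grav > 0" and eps: "\<epsilon> > 0"
    and k: "continuous_on {0..<\<epsilon>} k" "k 0 = 1 - e\<^sup>2" "\<And>t. t \<in> {0..<\<epsilon>} \<Longrightarrow> k t > 0"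
    and cr: "\<And>t. t \<in> {0..<\<epsilon>} \<Longrightarrow> crit 1 (sig t) (k t) \<ge> 0"
    and Q: "\<And>t a l m. 0 < t \<Longrightarrow> t < \<epsilon> \<Longrightarrow> axial_spec rho0 grav k t a l m \<Longrightarrow> Q (eq_state rho0 a (l *\<^sub>R ax3, m *\<^sub>R ax3))"
  shows "\<exists>f :: 'v::real_normed_vector \<Rightarrow> phase. bifurcating_family rho0 grav e Q f"
proof -
  obtain \<alpha> \<gamma> where ax: "maclaurin_axes rho0 grav e \<alpha> \<gamma>"
    by (rule maclaurin_axes_exist[OF e rg])
  note al = maclaurin_axesD(1-4)[OF ax]
  have a0: "\<alpha> > 0" using al by simp
  \<comment> \<open>determinant 1 means \<open>\<tau>\<^sup>3 \<kappa> = 1\<close> for \<open>\<tau> = a\<^sub>1 a\<^sub>2\<close>\<close>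
  define \<tau> where "\<tau> t = k t powr (-1/3)" for t
  have tp: "\<tau> t > 0" if "t \<in> {0..<\<epsilon>}" for t using k(3)[OF that] by (simp add: \<tau>_def)
  have t3: "(\<tau> t)^3 = 1 / k t" if "t \<in> {0..<\<epsilon>}" for t
  proof -
    have "(\<tau> t)^3 = inverse (k t)"
      unfolding \<tau>_def using powr_power[of "k t" "-1/3" 3] k(3)[OF that] by (simp add: powr_minus)
    then show ?thesis by (simp only: inverse_eq_divide)
  qed
  have ct: "continuous_on {0..<\<epsilon>} \<tau>" unfolding \<tau>_def using k(3) by (intro continuous_intros k(1)) force
  have z0: "(0::real) \<in> {0..<\<epsilon>}" using eps by simp
  have t0: "\<tau> 0 = \<alpha>\<^sup>2"
  proof -
    have "\<gamma> = 1 / \<alpha>\<^sup>2" using al(3) a0 by (simp add: field_simps)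
    then have "\<gamma>\<^sup>2 / \<alpha>\<^sup>2 = 1 / (\<alpha>\<^sup>2)^3" by (simp add: power2_eq_square power3_eq_cube)
    then have "k 0 = 1 / (\<alpha>\<^sup>2)^3" using al(4) k(2) by simp
    then have "(\<tau> 0)^3 = (\<alpha>\<^sup>2)^3" using t3[OF z0] by simp
    then show ?thesis using tp[OF z0] by (intro power_eq_imp_eq_base[of "\<tau> 0" 3]) auto
  qed
  define p where "p t = sqrt (\<tau> t * (1 + t))" for t
  define q where "q t = sqrt (\<tau> t / (1 + t))" for t
  define a where "a t = semi (p t) (q t) (1 / \<tau> t)" for t
  have pq: "p t > 0" "q t > 0" "p t * q t = \<tau> t" "(p t)\<^sup>2 = \<tau> t * (1 + t)" "(q t)\<^sup>2 = \<tau> t / (1 + t)" if "t \<in> {0..<\<epsilon>}" for t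
  proof -
    show "p t > 0" "q t > 0" "(p t)\<^sup>2 = \<tau> t * (1 + t)" "(q t)\<^sup>2 = \<tau> t / (1 + t)" using tp[OF that] that by (simp_all add: p_def q_def)
    have "p t * q t = sqrt ((\<tau> t)\<^sup>2)" unfolding p_def q_def real_sqrt_mult[symmetric] using that by (simp add: power2_eq_square)
    then show "p t * q t = \<tau> t" using tp[OF that] by simp
  qed
  have cpq: "continuous_on {0..<\<epsilon>} p" "continuous_on {0..<\<epsilon>} q" unfolding p_def q_def by (intro continuous_intros ct; auto)+
  have ca: "continuous_on {0..<\<epsilon>} a" unfolding a_def using tp by (intro continuous_intros cpq ct) force
  have pos: "a t $ i > 0" if "t \<in> {0..<\<epsilon>}" for t i
    unfolding a_def using pq[OF that] tp[OF that] by (intro semi_pos) auto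
  have det: "a t $ 1 * a t $ 2 * a t $ 3 = 1" if "t \<in> {0..<\<epsilon>}" for t
    using pq(3)[OF that] tp[OF that] by (simp add: a_def)
  have sg: "((a t $ 1)\<^sup>2 + (a t $ 2)\<^sup>2) / (a t $ 1 * a t $ 2) = sig t" if "t \<in> {0..<\<epsilon>}" for t
    using pq[OF that] tp[OF that] by (simp add: a_def sig_def add_divide_distrib)
  have kp: "(a t $ 3)\<^sup>2 / (a t $ 1 * a t $ 2) = k t" if "t \<in> {0..<\<epsilon>}" for t
  proof -
    have "(a t $ 3)\<^sup>2 / (a t $ 1 * a t $ 2) = 1 / (\<tau> t)^3"
      using pq(3)[OF that] by (simp add: a_def power2_eq_square power3_eq_cube)
    then show ?thesis unfolding t3[OF that] by simp
  qed
  have pq0: "p 0 = \<alpha>" "q 0 = \<alpha>" "1 / \<tau> 0 = \<gamma>"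
    unfolding p_def q_def t0 using a0 al(3) by (simp_all add: field_simps)
  define c where "c t = vel_scale rho0 grav (a t $ 1 * a t $ 2)" for t
  have TG: "metric_const rho0 > 0" "R_const rho0 grav > 0" using rg by (auto simp: metric_const_def R_const_def)
  have cp: "c t > 0" if "t \<in> {0..<\<epsilon>}" for t
    unfolding c_def vel_scale_def using TG pos[OF that, of 1] pos[OF that, of 2] by simp
  have cc: "continuous_on {0..<\<epsilon>} c"
  proof -
    have "continuous_on {0..<\<epsilon>} (\<lambda>t. R_const rho0 grav / (metric_const rho0 * sqrt ((\<tau> t)^3)))"
      using tp TG by (intro continuous_intros ct) force
    then show ?thesis by (rule continuous_on_eq) (simp add: c_def vel_scale_def a_def pq(3))
  qed
  define U where "U t = c t * crit 1 (sig t) (k t)" for t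
  define W where "W t = c t * (crit 1 (sig t) (k t) - 2 * crit 0 (sig t) (k t))" for t
  have ccr: "continuous_on {0..<\<epsilon>} (\<lambda>t. crit \<theta> (sig t) (k t))" for \<theta>
    using k(3) sig_ge by (intro continuous_on_crit continuous_on_sig k(1)) force
  have cU: "continuous_on {0..<\<epsilon>} U" "continuous_on {0..<\<epsilon>} W"
    unfolding U_def W_def by (intro continuous_intros cc ccr)+
  have W0: "W 0 > 0"
  proof -
    have "crit 1 2 (k 0) - 2 * crit 0 2 (k 0) = (1 - k 0) * (nmom 1 2 (k 0) + nmom 2 2 (k 0))"
      unfolding crit_def by (simp add: algebra_simps)
    moreover have "nmom 1 2 (k 0) > 0" "nmom 2 2 (k 0) > 0" using k(3)[OF z0] by (simp_all add: nmom_pos)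
    moreover have "1 - k 0 > 0" using k(2) e by simp
    ultimately show ?thesis unfolding W_def sig_0 using cp[OF z0] by (simp add: add_pos_pos)
  qed
  obtain e1 where e1: "0 < e1" "e1 \<le> \<epsilon>" "\<And>t. t \<in> {0..<e1} \<Longrightarrow> W t > 0"
    by (rule positive_near_zero[OF cU(2) eps W0]) blast
  have c1: "continuous_on {0..<\<epsilon>} (\<lambda>t. q t - 1 / \<tau> t)" using tp by (intro continuous_intros cpq ct) force
  obtain e2 where e2: "0 < e2" "e2 \<le> \<epsilon>" "\<And>t. t \<in> {0..<e2} \<Longrightarrow> q t - 1 / \<tau> t > 0"
    by (rule positive_near_zero[OF c1 eps]) (use al pq0 in auto)
  define d where "d = min e1 e2"
  have d: "0 < d" "d \<le> \<epsilon>" and sub: "{0..<d} \<subseteq> {0..<\<epsilon>}" using e1 e2 by (auto simp: d_def)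
  define l where "l t = (sqrt (U t) + sqrt (W t)) / 2" for t
  define m where "m t = (sqrt (U t) - sqrt (W t)) / 2" for t
  have lm: "(l t + m t)\<^sup>2 = U t" "(l t - m t)\<^sup>2 = W t" "l t > m t" if t: "t \<in> {0..<d}" for t
  proof -
    have te: "t \<in> {0..<\<epsilon>}" using t sub by auto
    have "U t \<ge> 0" unfolding U_def using cp[OF te] cr[OF te] by simp
    moreover have "W t > 0" using e1(3)[of t] t by (auto simp: d_def)
    moreover have "l t + m t = sqrt (U t)" "l t - m t = sqrt (W t)" by (simp_all add: l_def m_def field_simps)
    ultimately show "(l t + m t)\<^sup>2 = U t" "(l t - m t)\<^sup>2 = W t" by simp_all
    show "l t > m t" using \<open>W t > 0\<close> by (simp add: l_def m_def)
  qed
  have clm: "continuous_on {0..<d} (\<lambda>t. l t *\<^sub>R ax3)" "continuous_on {0..<d} (\<lambda>t. m t *\<^sub>R ax3)"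
    unfolding l_def m_def by (intro continuous_intros continuous_on_subset[OF cU(1) sub] continuous_on_subset[OF cU(2) sub]; simp)+
  have ne: "p t \<noteq> q t" if "t \<in> {0..<\<epsilon>}" "t > 0" for t
  proof
    assume "p t = q t"
    then have "\<tau> t * (1 + t) = \<tau> t / (1 + t)" using pq(4,5)[OF that(1)] by simp
    then have "\<tau> t * (t * (t + 2)) = 0" using that(2) by (simp add: field_simps)
    then show False using tp[OF that(1)] that(2) by simp
  qed
  have bal: "balanced rho0 grav (diag (a t)) (l t *\<^sub>R ax3, m t *\<^sub>R ax3)" if t: "t \<in> {0..<d}" for t
  proof (cases "t = 0")
    case True
    have eq: "a t $ 1 = a t $ 2" using pq0 by (simp add: a_def True)
    have te: "t \<in> {0..<\<epsilon>}" using t sub by auto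
    have "W t = c t * (1 - k t) * (nmom 1 2 (k t) + nmom 2 2 (k t))"
      unfolding W_def True sig_0 crit_def by (simp add: algebra_simps)
    then show ?thesis
      using type_S_balanced_iff(2)[OF pos[OF te] det[OF te] rg(1) eq, of grav "l t" "m t"] lm(2)[OF t]
      unfolding kp[OF te] c_def by simp
  next
    case False
    have te: "t \<in> {0..<\<epsilon>}" using t sub by auto
    have "a t $ 1 \<noteq> a t $ 2" using ne[OF te] False te by (simp add: a_def)
    then show ?thesis
      using type_S_balanced_iff(1)[OF pos[OF te] det[OF te] rg(1), of grav "l t" "m t"] lm(1,2)[OF t]
      unfolding kp[OF te] sg[OF te] c_def[symmetric] U_def W_def by simp
  qed
  have d0: "(0::real) \<in> {0..<d}" using d by simp
  have start: "eq_state rho0 (a 0) (l 0 *\<^sub>R ax3, m 0 *\<^sub>R ax3) = maclaurin rho0 grav e"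
  proof -
    have as: "a 0 = semi \<alpha> \<alpha> \<gamma>" by (simp add: a_def pq0)
    show ?thesis unfolding as
      by (rule spheroid_start[OF e rg ax bal[OF d0, unfolded as] lm(3)[OF d0]])
  qed
  have "bifurcating_family rho0 grav e Q (\<lambda>v::'v. eq_state rho0 (a (norm v)) (l (norm v) *\<^sub>R ax3, m (norm v) *\<^sub>R ax3))"
  proof (rule bifurcating_family_from_path[OF rg d(1) continuous_on_subset[OF ca sub] clm start])
    fix t assume t: "0 < t" "t < d"
    then have td: "t \<in> {0..<d}" and te: "t \<in> {0..<\<epsilon>}" using d by auto
    have g1: "1 / \<tau> t < q t" using e2(3)[of t] t by (auto simp: d_def)
    have "(q t)\<^sup>2 \<le> (p t)\<^sup>2"
    proof -
      have "\<tau> t / (1 + t) \<le> \<tau> t * (1 + t)" using tp[OF te] t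
        by (simp add: divide_le_eq mult.assoc mult_le_cancel_left1) (simp add: one_le_mult_iff algebra_simps)
      then show ?thesis by (simp add: pq(4,5)[OF te])
    qed
    then have "q t \<le> p t" by (rule power2_le_imp_le) (use pq(1)[OF te] in simp)
    then have g2: "q t < p t" using ne[OF te t(1)] by simp
    have inj: "inj (($) (a t))" by (rule inj_nth3) (use g1 g2 in \<open>simp_all add: a_def\<close>)
    have "2 * (l t * m t) = c t * crit 0 (sig t) (k t)"
    proof -
      have "4 * (l t * m t) = (l t + m t)\<^sup>2 - (l t - m t)\<^sup>2" by (simp add: power2_eq_square algebra_simps)
      also have "\<dots> = 2 * (c t * crit 0 (sig t) (k t))" unfolding lm[OF td] U_def W_def by (simp add: algebra_simps)
      finally show ?thesis by simp
    qed
    then have "(l t + m t)\<^sup>2 = c t * crit 1 (sig t) (k t) \<and> 2 * (l t * m t) = c t * crit 0 (sig t) (k t)"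
      using lm(1)[OF td] unfolding U_def by blast
    then have "\<exists>c>0. (l t + m t)\<^sup>2 = c * crit 1 (sig t) (k t) \<and> 2 * (l t * m t) = c * crit 0 (sig t) (k t)"
      using cp[OF te] by blast
    then have spec: "axial_spec rho0 grav k t (a t) (l t) (m t)"
      unfolding axial_spec_def using pos[OF te] inj det[OF te] bal[OF td] lm(3)[OF td] by blast
    have "Q (eq_state rho0 (a t) (l t *\<^sub>R ax3, m t *\<^sub>R ax3))"
      using Q[OF t(1) _ spec] te by auto
    then show "(\<forall>i. a t $ i > 0) \<and> inj (($) (a t)) \<and> a t $ 1 * a t $ 2 * a t $ 3 = 1 \<and>
        balanced rho0 grav (diag (a t)) (l t *\<^sub>R ax3, m t *\<^sub>R ax3) \<and> Q (eq_state rho0 (a t) (l t *\<^sub>R ax3, m t *\<^sub>R ax3))"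
      using pos[OF te] inj det[OF te] bal[OF td] by blast
  qed
  then show ?thesis by blast
qed

lemma axial_in_span: "l *\<^sub>R ax3 \<in> span {axis 3 1}"
  unfolding span_axis_one by blast

lemma type_S_axial: "type_S a (l *\<^sub>R ax3, m *\<^sub>R ax3)"
  unfolding type_S_def using axial_in_span by (intro exI[of _ 3]) simp

lemma norm_axial: "norm (l *\<^sub>R ax3) = \<bar>l\<bar>" by (simp add: norm_axis_1)

lemma axial_eq_0: "l *\<^sub>R ax3 = 0 \<longleftrightarrow> l = 0" by (simp add: axis_eq_0_iff)

text \<open>Positivity of \<open>crit 1\<close> at the spheroid gives \<open>l + m \<noteq> 0\<close> nearby. To keep both \<open>l\<close> and \<open>m\<close> nonzero the
path must avoid the zeros of \<open>crit 0\<close> (ellipsoids of Jacobi and Dedekind). If \<open>crit 0\<close> vanishes at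
the spheroid itself, the path leaves the zero curve of \<open>crit 0\<close> by adding \<open>t\<close> to \<open>\<kappa>\<close>; otherwise
\<open>\<kappa>\<close> can be kept constant.\<close>

lemma type_S_bifurcation:
  assumes rg: "rho0 > 0" "grav > 0" and e: "0 < e" "e < e_crit rho0 grav"
  shows "\<exists>f :: 'v::real_normed_vector \<Rightarrow> phase. bifurcating_family rho0 grav e
          (\<lambda>z. isotropy z = K_S \<and> card (isotropy z) = 2 \<and>
               ellipsoid_with rho0 grav
                 (\<lambda>a xi. type_S a xi \<and> fst xi \<noteq> 0 \<and> snd xi \<noteq> 0 \<and>
                         norm (fst xi) \<noteq> norm (snd xi)) z) f"
proof -
  have e1: "e < 1" using e e_crit_sign(1)[OF rg] by simp
  then have C: "crit 1 2 (1 - e\<^sup>2) > 0" using e_crit_sign(2)[OF rg, of e] e by simp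
  define \<kappa> where "\<kappa> = 1 - e\<^sup>2"
  have k0: "\<kappa> > 0" using e e1 by (simp add: \<kappa>_def power_less_one_iff)
  have T: "metric_const rho0 \<noteq> 0" using rg by (simp add: metric_const_def)
  obtain k \<epsilon> where k: "\<epsilon> > 0" "continuous_on {0..<\<epsilon>} k" "k 0 = \<kappa>" "\<And>t. t \<in> {0..<\<epsilon>} \<Longrightarrow> k t > 0"
      "\<And>t. 0 < t \<Longrightarrow> t < \<epsilon> \<Longrightarrow> crit 0 (sig t) (k t) \<noteq> 0"
  proof (cases "crit 0 2 \<kappa> = 0")
    case True
    obtain r \<sigma>\<^sub>1 where r: "\<sigma>\<^sub>1 > 2" "continuous_on {2..<\<sigma>\<^sub>1} r" "r 2 = \<kappa>" "\<And>\<sigma>. \<sigma> \<in> {2..<\<sigma>\<^sub>1} \<Longrightarrow> r \<sigma> > 0 \<and> crit 0 \<sigma> (r \<sigma>) = 0"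
      by (rule crit_root_branch[OF _ k0 True]) auto
    have "continuous_on {0..<1} (\<lambda>t. \<sigma>\<^sub>1 - sig t)" by (intro continuous_intros continuous_on_sig)
    then obtain d where d: "0 < d" "d \<le> 1" "\<And>t. t \<in> {0..<d} \<Longrightarrow> \<sigma>\<^sub>1 - sig t > 0"
      by (rule positive_near_zero) (use r(1) in \<open>auto simp: sig_0\<close>)
    have im: "sig t \<in> {2..<\<sigma>\<^sub>1}" if "t \<in> {0..<d}" for t using d(3)[OF that] sig_ge[of t] that by auto
    show ?thesis
    proof (rule that[of d "\<lambda>t. r (sig t) + t"])
      show "continuous_on {0..<d} (\<lambda>t. r (sig t) + t)"
        by (intro continuous_intros continuous_on_compose2[OF r(2) continuous_on_sig]) (use im in auto)
      show "r (sig t) + t > 0" if "t \<in> {0..<d}" for t using r(4)[OF im[OF that]] that by auto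
      show "crit 0 (sig t) (r (sig t) + t) \<noteq> 0" if "0 < t" "t < d" for t
      proof -
        have "crit 0 (sig t) (r (sig t) + t) > 0"
          using r(4)[OF im, of t] that sig_ge[of t] by (intro crit_mono[of 0 _ "r (sig t)"]) auto
        then show ?thesis by simp
      qed
    qed (use d r in \<open>auto simp: sig_0\<close>)
  next
    case False
    have "continuous_on {0..<1} (\<lambda>t. \<bar>crit 0 (sig t) \<kappa>\<bar>)"
    proof (intro continuous_intros continuous_on_crit continuous_on_sig)
      show "0 < sig t \<and> 0 < \<kappa>" if "t \<in> {0..<1}" for t using sig_ge[of t] that k0 by auto
    qed
    then obtain d where d: "0 < d" "d \<le> 1" "\<And>t. t \<in> {0..<d} \<Longrightarrow> \<bar>crit 0 (sig t) \<kappa>\<bar> > 0"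
      by (rule positive_near_zero) (use False in \<open>auto simp: sig_0\<close>)
    show ?thesis
    proof (rule that[of d "\<lambda>t. \<kappa>"])
      show "crit 0 (sig t) \<kappa> \<noteq> 0" if "0 < t" "t < d" for t using d(3)[of t] that by auto
    qed (use d k0 in auto)
  qed
  have "continuous_on {0..<\<epsilon>} (\<lambda>t. crit 1 (sig t) (k t))"
  proof (intro continuous_on_crit continuous_on_sig k(2))
    show "0 < sig t \<and> 0 < k t" if "t \<in> {0..<\<epsilon>}" for t using sig_ge[of t] that k(4)[OF that] by auto
  qed
  then obtain d where d: "0 < d" "d \<le> \<epsilon>" "\<And>t. t \<in> {0..<d} \<Longrightarrow> crit 1 (sig t) (k t) > 0"
    by (rule positive_near_zero) (use k C in \<open>auto simp: sig_0 \<kappa>_def\<close>)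
  have sub: "{0..<d} \<subseteq> {0..<\<epsilon>}" using d by auto
  show ?thesis
  proof (rule type_S_family[OF e(1) e1 rg d(1) continuous_on_subset[OF k(2) sub]])
    show "k 0 = 1 - e\<^sup>2" using k(3) by (simp add: \<kappa>_def)
    show "k t > 0" if "t \<in> {0..<d}" for t using k(4) that sub by blast
    show "crit 1 (sig t) (k t) \<ge> 0" if "t \<in> {0..<d}" for t using d(3)[OF that] by simp
    fix t a l m assume t: "0 < t" "t < d" and spec: "axial_spec rho0 grav k t a l m"
    obtain c where c: "c > 0" "(l + m)\<^sup>2 = c * crit 1 (sig t) (k t)" "2 * (l * m) = c * crit 0 (sig t) (k t)"
      using spec unfolding axial_spec_def by blast
    have s: "\<And>i. a $ i > 0" "inj (($) a)" "a$1 * a$2 * a$3 = 1" "balanced rho0 grav (diag a) (l *\<^sub>R ax3, m *\<^sub>R ax3)" "l > m"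
      using spec unfolding axial_spec_def by auto
    have "(l + m)\<^sup>2 > 0" using c(1,2) d(3)[of t] t by simp
    then have lm: "l + m \<noteq> 0" by auto
    have "2 * (l * m) \<noteq> 0" using c(1,3) k(5)[of t] t d(2) by simp
    then have nz: "l \<noteq> 0" "m \<noteq> 0" by auto
    have ab: "\<bar>l\<bar> \<noteq> \<bar>m\<bar>" using lm s(5) by (auto simp: abs_if split: if_splits)
    have "isotropy (eq_state rho0 a (l *\<^sub>R ax3, m *\<^sub>R ax3)) = K_S" "card (isotropy (eq_state rho0 a (l *\<^sub>R ax3, m *\<^sub>R ax3))) = 2"
      unfolding eq_state_def by (rule isotropy_type_S[OF s(1,2) T ab])+
    moreover have "ellipsoid_with rho0 grav (\<lambda>a xi. type_S a xi \<and> fst xi \<noteq> 0 \<and> snd xi \<noteq> 0 \<and> norm (fst xi) \<noteq> norm (snd xi))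
        (eq_state rho0 a (l *\<^sub>R ax3, m *\<^sub>R ax3))"
      by (rule ellipsoid_withI[OF rg(1) s(3,4,1,2)]) (use type_S_axial nz ab in \<open>simp add: norm_axial axial_eq_0\<close>)
    ultimately show "isotropy (eq_state rho0 a (l *\<^sub>R ax3, m *\<^sub>R ax3)) = K_S \<and> card (isotropy (eq_state rho0 a (l *\<^sub>R ax3, m *\<^sub>R ax3))) = 2 \<and>
        ellipsoid_with rho0 grav (\<lambda>a xi. type_S a xi \<and> fst xi \<noteq> 0 \<and> snd xi \<noteq> 0 \<and> norm (fst xi) \<noteq> norm (snd xi))
        (eq_state rho0 a (l *\<^sub>R ax3, m *\<^sub>R ax3))" by blast
  qed
qed

text \<open>The path follows the zero curve of \<open>crit 1\<close>, on which \<open>(l + m)\<^sup>2 = 0\<close>.\<close>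

lemma adjoint_S_bifurcation:
  assumes rg: "rho0 > 0" "grav > 0"
  shows "\<exists>f :: 'v::real_normed_vector \<Rightarrow> phase. bifurcating_family rho0 grav (e_crit rho0 grav)
          (\<lambda>z. isotropy z = K_adj \<and> card (isotropy z) = 4 \<and> ellipsoid_with rho0 grav adjoint_S z) f"
proof -
  define e where "e = e_crit rho0 grav"
  have e: "0 < e" "e < 1" using e_crit_sign(1)[OF rg] by (auto simp: e_def)
  define \<kappa> where "\<kappa> = 1 - e\<^sup>2"
  have k0: "\<kappa> > 0" using e by (simp add: \<kappa>_def power_less_one_iff)
  have C: "crit 1 2 \<kappa> = 0" using e_crit_sign(3)[OF rg, of e] e by (simp add: e_def \<kappa>_def)
  have T: "metric_const rho0 \<noteq> 0" using rg by (simp add: metric_const_def)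
  obtain r \<sigma>\<^sub>1 where r: "\<sigma>\<^sub>1 > 2" "continuous_on {2..<\<sigma>\<^sub>1} r" "r 2 = \<kappa>" "\<And>\<sigma>. \<sigma> \<in> {2..<\<sigma>\<^sub>1} \<Longrightarrow> r \<sigma> > 0 \<and> crit 1 \<sigma> (r \<sigma>) = 0"
    by (rule crit_root_branch[OF _ k0 C]) auto
  have "continuous_on {0..<1} (\<lambda>t. \<sigma>\<^sub>1 - sig t)" by (intro continuous_intros continuous_on_sig)
  then obtain d where d: "0 < d" "d \<le> 1" "\<And>t. t \<in> {0..<d} \<Longrightarrow> \<sigma>\<^sub>1 - sig t > 0"
    by (rule positive_near_zero) (use r(1) in \<open>auto simp: sig_0\<close>)
  have im: "sig t \<in> {2..<\<sigma>\<^sub>1}" if "t \<in> {0..<d}" for t using d(3)[OF that] sig_ge[of t] that by auto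
  show ?thesis unfolding e_def[symmetric]
  proof (rule type_S_family[OF e rg d(1), of "\<lambda>t. r (sig t)"])
    show "continuous_on {0..<d} (\<lambda>t. r (sig t))"
      by (intro continuous_on_compose2[OF r(2) continuous_on_sig]) (use im in auto)
    show "r (sig 0) = 1 - e\<^sup>2" using r(3) by (simp add: sig_0 \<kappa>_def)
    show "r (sig t) > 0" "crit 1 (sig t) (r (sig t)) \<ge> 0" if "t \<in> {0..<d}" for t using r(4)[OF im[OF that]] by auto
    fix t a l m assume t: "0 < t" "t < d" and spec: "axial_spec rho0 grav (\<lambda>t. r (sig t)) t a l m"
    obtain c where c: "c > 0" "(l + m)\<^sup>2 = c * crit 1 (sig t) (r (sig t))"
      using spec unfolding axial_spec_def by blast
    have s: "\<And>i. a $ i > 0" "inj (($) a)" "a$1 * a$2 * a$3 = 1" "balanced rho0 grav (diag a) (l *\<^sub>R ax3, m *\<^sub>R ax3)" "l > m"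
      using spec unfolding axial_spec_def by auto
    have "l + m = 0" using c(2) r(4)[OF im, of t] t by simp
    then have m: "m *\<^sub>R ax3 = - (l *\<^sub>R ax3)" and l: "l \<noteq> 0" using s(5) by (auto simp: eq_neg_iff_add_eq_0 simp flip: scaleR_left.add)
    have "isotropy (eq_state rho0 a (l *\<^sub>R ax3, m *\<^sub>R ax3)) = K_adj" "card (isotropy (eq_state rho0 a (l *\<^sub>R ax3, m *\<^sub>R ax3))) = 4"
      unfolding eq_state_def m by (rule isotropy_adjoint_S[OF s(1,2) T l])+
    moreover have "ellipsoid_with rho0 grav adjoint_S (eq_state rho0 a (l *\<^sub>R ax3, m *\<^sub>R ax3))"
      by (rule ellipsoid_withI[OF rg(1) s(3,4,1,2)]) (use type_S_axial[of a l m] l m in \<open>simp add: adjoint_S_def axial_eq_0\<close>)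
    ultimately show "isotropy (eq_state rho0 a (l *\<^sub>R ax3, m *\<^sub>R ax3)) = K_adj \<and> card (isotropy (eq_state rho0 a (l *\<^sub>R ax3, m *\<^sub>R ax3))) = 4 \<and>
        ellipsoid_with rho0 grav adjoint_S (eq_state rho0 a (l *\<^sub>R ax3, m *\<^sub>R ax3))" by blast
  qed
qed


section \<open>Absence of further bifurcations\<close>

text \<open>The hypotheses are the two off-diagonal equations that couple the third axis (\<open>l\<close>, \<open>r\<close>) with another one (\<open>x\<close>, \<open>y\<close>).
They are linear in \<open>(x, y)\<close>, and the conclusion is that their determinant vanishes.\<close>

lemma tilted_velocity_condition:
  fixes a b c l r x y :: real
  assumes "c * x * l - 2 * b * l * y + a * y * r = 0" "a * l * x - 2 * b * x * r + c * r * y = 0"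
    and nz: "x \<noteq> 0 \<or> y \<noteq> 0"
  shows "2 * a * b * (l\<^sup>2 + r\<^sup>2) = (a\<^sup>2 + 4 * b\<^sup>2 - c\<^sup>2) * (l * r)"
proof -
  define D where "D = c\<^sup>2 * (l * r) - (a * r - 2 * b * l) * (a * l - 2 * b * r)"
  have "x * D = c * r * (c * x * l - 2 * b * l * y + a * y * r) - (a * r - 2 * b * l) * (a * l * x - 2 * b * x * r + c * r * y)"
    unfolding D_def by (simp add: algebra_simps power2_eq_square)
  moreover have "y * D = c * l * (a * l * x - 2 * b * x * r + c * r * y) - (a * l - 2 * b * r) * (c * x * l - 2 * b * l * y + a * y * r)"
    unfolding D_def by (simp add: algebra_simps power2_eq_square)
  ultimately have "x * D = 0" "y * D = 0" using assms(1,2) by simp_all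
  then have "D = 0" using nz by auto
  then show ?thesis unfolding D_def by (simp add: algebra_simps power2_eq_square)
qed

text \<open>For \<open>l = \<plusminus>r\<close> the condition would read \<open>(2 b \<mp> a)\<^sup>2 = c\<^sup>2\<close>, but \<open>2 b - a > c\<close>.\<close>

lemma tilted_velocity_unequal:
  fixes a b c l r :: real
  assumes pos: "a > 0" "b > 0" "c > 0" and g: "2 * b - a > c"
    and e: "2 * a * b * (l\<^sup>2 + r\<^sup>2) = (a\<^sup>2 + 4 * b\<^sup>2 - c\<^sup>2) * (l * r)" and nz: "l \<noteq> 0 \<or> r \<noteq> 0"
  shows "\<bar>l\<bar> \<noteq> \<bar>r\<bar>"
proof
  assume "\<bar>l\<bar> = \<bar>r\<bar>"
  then have "l = r \<or> l = - r" by (auto simp: abs_if split: if_splits)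
  then show False
  proof
    assume l: "l = r"
    then have "r * r \<noteq> 0" using nz by auto
    moreover have "(r * r) * ((2 * b - a)\<^sup>2 - c\<^sup>2) = 0" using e unfolding l by (simp add: algebra_simps power2_eq_square)
    ultimately have "(2 * b - a)\<^sup>2 = c\<^sup>2" by simp
    moreover have "c\<^sup>2 < (2 * b - a)\<^sup>2" using g pos by (intro power_strict_mono) auto
    ultimately show False by simp
  next
    assume l: "l = - r"
    then have "r * r \<noteq> 0" using nz by auto
    moreover have "(r * r) * ((2 * b + a)\<^sup>2 - c\<^sup>2) = 0" using e unfolding l by (simp add: algebra_simps power2_eq_square)
    ultimately have "(2 * b + a)\<^sup>2 = c\<^sup>2" by simp
    moreover have "c\<^sup>2 < (2 * b + a)\<^sup>2" using g pos by (intro power_strict_mono) auto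
    ultimately show False by simp
  qed
qed

text \<open>Let \<open>q\<close> be the quadratic form \<open>\<alpha> (x\<^sup>2 + y\<^sup>2) - 2 \<gamma> x y\<close> with polar form \<open>B\<close>, applied to the vectors
\<open>w\<^sub>i = (x\<^sub>i, y\<^sub>i) = (L\<^sub>i, R\<^sub>i)\<close> for \<open>i = 1, 2\<close>. The off-diagonal equations say that \<open>w\<^sub>1\<close> and \<open>w\<^sub>2\<close> are parallel
and that \<open>B w\<^sub>1 w\<^sub>2 = 0\<close>, the diagonal ones that \<open>q w\<^sub>1 = q w\<^sub>2\<close>. By the Gram identity
\<open>q w\<^sub>1 * q w\<^sub>2 - (B w\<^sub>1 w\<^sub>2)\<^sup>2 = (\<alpha>\<^sup>2 - \<gamma>\<^sup>2) (x\<^sub>1 y\<^sub>2 - x\<^sub>2 y\<^sub>1)\<^sup>2\<close> this gives \<open>q w\<^sub>1 = q w\<^sub>2 = 0\<close>, and \<open>q\<close> is positive definite because \<open>\<gamma> < \<alpha>\<close>.\<close>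

lemma spheroid_axial:
  fixes a :: "real^3"
  assumes rho: "rho0 > 0" and pos: "\<And>i. a $ i > 0" and eq: "a$1 = a$2" and lt: "a$3 < a$1"
    and bal: "balanced rho0 grav (diag a) (L, R)"
  shows "L = L$3 *\<^sub>R ax3" "R = R$3 *\<^sub>R ax3"
proof -
  define \<alpha> \<gamma> where "\<alpha> = a$1" and "\<gamma> = a$3"
  have ag: "\<alpha> > 0" "\<gamma> > 0" "\<gamma> < \<alpha>" "a$2 = \<alpha>" using pos[of 1] pos[of 3] lt eq by (auto simp: \<alpha>_def \<gamma>_def)
  have T: "metric_const rho0 > 0" using rho by (simp add: metric_const_def)
  note b = bal[unfolded balanced_diag_iff[OF pos rho]]
  define x1 y1 x2 y2 where "x1 = L$1" and "y1 = R$1" and "x2 = L$2" and "y2 = R$2"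
  have o: "\<alpha> * x1 * x2 - 2 * \<gamma> * x2 * y1 + \<alpha> * y1 * y2 = 0" "\<alpha> * x2 * x1 - 2 * \<gamma> * x1 * y2 + \<alpha> * y2 * y1 = 0"
    using b unfolding off_residual_def ag(4) \<alpha>_def[symmetric] \<gamma>_def[symmetric] x1_def x2_def y1_def y2_def by simp_all
  have "2 * \<gamma> * (x2 * y1 - x1 * y2) = 0" using o by (simp add: algebra_simps)
  then have par: "x2 * y1 = x1 * y2" using ag by simp
  define q1 q2 B where "q1 = \<alpha> * (x1\<^sup>2 + y1\<^sup>2) - 2 * \<gamma> * x1 * y1" and "q2 = \<alpha> * (x2\<^sup>2 + y2\<^sup>2) - 2 * \<gamma> * x2 * y2"
    and "B = \<alpha> * (x1 * x2 + y1 * y2) - \<gamma> * (x1 * y2 + x2 * y1)"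
  have "2 * B = 0" using o unfolding B_def by (simp add: algebra_simps)
  have "q1 * q2 - B\<^sup>2 = (\<alpha>\<^sup>2 - \<gamma>\<^sup>2) * (x1 * y2 - x2 * y1)\<^sup>2"
    unfolding q1_def q2_def B_def by (simp add: algebra_simps power2_eq_square)
  then have "q1 * q2 = 0" using par \<open>2 * B = 0\<close> by simp
  moreover have "q1 = q2"
  proof -
    have "diag_residual rho0 grav a L R 1 2 3 = diag_residual rho0 grav a L R 2 1 3" using b by simp
    then have "metric_const rho0 * (\<alpha> * (q1 - q2)) = 0"
      unfolding diag_residual_def ag(4) \<alpha>_def[symmetric] \<gamma>_def[symmetric] x1_def[symmetric] x2_def[symmetric] y1_def[symmetric] y2_def[symmetric] q1_def q2_def
      by (simp add: algebra_simps power2_eq_square)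
    then show ?thesis using T ag by simp
  qed
  ultimately have "q1 = 0" "q2 = 0" by auto
  have "x = 0 \<and> y = 0" if "\<alpha> * (x\<^sup>2 + y\<^sup>2) - 2 * \<gamma> * x * y = 0" for x y
  proof -
    have "(\<alpha> - \<gamma>) * (x\<^sup>2 + y\<^sup>2) + \<gamma> * (x - y)\<^sup>2 = 0" using that by (simp add: algebra_simps power2_eq_square)
    moreover have "(\<alpha> - \<gamma>) * (x\<^sup>2 + y\<^sup>2) \<ge> 0" "\<gamma> * (x - y)\<^sup>2 \<ge> 0" using ag by simp_all
    ultimately have "(\<alpha> - \<gamma>) * (x\<^sup>2 + y\<^sup>2) = 0" by linarith
    then show ?thesis using ag by (simp add: sum_power2_eq_zero_iff)
  qed
  then have "x1 = 0" "y1 = 0" "x2 = 0" "y2 = 0" using \<open>q1 = 0\<close> \<open>q2 = 0\<close> unfolding q1_def q2_def by blast+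
  then show "L = L$3 *\<^sub>R ax3" "R = R$3 *\<^sub>R ax3"
    by (simp_all add: vec_eq_iff forall_3 axis_def x1_def x2_def y1_def y2_def)
qed

lemma spheroid_is_maclaurin:
  fixes a :: "real^3"
  assumes rg: "rho0 > 0" "grav > 0" and pos: "\<And>i. a $ i > 0" and eq: "a$1 = a$2" and lt: "a$3 < a$1"
    and det: "a$1 * a$2 * a$3 = 1" and bal: "balanced rho0 grav (diag a) (l *\<^sub>R ax3, m *\<^sub>R ax3)" and lm: "l > m"
  obtains e where "0 < e" "e < 1" "eq_state rho0 a (l *\<^sub>R ax3, m *\<^sub>R ax3) = maclaurin rho0 grav e"
proof -
  define \<kappa> where "\<kappa> = (a$3)\<^sup>2 / (a$1)\<^sup>2"
  have k: "0 < \<kappa>" "\<kappa> < 1" using pos[of 1] pos[of 3] lt by (simp_all add: \<kappa>_def power_strict_mono)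
  define e where "e = sqrt (1 - \<kappa>)"
  have e: "0 < e" "e < 1" "1 - e\<^sup>2 = \<kappa>" using k by (auto simp: e_def)
  obtain \<alpha> \<gamma> where ax: "maclaurin_axes rho0 grav e \<alpha> \<gamma>"
    by (rule maclaurin_axes_exist[OF e(1,2) rg])
  note al = maclaurin_axesD(1-4)[OF ax]
  have cube: "x^6 = 1 / \<kappa>" if "x > 0" "x\<^sup>2 * y = 1" "y\<^sup>2 / x\<^sup>2 = \<kappa>" for x y :: real
  proof -
    have "y = 1 / x\<^sup>2" using that by (simp add: field_simps)
    then have "\<kappa> = 1 / x^6" using that by (simp add: power2_eq_square eval_nat_numeral)
    then show ?thesis by simp
  qed
  have "a$1 ^ 6 = 1 / \<kappa>" using det pos[of 1] by (intro cube[of "a$1" "a$3"]) (simp_all add: \<kappa>_def power2_eq_square eq)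
  moreover have "\<alpha> ^ 6 = 1 / \<kappa>" using al e(3) by (intro cube[of \<alpha> \<gamma>]) auto
  ultimately have a1: "a$1 = \<alpha>" using pos[of 1] al by (intro power_eq_imp_eq_base[of "a$1" 6]) auto
  have "\<alpha>\<^sup>2 * a$3 = \<alpha>\<^sup>2 * \<gamma>" using det eq a1 al(3) by (simp add: power2_eq_square)
  then have "a$3 = \<gamma>" using al(1,2) by simp
  then have as: "a = semi \<alpha> \<alpha> \<gamma>" using a1 eq by (simp add: vec_eq_iff forall_3)
  show ?thesis
    using that[OF e(1,2)] spheroid_start[OF e(1,2) rg ax bal[unfolded as] lm] unfolding as by blast
qed

text \<open>If the sense of rotation is opposite to that of the MacLaurin spheroid (\<open>l < m\<close>), then a half-turn about the
first axis reverses it.\<close>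

lemma spheroid_in_maclaurin_family:
  fixes a :: "real^3"
  assumes rg: "rho0 > 0" "grav > 0" and pos: "\<And>i. a $ i > 0" and eq: "a$1 = a$2" and lt: "a$3 < a$1"
    and det: "a$1 * a$2 * a$3 = 1" and bal: "balanced rho0 grav (diag a) (L, R)"
    and nz: "fund (L, R) (diag a) $ 1 $ 2 \<noteq> 0"
    and g: "rotation_matrix g" "rotation_matrix k"
    and F: "transform g k F = diag a" and P: "transform g k P = metric_const rho0 *\<^sub>R fund (L, R) (diag a)"
  shows "(F, P) \<in> maclaurin_family rho0 grav"
proof -
  define l m where "l = L$3" and "m = R$3"
  have LR: "L = l *\<^sub>R ax3" "R = m *\<^sub>R ax3" using spheroid_axial[OF rg(1) pos eq lt bal] by (simp_all add: l_def m_def)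
  have z: "(F, P) = (transform (transpose g) (transpose k) (diag a), transform (transpose g) (transpose k) (metric_const rho0 *\<^sub>R fund (L, R) (diag a)))"
    using transform_inverse[OF g, of F] transform_inverse[OF g, of P] unfolding F P by simp
  note gt = rotation_transpose[OF g(1)] rotation_transpose[OF g(2)]
  have "l \<noteq> m" using nz unfolding LR fund_diag_nth by (auto simp: axis_def eq)
  then consider "l > m" | "- l > - m" by linarith
  then show ?thesis
  proof cases
    case 1
    obtain e where e: "0 < e" "e < 1" "eq_state rho0 a (l *\<^sub>R ax3, m *\<^sub>R ax3) = maclaurin rho0 grav e"
      by (rule spheroid_is_maclaurin[OF rg pos eq lt det bal[unfolded LR] 1])
    have "(F, P) \<in> sym_orbit (eq_state rho0 a (l *\<^sub>R ax3, m *\<^sub>R ax3))"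
      unfolding z LR eq_state_def by (rule mem_orbit[OF gt])
    then show ?thesis unfolding e(3) maclaurin_family_def using e(1,2) by auto
  next
    case 2
    have b: "balanced rho0 grav (diag a) ((- l) *\<^sub>R ax3, (- m) *\<^sub>R ax3)"
      using bal unfolding LR type_S_balanced_iff(2)[OF pos det rg(1) eq] by (simp add: power2_commute)
    obtain e where e: "0 < e" "e < 1" "eq_state rho0 a ((- l) *\<^sub>R ax3, (- m) *\<^sub>R ax3) = maclaurin rho0 grav e"
      by (rule spheroid_is_maclaurin[OF rg pos eq lt det b 2])
    define h where "h = diag (vector [1, -1, -1])"
    have h: "rotation_matrix h" unfolding h_def by (rule rotation_diag3) simp_all
    have hD: "transform h h (diag a) = diag a"
      by (simp add: h_def transform_def transpose_diag mat3_eq_iff forall_3 diag_conj_nth diag_nth)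
    have hP: "transform h h (metric_const rho0 *\<^sub>R fund ((- l) *\<^sub>R ax3, (- m) *\<^sub>R ax3) (diag a)) = metric_const rho0 *\<^sub>R fund (L, R) (diag a)"
      by (simp add: h_def LR transform_def transpose_diag mat3_eq_iff forall_3 diag_conj_nth fund_diag_nth axis_def)
    have "(F, P) = (transform (transpose g ** h) (transpose k ** h) (diag a),
        transform (transpose g ** h) (transpose k ** h) (metric_const rho0 *\<^sub>R fund ((- l) *\<^sub>R ax3, (- m) *\<^sub>R ax3) (diag a)))"
      unfolding transform_transform[symmetric] hD hP by (rule z)
    moreover have "rotation_matrix (transpose g ** h)" "rotation_matrix (transpose k ** h)" using gt h rotation_mul by blast+
    ultimately have "(F, P) \<in> sym_orbit (eq_state rho0 a ((- l) *\<^sub>R ax3, (- m) *\<^sub>R ax3))"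
      unfolding eq_state_def using mem_orbit by metis
    then show ?thesis unfolding e(3) maclaurin_family_def using e(1,2) by auto
  qed
qed

text \<open>The strict inequalities at a spheroid that persist for nearby semiaxes. The last two transfer
a nonzero sign of \<open>crit 1\<close>; at the critical eccentricity they are vacuous.\<close>

definition shape_margin :: "real \<Rightarrow> real^3 \<Rightarrow> bool" where
  "shape_margin \<kappa> a \<longleftrightarrow>
     (let \<sigma> = ((a$1)\<^sup>2 + (a$2)\<^sup>2) / (a$1 * a$2); \<mu> = (a$3)\<^sup>2 / (a$1 * a$2) in
       2 * a$2 - a$1 > a$3 \<and> crit 1 \<sigma> \<mu> - 2 * crit 0 \<sigma> \<mu> > 0 \<and>
       (crit 1 2 \<kappa> < 0 \<longrightarrow> crit 1 \<sigma> \<mu> < 0) \<and> (crit 1 2 \<kappa> > 0 \<longrightarrow> crit 1 \<sigma> \<mu> > 0))"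

lemma near_spheroid_box:
  fixes \<alpha> \<gamma> :: real
  assumes al: "\<alpha> > \<gamma>" "\<gamma> > 0" and k: "\<gamma>\<^sup>2 / \<alpha>\<^sup>2 = \<kappa>"
  obtains \<epsilon> where "\<epsilon> > 0" "\<forall>a::real^3. \<bar>a$1 - \<alpha>\<bar> < \<epsilon> \<longrightarrow> \<bar>a$2 - \<alpha>\<bar> < \<epsilon> \<longrightarrow> \<bar>a$3 - \<gamma>\<bar> < \<epsilon> \<longrightarrow>
      shape_margin \<kappa> a"
proof -
  define \<sigma> \<mu> where "\<sigma> a = ((a$1)\<^sup>2 + (a$2)\<^sup>2) / (a$1 * a$2)" and "\<mu> a = (a$3)\<^sup>2 / (a$1 * a$2)" for a :: "real^3"
  define b where "b = semi \<alpha> \<alpha> \<gamma>"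
  have a0: "\<alpha> > 0" using al by simp
  have k0: "\<kappa> > 0" unfolding k[symmetric] using al a0 by simp
  have k1: "\<kappa> < 1" unfolding k[symmetric] using al a0 by (simp add: power_strict_mono)
  have nth: "((\<lambda>a. a $ i) \<longlongrightarrow> b $ i) (nhds b)" for i by (intro tendsto_vec_nth filterlim_ident)
  have "((\<lambda>a. ((a$1)\<^sup>2 + (a$2)\<^sup>2) / (a$1 * a$2)) \<longlongrightarrow> ((b$1)\<^sup>2 + (b$2)\<^sup>2) / (b$1 * b$2)) (nhds b)"
    using a0 by (intro tendsto_intros nth) (simp add: b_def)
  moreover have "((b$1)\<^sup>2 + (b$2)\<^sup>2) / (b$1 * b$2) = 2" using a0 by (simp add: b_def power2_eq_square)
  ultimately have s: "(\<sigma> \<longlongrightarrow> 2) (nhds b)" unfolding \<sigma>_def[abs_def] by simp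
  have "((\<lambda>a. (a$3)\<^sup>2 / (a$1 * a$2)) \<longlongrightarrow> (b$3)\<^sup>2 / (b$1 * b$2)) (nhds b)"
    using a0 by (intro tendsto_intros nth) (simp add: b_def)
  moreover have "(b$3)\<^sup>2 / (b$1 * b$2) = \<kappa>" using k by (simp add: b_def power2_eq_square)
  ultimately have c: "(\<mu> \<longlongrightarrow> \<kappa>) (nhds b)" unfolding \<mu>_def[abs_def] by simp
  have cr: "((\<lambda>a. crit \<theta> (\<sigma> a) (\<mu> a)) \<longlongrightarrow> crit \<theta> 2 \<kappa>) (nhds b)" for \<theta>
    using k0 by (intro tendsto_crit s c) auto
  have W: "((\<lambda>a. crit 1 (\<sigma> a) (\<mu> a) - 2 * crit 0 (\<sigma> a) (\<mu> a)) \<longlongrightarrow> crit 1 2 \<kappa> - 2 * crit 0 2 \<kappa>) (nhds b)"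
    by (intro tendsto_intros cr)
  \<comment> \<open>proportional to the squared angular velocity of the spheroid\<close>
  have W0: "crit 1 2 \<kappa> - 2 * crit 0 2 \<kappa> > 0"
  proof -
    have "crit 1 2 \<kappa> - 2 * crit 0 2 \<kappa> = (1 - \<kappa>) * (nmom 1 2 \<kappa> + nmom 2 2 \<kappa>)"
      unfolding crit_def by (simp add: algebra_simps)
    moreover have "nmom 1 2 \<kappa> > 0" "nmom 2 2 \<kappa> > 0" using k0 by (simp_all add: nmom_pos)
    ultimately show ?thesis using k1 by (simp add: add_pos_pos)
  qed
  have lin: "((\<lambda>a. 2 * a$2 - a$1 - a$3) \<longlongrightarrow> 2 * b$2 - b$1 - b$3) (nhds b)" by (intro tendsto_intros nth)
  have e1: "\<forall>\<^sub>F a in nhds b. 2 * a$2 - a$1 - a$3 > 0" by (rule order_tendstoD(1)[OF lin]) (use al in \<open>simp add: b_def\<close>)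
  have e2: "\<forall>\<^sub>F a in nhds b. crit 1 (\<sigma> a) (\<mu> a) - 2 * crit 0 (\<sigma> a) (\<mu> a) > 0" by (rule order_tendstoD(1)[OF W W0])
  have e3: "\<forall>\<^sub>F a in nhds b. crit 1 2 \<kappa> < 0 \<longrightarrow> crit 1 (\<sigma> a) (\<mu> a) < 0"
    using order_tendstoD(2)[OF cr[of 1], of 0] by (cases "crit 1 2 \<kappa> < 0") auto
  have e4: "\<forall>\<^sub>F a in nhds b. crit 1 2 \<kappa> > 0 \<longrightarrow> crit 1 (\<sigma> a) (\<mu> a) > 0"
    using order_tendstoD(1)[OF cr[of 1], of 0] by (cases "crit 1 2 \<kappa> > 0") auto
  have "\<forall>\<^sub>F a in nhds b. shape_margin \<kappa> a"
    using e1 e2 e3 e4 by eventually_elim (simp add: shape_margin_def \<sigma>_def \<mu>_def)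
  then obtain d where d: "d > 0" "\<And>a. dist a b < d \<Longrightarrow> shape_margin \<kappa> a"
    unfolding eventually_nhds_metric by blast
  show ?thesis
  proof (rule that[of "d / 3"], goal_cases)
    case 1
    show "d / 3 > 0" using d(1) by simp
  next
    case 2
    show ?case
    proof (intro allI impI)
      fix a :: "real^3" assume h: "\<bar>a$1 - \<alpha>\<bar> < d / 3" "\<bar>a$2 - \<alpha>\<bar> < d / 3" "\<bar>a$3 - \<gamma>\<bar> < d / 3"
      have "dist a b \<le> (\<Sum>i\<in>UNIV. \<bar>(a - b) $ i\<bar>)" unfolding dist_norm by (rule norm_le_l1_cart)
      also have "\<dots> < d" using h by (simp add: sum_3 b_def)
      finally show "shape_margin \<kappa> a" by (rule d(2))
    qed
  qed
qed

text \<open>After diagonalisation only three cases survive. Equal largest semiaxes belong to the MacLaurin family,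
a velocity component along the first or second axis gives type I, and an axial velocity requires \<open>crit 1 \<ge> 0\<close>
at the shape in question. The sign of \<open>crit 1\<close> at the spheroid is that of \<open>e\<^sub>c\<^sub>r\<^sub>i\<^sub>t - e0\<close>, which gives the
restrictions on \<open>e0\<close>.\<close>

lemma classification_near_maclaurin:
  assumes rg: "rho0 > 0" "grav > 0" and e0: "0 < e0" "e0 < 1"
  shows "\<forall>\<^sub>F z in at (maclaurin rho0 grav e0)
                 within {z. rel_equilibrium rho0 grav z} - maclaurin_family rho0 grav.
          ellipsoid_with rho0 grav type_I z \<and> isotropy z = {\<one>\<^bsub>sym_group\<^esub>}
        \<or> e0 \<le> e_crit rho0 grav \<and>
          ellipsoid_with rho0 grav
            (\<lambda>a xi. type_S a xi \<and> norm (fst xi) \<noteq> norm (snd xi)) z \<and>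
          (\<exists>w\<in>sym_orbit z. isotropy w = K_S)
        \<or> e0 = e_crit rho0 grav \<and>
          ellipsoid_with rho0 grav adjoint_S z \<and>
          (\<exists>w\<in>sym_orbit z. isotropy w = K_adj)" (is "eventually ?C _")
proof -
  obtain \<alpha> \<gamma> where ax: "maclaurin_axes rho0 grav e0 \<alpha> \<gamma>"
    by (rule maclaurin_axes_exist[OF e0 rg])
  note al = maclaurin_axesD(1-4)[OF ax] and mac = maclaurin_axesD(5)[OF ax]
  have T: "metric_const rho0 > 0" using rg by (simp add: metric_const_def)
  have p0: "metric_const rho0 * maclaurin_Omega rho0 grav e0 * \<alpha> \<noteq> 0"
    using T maclaurin_Omega_eq(2)[OF e0 rg] al by simp
  obtain \<epsilon> where eps: "\<epsilon> > 0" and box: "\<forall>a::real^3. \<bar>a$1 - \<alpha>\<bar> < \<epsilon> \<longrightarrow> \<bar>a$2 - \<alpha>\<bar> < \<epsilon> \<longrightarrow> \<bar>a$3 - \<gamma>\<bar> < \<epsilon> \<longrightarrow>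
      shape_margin (1 - e0\<^sup>2) a"
    by (rule near_spheroid_box[OF al(1,2,4)])
  show ?thesis
    unfolding eventually_at_filter mac
  proof (rule eventually_mono[OF singular_values_near_spheroid[OF al(1-3) p0 eps, unfolded semi_vector]], intro impI)
    fix z
    assume good: "\<forall>g k a. rotation_matrix g \<longrightarrow> rotation_matrix k \<longrightarrow> transform g k (fst z) = diag a \<longrightarrow>
       a$1 \<ge> a$2 \<longrightarrow> a$2 \<ge> a$3 \<longrightarrow> a$3 > 0 \<longrightarrow>
       \<bar>a$1 - \<alpha>\<bar> < \<epsilon> \<and> \<bar>a$2 - \<alpha>\<bar> < \<epsilon> \<and> \<bar>a$3 - \<gamma>\<bar> < \<epsilon> \<and> transform g k (snd z) $ 1 $ 2 \<noteq> 0"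
      and zin: "z \<in> {z. rel_equilibrium rho0 grav z} - maclaurin_family rho0 grav"
    obtain F P where z: "z = (F, P)" by (cases z) auto
    obtain xi where re: "rel_equilibrium_vel rho0 grav (F, P) xi" using zin unfolding z rel_equilibrium_def by auto
    then have F1: "det F = 1" and P: "P = metric_const rho0 *\<^sub>R fund xi F" and bF: "balanced rho0 grav F xi"
      unfolding rel_equilibrium_vel_iff[OF rg(1)] by auto
    obtain g k a where g: "rotation_matrix g" "rotation_matrix k" and Fa: "transform g k F = diag a"
      and o: "a$1 \<ge> a$2" "a$2 \<ge> a$3" "a$3 > 0"
      by (rule singular_values[OF F1])
    define L R where "L = g *v fst xi" and "R = k *v snd xi"
    have bal: "balanced rho0 grav (diag a) (L, R)"
      using balanced_transform[OF g bF] unfolding Fa L_def R_def .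
    have Pa: "transform g k P = metric_const rho0 *\<^sub>R fund (L, R) (diag a)"
      unfolding P transform_scaleR fund_transform[OF g, symmetric] Fa L_def R_def ..
    have near: "\<bar>a$1 - \<alpha>\<bar> < \<epsilon>" "\<bar>a$2 - \<alpha>\<bar> < \<epsilon>" "\<bar>a$3 - \<gamma>\<bar> < \<epsilon>" and P12: "transform g k P $ 1 $ 2 \<noteq> 0"
      using good g Fa o unfolding z fst_conv snd_conv by blast+
    note bx = box[rule_format, OF near, unfolded shape_margin_def Let_def]
    have pos: "a $ i > 0" for i using pos_all3[of a i] o by simp
    have det: "a$1 * a$2 * a$3 = 1" using det_transform[OF g, of F] unfolding Fa F1 det_diag3 .
    have lt23: "a$3 < a$2" using bx o(1) by linarith
    have nz: "fund (L, R) (diag a) $ 1 $ 2 \<noteq> 0" using P12 unfolding Pa by auto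
    have ne: "a$1 \<noteq> a$2"
    proof
      assume eq: "a$1 = a$2"
      have "(F, P) \<in> maclaurin_family rho0 grav"
        by (rule spheroid_in_maclaurin_family[OF rg pos eq _ det bal nz g Fa Pa]) (use lt23 eq in simp)
      then show False using zin unfolding z by simp
    qed
    have inj: "inj (($) a)" by (rule inj_nth3) (use ne lt23 o in auto)
    define w where "w = eq_state rho0 a (L, R)"
    have we: "w = (transform g k F, transform g k P)" unfolding w_def eq_state_def Fa Pa ..
    have wo: "w \<in> sym_orbit z" unfolding we z by (rule mem_orbit[OF g])
    have ell: "ellipsoid_with rho0 grav Q z" if "Q a (L, R)" for Q
    proof -
      have "card (range (\<lambda>i. a $ i)) = 3" using card_image[OF inj] by simp
      moreover have "rel_equilibrium_vel rho0 grav w (L, R)"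
        unfolding w_def rel_equilibrium_eq_state[OF rg(1) det] by (rule bal)
      ultimately show ?thesis unfolding ellipsoid_with_def using wo pos that unfolding w_def eq_state_def by blast
    qed
    have iso: "isotropy z = {\<one>\<^bsub>sym_group\<^esub>}" if "isotropy w = {\<one>\<^bsub>sym_group\<^esub>}"
      unfolding z by (rule isotropy_trivial_transform[OF g]) (use that we in simp)
    have T0: "metric_const rho0 \<noteq> 0" using T by simp
    note b = bal[unfolded balanced_diag_iff[OF pos rg(1)]]
    have c13: "2 * a$1 * a$2 * ((L$3)\<^sup>2 + (R$3)\<^sup>2) = ((a$1)\<^sup>2 + 4 * (a$2)\<^sup>2 - (a$3)\<^sup>2) * (L$3 * R$3)" if "L$1 \<noteq> 0 \<or> R$1 \<noteq> 0"
      by (rule tilted_velocity_condition[OF _ _ that]) (use b in \<open>simp_all add: off_residual_def\<close>)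
    have c23: "2 * a$2 * a$1 * ((L$3)\<^sup>2 + (R$3)\<^sup>2) = ((a$2)\<^sup>2 + 4 * (a$1)\<^sup>2 - (a$3)\<^sup>2) * (L$3 * R$3)" if "L$2 \<noteq> 0 \<or> R$2 \<noteq> 0"
      by (rule tilted_velocity_condition[OF _ _ that]) (use b in \<open>simp_all add: off_residual_def\<close>)
    \<comment> \<open>the momentum is close to that of the spheroid\<close>
    have nz3: "L$3 \<noteq> 0 \<or> R$3 \<noteq> 0" using nz unfolding fund_diag_nth by auto
    \<comment> \<open>components along both axes would give two conditions that differ only by an exchange of \<open>a\<^sub>1\<close> and \<open>a\<^sub>2\<close>\<close>
    have one_zero: "(L$1 = 0 \<and> R$1 = 0) \<or> (L$2 = 0 \<and> R$2 = 0)"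
    proof (rule ccontr)
      assume both: "\<not> ?thesis"
      then have "((a$1)\<^sup>2 + 4 * (a$2)\<^sup>2 - (a$3)\<^sup>2) * (L$3 * R$3) = ((a$2)\<^sup>2 + 4 * (a$1)\<^sup>2 - (a$3)\<^sup>2) * (L$3 * R$3)"
        using c13 c23 by (simp add: mult.commute mult.left_commute)
      then have "L$3 = 0 \<or> R$3 = 0 \<or> (a$2)\<^sup>2 = (a$1)\<^sup>2" by simp
      moreover have "(a$2)\<^sup>2 < (a$1)\<^sup>2" using ne o(1) pos[of 2] by (intro power_strict_mono) auto
      ultimately have z0: "L$3 * R$3 = 0" by auto
      have "2 * a$1 * a$2 * ((L$3)\<^sup>2 + (R$3)\<^sup>2) = 0" using c13 both z0 by auto
      then have "(L$3)\<^sup>2 + (R$3)\<^sup>2 = 0" using pos[of 1] pos[of 2] by simp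
      then show False using nz3 by (simp add: sum_power2_eq_zero_iff)
    qed
    show "?C z"
    proof (cases "L$1 = 0 \<and> R$1 = 0 \<and> L$2 = 0 \<and> R$2 = 0")
      case False
      have "type_I a (L, R) \<and> isotropy w = {\<one>\<^bsub>sym_group\<^esub>}"
      proof (cases "L$2 = 0 \<and> R$2 = 0")
        case True
        then have n1: "L$1 \<noteq> 0 \<or> R$1 \<noteq> 0" using False by auto
        have "type_I a (L, R)"
          by (rule type_I_in_plane[of 1 3 2]) (use True n1 nz3 bx exhaust_3 in auto)
        moreover have "isotropy w = {\<one>\<^bsub>sym_group\<^esub>}" unfolding w_def eq_state_def
          by (rule isotropy_trivial[OF pos inj T0, of 1 3 _ _ 3])
            (use n1 nz3 tilted_velocity_unequal[OF pos pos pos _ c13[OF n1] nz3] bx in auto)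
        ultimately show ?thesis ..
      next
        case n2: False
        then have n2: "L$2 \<noteq> 0 \<or> R$2 \<noteq> 0" by auto
        then have z1: "L$1 = 0" "R$1 = 0" using one_zero by auto
        have "type_I a (L, R)"
          by (rule type_I_in_plane[of 2 3 1]) (use z1 n2 nz3 o lt23 exhaust_3 in auto)
        moreover have "isotropy w = {\<one>\<^bsub>sym_group\<^esub>}" unfolding w_def eq_state_def
          by (rule isotropy_trivial[OF pos inj T0, of 2 3 _ _ 3])
            (use n2 nz3 tilted_velocity_unequal[OF pos pos pos _ c23[OF n2] nz3] o lt23 in auto)
        ultimately show ?thesis ..
      qed
      then show ?thesis using ell iso by blast
    next
      case True
      define l m where "l = L$3" and "m = R$3"
      have LR: "L = l *\<^sub>R ax3" "R = m *\<^sub>R ax3" using True by (simp_all add: vec_eq_iff forall_3 axis_def l_def m_def)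
      define c where "c = vel_scale rho0 grav (a$1 * a$2)"
      have "R_const rho0 grav > 0" using rg by (simp add: R_const_def)
      then have c0: "c > 0" unfolding c_def vel_scale_def using T pos[of 1] pos[of 2] by simp
      define C1 C0 where "C1 = crit 1 (((a$1)\<^sup>2 + (a$2)\<^sup>2) / (a$1 * a$2)) ((a$3)\<^sup>2 / (a$1 * a$2))"
        and "C0 = crit 0 (((a$1)\<^sup>2 + (a$2)\<^sup>2) / (a$1 * a$2)) ((a$3)\<^sup>2 / (a$1 * a$2))"
      have lm: "(l + m)\<^sup>2 = c * C1" "(l - m)\<^sup>2 = c * (C1 - 2 * C0)"
        using bal unfolding LR type_S_balanced_iff(1)[OF pos det rg(1) ne] c_def C1_def C0_def by auto
      have bx': "C1 - 2 * C0 > 0" "crit 1 2 (1 - e0\<^sup>2) < 0 \<longrightarrow> C1 < 0" "crit 1 2 (1 - e0\<^sup>2) > 0 \<longrightarrow> C1 > 0"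
        using bx unfolding C1_def C0_def by auto
      have "c * C1 \<ge> 0" unfolding lm(1)[symmetric] by simp
      then have "C1 \<ge> 0" using c0 by (simp add: zero_le_mult_iff)
      then have "crit 1 2 (1 - e0\<^sup>2) \<ge> 0" using bx' by linarith
      then have ecr: "e0 \<le> e_crit rho0 grav"
        using e_crit_sign(2)[OF rg, of e0] e_crit_sign(3)[OF rg, of e0] e0 by fastforce
      have "(l - m)\<^sup>2 > 0" unfolding lm(2) using c0 bx' by simp
      then have lnm: "l \<noteq> m" by auto
      show ?thesis
      proof (cases "\<bar>l\<bar> = \<bar>m\<bar>")
        case False
        have "isotropy w = K_S" unfolding w_def eq_state_def LR by (rule isotropy_type_S(1)[OF pos inj T0 False])
        moreover have "ellipsoid_with rho0 grav (\<lambda>a xi. type_S a xi \<and> norm (fst xi) \<noteq> norm (snd xi)) z"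
          by (rule ell) (use False in \<open>simp add: LR type_S_axial norm_axial\<close>)
        ultimately show ?thesis using ecr wo by blast
      next
        case True
        then have ml: "m = - l" using lnm by (auto simp: abs_if split: if_splits)
        then have l0: "l \<noteq> 0" using lnm by auto
        have R: "R = - (l *\<^sub>R ax3)" unfolding LR ml by simp
        have "C1 = 0" using lm(1) c0 ml by simp
        then have "crit 1 2 (1 - e0\<^sup>2) = 0" using bx' by linarith
        then have "e0 = e_crit rho0 grav" using e_crit_sign(3)[OF rg, of e0] e0 by simp
        moreover have "isotropy w = K_adj" unfolding w_def eq_state_def R LR(1) by (rule isotropy_adjoint_S(1)[OF pos inj T0 l0])
        moreover have "ellipsoid_with rho0 grav adjoint_S z"
          by (rule ell) (use type_S_axial[of a l m] l0 in \<open>simp add: adjoint_S_def LR ml axial_eq_0\<close>)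
        ultimately show ?thesis using wo by blast
      qed
    qed
  qed
qed


section \<open>The bifurcations from the MacLaurin family\<close>

theorem mainTheorem1:
  fixes rho0 grav :: real
  assumes "rho0 > 0" and "grav > 0"
  shows
    "(\<forall>e0\<in>{0<..<1}. \<exists>f :: real^2 \<Rightarrow> phase.
        bifurcating_family rho0 grav e0
          (\<lambda>z. isotropy z = {\<one>\<^bsub>sym_group\<^esub>} \<and> ellipsoid_with rho0 grav type_I z) f)
   \<and> (\<forall>e0\<in>{0<..<e_crit rho0 grav}. \<exists>f :: real^2 \<Rightarrow> phase.
        bifurcating_family rho0 grav e0
          (\<lambda>z. isotropy z = K_S \<and> card (isotropy z) = 2 \<and>
               ellipsoid_with rho0 grav
                 (\<lambda>a xi. type_S a xi \<and> fst xi \<noteq> 0 \<and> snd xi \<noteq> 0 \<and>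
                         norm (fst xi) \<noteq> norm (snd xi)) z) f)
   \<and> (\<exists>f :: real \<Rightarrow> phase.
        bifurcating_family rho0 grav (e_crit rho0 grav)
          (\<lambda>z. isotropy z = K_adj \<and> card (isotropy z) = 4 \<and>
               ellipsoid_with rho0 grav adjoint_S z) f)
   \<and> (\<forall>e0\<in>{0<..<1}.
        \<forall>\<^sub>F z in at (maclaurin rho0 grav e0)
                 within {z. rel_equilibrium rho0 grav z} - maclaurin_family rho0 grav.
          ellipsoid_with rho0 grav type_I z \<and> isotropy z = {\<one>\<^bsub>sym_group\<^esub>}
        \<or> e0 \<le> e_crit rho0 grav \<and>
          ellipsoid_with rho0 grav
            (\<lambda>a xi. type_S a xi \<and> norm (fst xi) \<noteq> norm (snd xi)) z \<and>
          (\<exists>w\<in>sym_orbit z. isotropy w = K_S)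
        \<or> e0 = e_crit rho0 grav \<and>
          ellipsoid_with rho0 grav adjoint_S z \<and>
          (\<exists>w\<in>sym_orbit z. isotropy w = K_adj))"
proof (intro conjI ballI)
  fix e0 :: real assume e0: "e0 \<in> {0<..<1}"
  show "\<exists>f :: real^2 \<Rightarrow> phase. bifurcating_family rho0 grav e0
      (\<lambda>z. isotropy z = {\<one>\<^bsub>sym_group\<^esub>} \<and> ellipsoid_with rho0 grav type_I z) f"
    by (rule type_I_bifurcation[OF _ _ assms]) (use e0 in auto)
next
  fix e0 :: real assume e0: "e0 \<in> {0<..<e_crit rho0 grav}"
  show "\<exists>f :: real^2 \<Rightarrow> phase. bifurcating_family rho0 grav e0
      (\<lambda>z. isotropy z = K_S \<and> card (isotropy z) = 2 \<and>
           ellipsoid_with rho0 grav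
             (\<lambda>a xi. type_S a xi \<and> fst xi \<noteq> 0 \<and> snd xi \<noteq> 0 \<and>
                     norm (fst xi) \<noteq> norm (snd xi)) z) f"
    by (rule type_S_bifurcation[OF assms]) (use e0 in auto)
next
  show "\<exists>f :: real \<Rightarrow> phase. bifurcating_family rho0 grav (e_crit rho0 grav)
      (\<lambda>z. isotropy z = K_adj \<and> card (isotropy z) = 4 \<and> ellipsoid_with rho0 grav adjoint_S z) f"
    by (rule adjoint_S_bifurcation[OF assms])
next
  fix e0 :: real assume e0: "e0 \<in> {0<..<1}"
  show "\<forall>\<^sub>F z in at (maclaurin rho0 grav e0)
                 within {z. rel_equilibrium rho0 grav z} - maclaurin_family rho0 grav.
          ellipsoid_with rho0 grav type_I z \<and> isotropy z = {\<one>\<^bsub>sym_group\<^esub>}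
        \<or> e0 \<le> e_crit rho0 grav \<and>
          ellipsoid_with rho0 grav
            (\<lambda>a xi. type_S a xi \<and> norm (fst xi) \<noteq> norm (snd xi)) z \<and>
          (\<exists>w\<in>sym_orbit z. isotropy w = K_S)
        \<or> e0 = e_crit rho0 grav \<and>
          ellipsoid_with rho0 grav adjoint_S z \<and>
          (\<exists>w\<in>sym_orbit z. isotropy w = K_adj)"
    by (rule classification_near_maclaurin[OF assms]) (use e0 in auto)
qed

end
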